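(* Let $f$ be a Lattès-type map with orbifold type $(2,2,2,2)$, and let $A$ be the corresponding linear map from $\mathbb R^2$ to $\mathbb R^2$. Then the combinatorial expansion factor $\Lambda_0(f)$ equals the minimum absolute value of the eigenvalues of $A$.
   Context: $S^2$ is an oriented topological $2$-sphere. A branched covering map $f\colon S^2\to S^2$ is a continuous map that near each point $p$ has the form $z\mapsto z^{d}$, $d=\deg_f(p)\ge1$, in suitable orientation-preserving local coordinates centered at $p$ and $f(p)$; $p$ is critical if $\deg_f(p)\ge2$. $\mathrm{post}(f)=\bigcup_{n\ge1}\{f^n(c): c\text{ critical point of }f\}$. A Thurston map is a branched covering map of degree at least $2$ with $\mathrm{post}(f)$ finite; it is expanding if for some Jordan curve $\mathcal C\supset\mathrm{post}(f)$ the maximal diameter of the components of $f^{-n}(S^2\setminus\mathcal C)$ tends to $0$ as $n\to\infty$. Lattès-type maps: let $\mathcal L\subset\mathbb R^2$ be a rank-$2$ lattice and $T=\mathbb R^2/\mathcal L$. A torus endomorphism $\bar A\colon T\to T$ is a map induced by an orientation-preserving affine map of $\mathbb R^2$ sending points that differ by an element of $\mathcal L$ to points that differ by an element of $\mathcal L$; it is a torus automorphism if bijective. Its eigenvalues are those of the linear part of the affine map. A branched cover $\Theta\colon T\to S^2$ is induced by a rigid action of a group $G$ on $T$ if every $g\in G$ acts as a torus automorphism and $\Theta(t)=\Theta(t')$ if and only if $t=g(t')$ for some $g\in G$. A map $f\colon S^2\to S^2$ is a Lattès-type map if $f\circ\Theta=\Theta\circ\bar A$ for some torus endomorphism $\bar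 A$ of some $T$ all of whose eigenvalues have absolute value $>1$ and some branched covering map $\Theta\colon T\to S^2$ induced by a rigid action of a finite cyclic group. The linear map corresponding to $f$ is the linear part of an affine map of $\mathbb R^2$ inducing $\bar A$. Every Lattès-type map is an expanding Thurston map. Orbifold type: let $\nu_f\colon S^2\to\mathbb N\cup\{\infty\}$ be the smallest function (for pointwise divisibility) such that $\nu_f(p)\deg_f(p)$ divides $\nu_f(f(p))$ for all $p\in S^2$. If $\mathrm{post}(f)=\{p_1,\dots,p_m\}$, the orbifold type of $f$ is $(\nu_f(p_1),\dots,\nu_f(p_m))$. Combinatorial expansion factor: let $\mathcal C\subset S^2$ be a Jordan curve containing $\mathrm{post}(f)$. The $n$-tiles are the closures of the connected components of $S^2\setminus f^{-n}(\mathcal C)$; the $0$-edges are the closed arcs into which $\mathrm{post}(f)$ divides $\mathcal C$. A set joins opposite sides of $\mathcal C$ if $\#\mathrm{post}(f)\ge4$ and it meets two disjoint $0$-edges, or $\#\mathrm{post}(f)=3$ and it meets all three $0$-edges. $D_n(f,\mathcal C)$ is the minimal number of $n$-tiles whose union is connected and joins opposite sides of $\mathcal C$. For an expanding Thurston map, $\Lambda_0(f)=\lim_{n\to\infty}D_n(f,\mathcal C)^{1/n}$; this limit exists and does not depend on $\mathcal C$. *)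

theory Defs
  imports
    "HOL-Complex_Analysis.Complex_Analysis"
    "HOL-Algebra.Group_Action"
    "HOL-Algebra.Elementary_Groups"
    "HOL-Library.Extended_Nat"
begin

section \<open>Oriented surfaces and branched covering maps\<close>

type_synonym 'a chart = "'a set \<times> ('a \<Rightarrow> complex)"

definition is_chart :: "'a topology \<Rightarrow> 'a chart \<Rightarrow> bool" where
  "is_chart X = (\<lambda>(U, \<phi>). openin X U \<and> open (\<phi> ` U) \<and>
      homeomorphic_map (subtopology X U) (top_of_set (\<phi> ` U)) \<phi>)"

text \<open>The transition map is only a homeomorphism between open subsets of the plane, so it is
  called orientation preserving when it has local degree 1: the image of a small positively
  oriented circle around \<open>z\<close> winds once around the image of \<open>z\<close>.\<close>

definition orientation_compatible :: "'a chart \<Rightarrow> 'a chart \<Rightarrow> bool" where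
  "orientation_compatible = (\<lambda>(U, \<phi>) (V, \<psi>).
      \<forall>z r. 0 < r \<longrightarrow> cball z r \<subseteq> \<phi> ` (U \<inter> V) \<longrightarrow>
        winding_number (\<psi> \<circ> inv_into U \<phi> \<circ> circlepath z r) (\<psi> (inv_into U \<phi> z)) = 1)"

definition oriented_atlas :: "'a topology \<Rightarrow> 'a chart set \<Rightarrow> bool" where
  "oriented_atlas X \<A> \<longleftrightarrow>
      (\<forall>c\<in>\<A>. is_chart X c) \<and> \<Union> (fst ` \<A>) = topspace X \<and>
      (\<forall>c\<in>\<A>. \<forall>c'\<in>\<A>. orientation_compatible c c')"

text \<open>The orientation-preserving local coordinates of the surface oriented by \<open>\<A>\<close>.\<close>

definition oriented_chart :: "'a topology \<Rightarrow> 'a chart set \<Rightarrow> 'a chart \<Rightarrow> bool" where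
  "oriented_chart X \<A> c \<longleftrightarrow> is_chart X c \<and> (\<forall>c'\<in>\<A>. orientation_compatible c c')"

definition oriented_sphere :: "'a topology \<Rightarrow> 'a chart set \<Rightarrow> bool" where
  "oriented_sphere X \<A> \<longleftrightarrow>
      X homeomorphic_space top_of_set (sphere (0 :: real^3) 1) \<and> oriented_atlas X \<A>"

definition has_local_degree ::
  "'a topology \<Rightarrow> 'a chart set \<Rightarrow> 'b topology \<Rightarrow> 'b chart set \<Rightarrow> ('a \<Rightarrow> 'b) \<Rightarrow> 'a \<Rightarrow> nat \<Rightarrow> bool" where
  "has_local_degree X \<A> Y \<B> f p d \<longleftrightarrow> d \<ge> 1 \<and>
      (\<exists>U \<phi> V \<psi>. oriented_chart X \<A> (U, \<phi>) \<and> p \<in> U \<and> \<phi> p = 0 \<and>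
                 oriented_chart Y \<B> (V, \<psi>) \<and> f p \<in> V \<and> \<psi> (f p) = 0 \<and>
                 f ` U \<subseteq> V \<and> (\<forall>x\<in>U. \<psi> (f x) = \<phi> x ^ d))"

definition branched_covering_map ::
  "'a topology \<Rightarrow> 'a chart set \<Rightarrow> 'b topology \<Rightarrow> 'b chart set \<Rightarrow> ('a \<Rightarrow> 'b) \<Rightarrow> bool" where
  "branched_covering_map X \<A> Y \<B> f \<longleftrightarrow>
      continuous_map X Y f \<and> (\<forall>p\<in>topspace X. \<exists>d. has_local_degree X \<A> Y \<B> f p d)"

definition local_degree :: "'a topology \<Rightarrow> 'a chart set \<Rightarrow> ('a \<Rightarrow> 'a) \<Rightarrow> 'a \<Rightarrow> nat" where
  "local_degree X \<A> f p = (THE d. has_local_degree X \<A> X \<A> f p d)"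

definition critical_points :: "'a topology \<Rightarrow> 'a chart set \<Rightarrow> ('a \<Rightarrow> 'a) \<Rightarrow> 'a set" where
  "critical_points X \<A> f = {p \<in> topspace X. local_degree X \<A> f p \<ge> 2}"

definition post :: "'a topology \<Rightarrow> 'a chart set \<Rightarrow> ('a \<Rightarrow> 'a) \<Rightarrow> 'a set" where
  "post X \<A> f = {(f ^^ n) c | n c. n \<ge> 1 \<and> c \<in> critical_points X \<A> f}"


section \<open>Orbifold type\<close>

text \<open>Among nonzero values, \<open>dvd\<close> on \<^typ>\<open>enat\<close> is the divisibility relation on the positive
  integers together with infinity: everything divides infinity, and infinity divides only itself.
  Zero is excluded because it is a further multiple of everything.\<close>

definition ramification_admissible ::
  "'a topology \<Rightarrow> 'a chart set \<Rightarrow> ('a \<Rightarrow> 'a) \<Rightarrow> ('a \<Rightarrow> enat) \<Rightarrow> bool" where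
  "ramification_admissible X \<A> f \<nu> \<longleftrightarrow>
      (\<forall>p\<in>topspace X. \<nu> p \<noteq> 0 \<and> \<nu> p * enat (local_degree X \<A> f p) dvd \<nu> (f p))"

definition is_ramification_function ::
  "'a topology \<Rightarrow> 'a chart set \<Rightarrow> ('a \<Rightarrow> 'a) \<Rightarrow> ('a \<Rightarrow> enat) \<Rightarrow> bool" where
  "is_ramification_function X \<A> f \<nu> \<longleftrightarrow> ramification_admissible X \<A> f \<nu> \<and>
      (\<forall>\<mu>. ramification_admissible X \<A> f \<mu> \<longrightarrow> (\<forall>p\<in>topspace X. \<nu> p dvd \<mu> p))"

definition has_orbifold_type ::
  "'a topology \<Rightarrow> 'a chart set \<Rightarrow> ('a \<Rightarrow> 'a) \<Rightarrow> enat list \<Rightarrow> bool" where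
  "has_orbifold_type X \<A> f ks \<longleftrightarrow>
      (\<exists>\<nu> ps. is_ramification_function X \<A> f \<nu> \<and>
         distinct ps \<and> set ps = post X \<A> f \<and> map \<nu> ps = ks)"


section \<open>Tori and their endomorphisms\<close>

definition rank2_lattice :: "(real^2) set \<Rightarrow> bool" where
  "rank2_lattice L \<longleftrightarrow> (\<exists>u v. u \<noteq> v \<and> independent {u, v} \<and>
      L = {of_int m *\<^sub>R u + of_int n *\<^sub>R v | m n. True})"

definition torus_proj :: "(real^2) set \<Rightarrow> real^2 \<Rightarrow> (real^2) set" where
  "torus_proj L x = {y. y - x \<in> L}"

definition torus :: "(real^2) set \<Rightarrow> (real^2) set topology" where
  "torus L = topology (\<lambda>U. U \<subseteq> range (torus_proj L) \<and> open (torus_proj L -` U))"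

lemma openin_torus:
  "openin (torus L) U \<longleftrightarrow> U \<subseteq> range (torus_proj L) \<and> open (torus_proj L -` U)"
proof -
  have "istopology (\<lambda>U. U \<subseteq> range (torus_proj L) \<and> open (torus_proj L -` U))"
    unfolding istopology_def by (auto simp: vimage_Union)
  then show ?thesis
    by (simp add: torus_def topology_inverse')
qed

lemma topspace_torus: "topspace (torus L) = range (torus_proj L)"
proof
  show "topspace (torus L) \<subseteq> range (torus_proj L)"
    by (auto simp: topspace_def openin_torus)
  have "openin (torus L) (range (torus_proj L))"
    by (simp add: openin_torus vimage_def)
  then show "range (torus_proj L) \<subseteq> topspace (torus L)"
    by (rule openin_subset)
qed

lemma quotient_map_torus_proj: "quotient_map euclidean (torus L) (torus_proj L)"
  by (auto simp: quotient_map_def topspace_torus openin_torus vimage_def)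

definition complex_of_plane :: "real^2 \<Rightarrow> complex" where
  "complex_of_plane x = Complex (x $ 1) (x $ 2)"

text \<open>The orientation of the torus inherited from the plane: the charts are the local inverses of
  the projection.\<close>

definition torus_atlas :: "(real^2) set \<Rightarrow> (real^2) set chart set" where
  "torus_atlas L = {(torus_proj L ` W, complex_of_plane \<circ> inv_into W (torus_proj L)) | W.
      open W \<and> inj_on (torus_proj L) W}"

text \<open>\<open>torus_endomorphism_of L g A\<close>: the map \<open>g\<close> is induced by an orientation-preserving affine map
  with linear part \<open>A\<close> that respects the equivalence relation defined by \<open>L\<close>.\<close>

definition torus_endomorphism_of ::
  "(real^2) set \<Rightarrow> ((real^2) set \<Rightarrow> (real^2) set) \<Rightarrow> (real^2 \<Rightarrow> real^2) \<Rightarrow> bool" where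
  "torus_endomorphism_of L g A \<longleftrightarrow> linear A \<and> det (matrix A) > 0 \<and>
      (\<exists>b. (\<forall>x y. x - y \<in> L \<longrightarrow> (A x + b) - (A y + b) \<in> L) \<and>
           (\<forall>x. g (torus_proj L x) = torus_proj L (A x + b)))"

definition torus_automorphism ::
  "(real^2) set \<Rightarrow> ((real^2) set \<Rightarrow> (real^2) set) \<Rightarrow> bool" where
  "torus_automorphism L g \<longleftrightarrow> (\<exists>A. torus_endomorphism_of L g A) \<and>
      bij_betw g (topspace (torus L)) (topspace (torus L))"

text \<open>The real and non-real eigenvalues of a linear endomorphism of the real plane.\<close>

definition eigenvalues :: "(real^2 \<Rightarrow> real^2) \<Rightarrow> complex set" where
  "eigenvalues A = {k. \<exists>v :: complex^2. v \<noteq> 0 \<and>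
      map_matrix complex_of_real (matrix A) *v v = k *s v}"


section \<open>Lattes-type maps\<close>

definition induced_by_rigid_action ::
  "(real^2) set \<Rightarrow> 'g monoid \<Rightarrow> ('g \<Rightarrow> (real^2) set \<Rightarrow> (real^2) set) \<Rightarrow> ((real^2) set \<Rightarrow> 'a) \<Rightarrow> bool" where
  "induced_by_rigid_action L G act \<Theta> \<longleftrightarrow>
      group_action G (topspace (torus L)) act \<and>
      (\<forall>g\<in>carrier G. torus_automorphism L (act g)) \<and>
      (\<forall>t\<in>topspace (torus L). \<forall>t'\<in>topspace (torus L).
         \<Theta> t = \<Theta> t' \<longleftrightarrow> (\<exists>g\<in>carrier G. t = act g t'))"

text \<open>\<open>lattes_linear_map X \<A> f A\<close>: some presentation of \<open>f\<close> as a Lattes-type map has a torus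
  endomorphism with linear part \<open>A\<close>. The group \<open>G\<close> may be taken to have integer elements since every
  finite cyclic group is isomorphic to such a group.\<close>

definition lattes_linear_map ::
  "'a topology \<Rightarrow> 'a chart set \<Rightarrow> ('a \<Rightarrow> 'a) \<Rightarrow> (real^2 \<Rightarrow> real^2) \<Rightarrow> bool" where
  "lattes_linear_map X \<A> f A \<longleftrightarrow> f \<in> topspace X \<rightarrow> topspace X \<and>
      (\<exists>L (G :: int monoid) act \<Theta> g.
         rank2_lattice L \<and>
         torus_endomorphism_of L g A \<and> (\<forall>k\<in>eigenvalues A. cmod k > 1) \<and>
         group G \<and> cyclic_group G \<and> finite (carrier G) \<and>
         branched_covering_map (torus L) (torus_atlas L) X \<A> \<Theta> \<and>
         induced_by_rigid_action L G act \<Theta> \<and>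
         (\<forall>t\<in>topspace (torus L). f (\<Theta> t) = \<Theta> (g t)))"

definition lattes_type_map :: "'a topology \<Rightarrow> 'a chart set \<Rightarrow> ('a \<Rightarrow> 'a) \<Rightarrow> bool" where
  "lattes_type_map X \<A> f \<longleftrightarrow> (\<exists>A. lattes_linear_map X \<A> f A)"


section \<open>Combinatorial expansion factor\<close>

definition jordan_curve :: "'a topology \<Rightarrow> 'a set \<Rightarrow> bool" where
  "jordan_curve X C \<longleftrightarrow> C \<subseteq> topspace X \<and>
      subtopology X C homeomorphic_space top_of_set (sphere (0 :: complex) 1)"

definition tiles :: "'a topology \<Rightarrow> ('a \<Rightarrow> 'a) \<Rightarrow> 'a set \<Rightarrow> nat \<Rightarrow> 'a set set" where
  "tiles X f C n = (\<lambda>U. X closure_of U) `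
      connected_components_of (subtopology X {x \<in> topspace X. (f ^^ n) x \<notin> C})"

definition zero_edges :: "'a topology \<Rightarrow> 'a chart set \<Rightarrow> ('a \<Rightarrow> 'a) \<Rightarrow> 'a set \<Rightarrow> 'a set set" where
  "zero_edges X \<A> f C = (\<lambda>e. X closure_of e) `
      connected_components_of (subtopology X (C - post X \<A> f))"

definition joins_opposite_sides ::
  "'a topology \<Rightarrow> 'a chart set \<Rightarrow> ('a \<Rightarrow> 'a) \<Rightarrow> 'a set \<Rightarrow> 'a set \<Rightarrow> bool" where
  "joins_opposite_sides X \<A> f C K \<longleftrightarrow>
      card (post X \<A> f) \<ge> 4 \<and>
        (\<exists>e\<in>zero_edges X \<A> f C. \<exists>e'\<in>zero_edges X \<A> f C.
           e \<inter> e' = {} \<and> K \<inter> e \<noteq> {} \<and> K \<inter> e' \<noteq> {}) \<or>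
      card (post X \<A> f) = 3 \<and> (\<forall>e\<in>zero_edges X \<A> f C. K \<inter> e \<noteq> {})"

definition min_tiles :: "'a topology \<Rightarrow> 'a chart set \<Rightarrow> ('a \<Rightarrow> 'a) \<Rightarrow> 'a set \<Rightarrow> nat \<Rightarrow> nat" where
  "min_tiles X \<A> f C n = (LEAST k. \<exists>\<T> \<subseteq> tiles X f C n. finite \<T> \<and> card \<T> = k \<and>
      connectedin X (\<Union>\<T>) \<and> joins_opposite_sides X \<A> f C (\<Union>\<T>))"

text \<open>The common limit for all Jordan curves containing the postcritical set.\<close>

definition combinatorial_expansion_factor ::
  "'a topology \<Rightarrow> 'a chart set \<Rightarrow> ('a \<Rightarrow> 'a) \<Rightarrow> real" where
  "combinatorial_expansion_factor X \<A> f =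
      (THE l. \<forall>C. jordan_curve X C \<and> post X \<A> f \<subseteq> C \<longrightarrow>
         (\<lambda>n. root n (real (min_tiles X \<A> f C n))) \<longlonglongrightarrow> l)"

end

theory Submission
  imports Defs "HOL-Algebra.Multiplicative_Group"
begin

unbundle no fps_syntax

text \<open>
  Write \<open>P\<close> for the composition of \<open>\<Theta>\<close> with the projection from the plane, so that \<open>f \<circ> P = P \<circ> h\<close>
  for an affine map \<open>h\<close> with linear part \<open>A\<close>. The orbifold type forces the group to act by half-turns:
  it divides every branching degree of \<open>P\<close> into 2 and it rules out an unbranched \<open>P\<close>. After moving a
  branch point to the origin, \<open>P x = P y\<close> iff \<open>x - y\<close> or \<open>x + y\<close> lies in the lattice, and the
  postcritical points are the images of the half-lattice.

  The lifts of an arc of the Jordan curve through three postcritical points contain a doubly periodic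
  grid, so the components of the preimage of the complement of the curve have bounded diameter. Since
  \<open>P\<close> conjugates \<open>f\<close> to \<open>h\<close>, an \<open>n\<close>-tile lifts to a set whose image under \<open>h ^^ n\<close> has bounded
  diameter, hence a set of diameter of order \<open>n / \<lambda> ^ n\<close>, where \<open>\<lambda>\<close> is the smallest modulus of an
  eigenvalue. The distance to the lift of a 0-edge is a function on the sphere; it shows that a chain
  joining opposite sides has at least of order \<open>\<lambda> ^ n / n\<close> tiles. Conversely, the tiles along a
  segment in the direction of slowest growth, from a corner to the lift of a disjoint 0-edge, form a
  chain of at most of order \<open>n * \<lambda> ^ n\<close> tiles.
\<close>

subsection \<open>Orientation-preserving germs of the plane\<close>

text \<open>The hypotheses speak of degrees of \<open>f\<close>, while the lifting argument needs
  those of the covering by the plane. The bridge is the chain rule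
  \<open>D (h x) = local_degree X \<A> f (Pr x) * D x\<close>: every point of the torus is reached
  by an orbit that starts at an unbranched point, and following it forward compares \<open>D\<close>
  with the ramification function. Because charts are merely topological, orientation is expressed by
  winding numbers of images of small circles, and the chain rule itself requires the construction of
  a new oriented chart from power maps. The Jordan curve may be wild and the covering is branched
  over its corners, so neither the shape of a tile nor an unobstructed lift of an arc is at hand.
  Connected sets are lifted instead to components of preimages of open sets, and what is used of a
  tile is mainly the diameter of a lift. The factor of order n allows for a Jordan block of
  \<open>A\<close>; its n-th root tends to 1. The expansion factor is a definite description over
  all admissible curves, so its value is determined only once one such curve exists.\<close>

definition op_at :: "(complex \<Rightarrow> complex) \<Rightarrow> complex \<Rightarrow> bool" where
  "op_at F z \<longleftrightarrow> (\<exists>\<rho>>0. \<forall>r. 0 < r \<and> r < \<rho> \<longrightarrow> winding_number (F \<circ> circlepath z r) (F z) = 1)"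

text \<open>Two moves: the straight-line homotopy between the circles avoids \<open>z\<close>, and
  injectivity keeps its image away from \<open>F z\<close>; then the centre moves from
  \<open>F z\<close> to \<open>F z0\<close> inside the connected image of the open large disc, which
  the image of the large circle misses.\<close>

lemma winding_number_image_circlepath:
  fixes F :: "complex \<Rightarrow> complex"
  assumes cont: "continuous_on (cball z0 r0) F" and inj: "inj_on F (cball z0 r0)"
    and r: "0 < r" and sub: "cball z r \<subseteq> ball z0 r0"
  shows "winding_number (F \<circ> circlepath z r) (F z) = winding_number (F \<circ> circlepath z0 r0) (F z0)"
proof -
  have z: "dist z0 z < r0" using sub r by (auto simp: subset_iff)
  then have r0: "0 < r0" by (smt (verit) zero_le_dist)
  have le: "dist z0 z + r < r0"
  proof -
    \<comment> \<open>\<open>z + r * u\<close> is the point of the small disc farthest from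
      \<open>z0\<close>; any unit vector serves when the centres coincide.\<close>
    define u where "u = (if z = z0 then 1 else (z - z0) / cmod (z - z0))"
    have u: "cmod u = 1" by (auto simp: u_def norm_divide)
    have eq: "z - z0 = cmod (z - z0) * u" by (auto simp: u_def)
    have "z + r * u \<in> cball z r" using u r by (simp add: dist_norm norm_mult)
    then have "z + r * u \<in> ball z0 r0" using sub by blast
    then have "cmod (z + r * u - z0) < r0" by (simp add: dist_norm norm_minus_commute)
    moreover have "z + r * u - z0 = complex_of_real (cmod (z - z0) + r) * u"
    proof -
      have "z + r * u - z0 = (z - z0) + r * u" by simp
      also have "\<dots> = cmod (z - z0) * u + r * u" by (subst eq) (rule refl)
      finally show ?thesis by (simp add: algebra_simps)
    qed
    moreover have "cmod (complex_of_real (cmod (z - z0) + r) * u) = cmod (z - z0) + r"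
      using u r by (simp only: norm_mult norm_of_real) simp
    ultimately show ?thesis by (simp add: dist_norm norm_minus_commute)
  qed
  have "homotopic_loops (cball z0 r0 - {z}) (circlepath z r) (circlepath z0 r0)"
  proof (rule homotopic_loops_linear)
    fix t x :: real assume t: "t \<in> {0..1}"
    define e where "e = exp (2 * of_real pi * \<i> * of_real t)"
    have e: "cmod e = 1" by (simp add: e_def norm_exp_eq_Re)
    have cz: "circlepath z r t = z + r * e" "circlepath z0 r0 t = z0 + r0 * e"
      by (simp_all add: circlepath e_def)
    have "circlepath z r t \<in> cball z r"
      using r e by (simp add: cz dist_norm norm_mult)
    moreover have "circlepath z0 r0 t \<in> cball z0 r0"
      using r0 e by (simp add: cz dist_norm norm_mult)
    ultimately have "circlepath z r t \<in> cball z0 r0" "circlepath z0 r0 t \<in> cball z0 r0"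
      using sub ball_subset_cball by blast+
    then have 1: "closed_segment (circlepath z r t) (circlepath z0 r0 t) \<subseteq> cball z0 r0"
      using closed_segment_subset convex_cball by blast
    have "z \<notin> closed_segment (circlepath z r t) (circlepath z0 r0 t)"
    proof
      assume "z \<in> closed_segment (circlepath z r t) (circlepath z0 r0 t)"
      then obtain s where s: "0 \<le> s" "s \<le> 1" "z = (1 - s) *\<^sub>R (z + r * e) + s *\<^sub>R (z0 + r0 * e)"
        unfolding closed_segment_def cz by blast
      then have "complex_of_real s * (z - z0) = complex_of_real ((1 - s) * r + s * r0) * e"
        by (simp add: scaleR_conv_of_real algebra_simps)
      then have "cmod (complex_of_real s * (z - z0)) = cmod (complex_of_real ((1 - s) * r + s * r0) * e)"
        by (rule arg_cong)
      then have "s * cmod (z - z0) = \<bar>(1 - s) * r + s * r0\<bar>"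
        using e s by (simp only: norm_mult norm_of_real) simp
      moreover have "(1 - s) * r + s * r0 \<ge> 0" using s r r0 by simp
      ultimately have "s * cmod (z - z0) = (1 - s) * r + s * r0" by simp
      moreover have "s * cmod (z - z0) \<le> s * (r0 - r)"
        using le s by (intro mult_left_mono) (auto simp: dist_norm norm_minus_commute)
      moreover have "s * (r0 - r) < (1 - s) * r + s * r0"
        using r by (simp add: algebra_simps)
      ultimately show False by simp
    qed
    with 1 show "closed_segment (circlepath z r t) (circlepath z0 r0 t) \<subseteq> cball z0 r0 - {z}" by blast
  qed simp_all
  then have "homotopic_loops (- {F z}) (F \<circ> circlepath z r) (F \<circ> circlepath z0 r0)"
  proof (rule homotopic_loops_continuous_image)
    show "continuous_on (cball z0 r0 - {z}) F" using cont by (rule continuous_on_subset) auto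
    show "F \<in> (cball z0 r0 - {z}) \<rightarrow> - {F z}"
      using inj z by (auto simp: inj_on_def)
  qed
  then have 2: "winding_number (F \<circ> circlepath z r) (F z) = winding_number (F \<circ> circlepath z0 r0) (F z)"
    by (rule winding_number_homotopic_loops)
  have "winding_number (F \<circ> circlepath z0 r0) constant_on (F ` ball z0 r0)"
  proof (rule winding_number_constant)
    show "path (F \<circ> circlepath z0 r0)"
      using r0 by (intro path_continuous_image) (auto intro: continuous_on_subset[OF cont])
    show "connected (F ` ball z0 r0)"
      by (intro connected_continuous_image) (auto intro: continuous_on_subset[OF cont])
    have "path_image (F \<circ> circlepath z0 r0) = F ` sphere z0 r0"
      using r0 by (simp add: path_image_compose)
    moreover have "F ` ball z0 r0 \<inter> F ` sphere z0 r0 = F ` (ball z0 r0 \<inter> sphere z0 r0)"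
      using inj by (intro inj_on_image_Int[symmetric]) auto
    moreover have "ball z0 r0 \<inter> sphere z0 r0 = {}" by auto
    ultimately show "F ` ball z0 r0 \<inter> path_image (F \<circ> circlepath z0 r0) = {}" by simp
  qed (simp add: pathfinish_compose pathstart_compose)
  then have "winding_number (F \<circ> circlepath z0 r0) (F z) = winding_number (F \<circ> circlepath z0 r0) (F z0)"
    using z r0 unfolding constant_on_def by (metis centre_in_ball image_eqI mem_ball)
  with 2 show ?thesis by simp
qed

text \<open>Inside a disc of injectivity the winding number does not depend on the radius, so one
  circle decides what \<open>op_at\<close> demands of all small ones.\<close>

lemma op_at_iff:
  assumes "continuous_on (cball z r) F" "inj_on F (cball z r)" "0 < r"
  shows "op_at F z \<longleftrightarrow> winding_number (F \<circ> circlepath z r) (F z) = 1"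
proof -
  have *: "winding_number (F \<circ> circlepath z s) (F z) = winding_number (F \<circ> circlepath z r) (F z)"
    if "0 < s" "s < r" for s
    using winding_number_image_circlepath[OF assms(1,2) that(1), of z] that by (auto simp: subset_iff)
  show ?thesis
  proof
    assume "op_at F z"
    then obtain \<rho> where \<rho>: "\<rho> > 0" "\<And>s. 0 < s \<Longrightarrow> s < \<rho> \<Longrightarrow> winding_number (F \<circ> circlepath z s) (F z) = 1"
      unfolding op_at_def by blast
    define s where "s = min \<rho> r / 2"
    have "0 < s" "s < \<rho>" "s < r" using \<rho>(1) assms(3) by (auto simp: s_def)
    then show "winding_number (F \<circ> circlepath z r) (F z) = 1" using * \<rho>(2) by metis
  next
    assume "winding_number (F \<circ> circlepath z r) (F z) = 1"
    then show "op_at F z" unfolding op_at_def using * assms(3) by auto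
  qed
qed

text \<open>Orientation is constant on a disc of injectivity. Hence it can be tested at any nearby
  point, in particular away from a branch point.\<close>

lemma op_at_nearby:
  assumes "continuous_on (ball z0 \<rho>) F" "inj_on F (ball z0 \<rho>)" "z \<in> ball z0 \<rho>"
  shows "op_at F z \<longleftrightarrow> op_at F z0"
proof -
  define r0 where "r0 = (dist z0 z + \<rho>) / 2"
  have r0: "dist z0 z < r0" "r0 < \<rho>" using assms(3) by (auto simp: r0_def)
  define r where "r = (r0 - dist z0 z) / 2"
  have r: "0 < r" "dist z0 z + r < r0" using r0(1) by (auto simp: r_def field_simps)
  have "0 < r0" using r0(1) by (smt (verit) zero_le_dist)
  have sub0: "cball z0 r0 \<subseteq> ball z0 \<rho>" using r0 by auto
  have sub: "cball z r \<subseteq> ball z0 r0"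
  proof
    fix y assume "y \<in> cball z r"
    then have "dist z y \<le> r" by simp
    then show "y \<in> ball z0 r0" using r(2) dist_triangle[of z0 y z] by simp
  qed
  have sub': "cball z r \<subseteq> ball z0 \<rho>" using sub sub0 by force
  note c = continuous_on_subset[OF assms(1)] and i = inj_on_subset[OF assms(2)]
  show ?thesis
    using op_at_iff[OF c[OF sub0] i[OF sub0] \<open>0 < r0\<close>] op_at_iff[OF c[OF sub'] i[OF sub'] r(1)]
      winding_number_image_circlepath[OF c[OF sub0] i[OF sub0] r(1) sub] by simp
qed

text \<open>Loops around \<open>w\<close> inside a disc are compared by retracting the punctured plane to the
  punctured disc, on which \<open>G\<close> is defined.\<close>

lemma winding_number_compose_cong:
  fixes G :: "complex \<Rightarrow> complex"
  assumes cont: "continuous_on (cball w \<epsilon>) G" and inj: "inj_on G (cball w \<epsilon>)" and e: "0 < \<epsilon>"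
    and p: "path p" "pathfinish p = pathstart p" "path_image p \<subseteq> cball w \<epsilon> - {w}"
    and q: "path q" "pathfinish q = pathstart q" "path_image q \<subseteq> cball w \<epsilon> - {w}"
    and eq: "winding_number p w = winding_number q w"
  shows "winding_number (G \<circ> p) (G w) = winding_number (G \<circ> q) (G w)"
proof -
  define ret where "ret = (\<lambda>y. w + (min 1 (\<epsilon> / cmod (y - w))) *\<^sub>R (y - w))"
  have ret_id: "ret y = y" if "y \<in> cball w \<epsilon> - {w}" for y
    using that e by (auto simp: ret_def dist_norm norm_minus_commute min_def divide_simps)
  have contr: "continuous_on (- {w}) ret"
    unfolding ret_def by (intro continuous_intros) auto
  have ret_in: "ret y \<in> cball w \<epsilon> - {w}" if "y \<noteq> w" for y
  proof -
    have "cmod (y - w) > 0" using that by simp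
    then have "min 1 (\<epsilon> / cmod (y - w)) * cmod (y - w) \<le> \<epsilon>"
      by (auto simp: min_def field_simps)
    moreover have "min 1 (\<epsilon> / cmod (y - w)) > 0" using \<open>cmod (y - w) > 0\<close> e by auto
    ultimately show ?thesis using that by (auto simp: ret_def dist_norm)
  qed
  have "homotopic_loops (- {w}) p q"
    using p q eq by (subst (asm) winding_number_homotopic_loops_eq) auto
  then have "homotopic_loops (- {G w}) ((G \<circ> ret) \<circ> p) ((G \<circ> ret) \<circ> q)"
  proof (rule homotopic_loops_continuous_image)
    show "continuous_on (- {w}) (G \<circ> ret)"
      by (rule continuous_on_compose[OF contr continuous_on_subset[OF cont]]) (use ret_in in blast)
    show "G \<circ> ret \<in> (- {w}) \<rightarrow> - {G w}"
    proof
      fix y assume "y \<in> - {w}"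
      then have "ret y \<in> cball w \<epsilon>" "ret y \<noteq> w" using ret_in[of y] by auto
      then show "(G \<circ> ret) y \<in> - {G w}" using inj_onD[OF inj, of "ret y" w] e by auto
    qed
  qed
  then have "winding_number ((G \<circ> ret) \<circ> p) (G w) = winding_number ((G \<circ> ret) \<circ> q) (G w)"
    by (rule winding_number_homotopic_loops)
  moreover have "winding_number ((G \<circ> ret) \<circ> c) (G w) = winding_number (G \<circ> c) (G w)"
    if "path_image c \<subseteq> cball w \<epsilon> - {w}" for c
  proof (rule winding_number_cong)
    fix t :: real assume "0 \<le> t" "t \<le> 1"
    then have "c t \<in> path_image c" unfolding path_image_def by auto
    then have "c t \<in> cball w \<epsilon> - {w}" using that by blast
    then show "((G \<circ> ret) \<circ> c) t = (G \<circ> c) t" using ret_id[of "c t"] by simp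
  qed
  ultimately show ?thesis using p q by simp
qed

text \<open>Common preparation for composing and cancelling germs: a circle so small that its image
  is a simple loop inside the disc where the second germ is controlled.\<close>

lemma image_circle_setup:
  fixes F :: "complex \<Rightarrow> complex"
  assumes "continuous_on (ball z \<rho>) F" "inj_on F (ball z \<rho>)" "0 < \<rho>" "0 < \<epsilon>"
  obtains r where "0 < r" "r < \<rho>" "F ` cball z r \<subseteq> ball (F z) \<epsilon>"
    "simple_path (F \<circ> circlepath z r)" "pathfinish (F \<circ> circlepath z r) = pathstart (F \<circ> circlepath z r)"
    "path_image (F \<circ> circlepath z r) \<subseteq> cball (F z) \<epsilon> - {F z}"
    "continuous_on (cball z r) F" "inj_on F (cball z r)"
proof -
  have "isCont F z" using assms(1,3) by (simp add: continuous_on_eq_continuous_at)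
  then obtain d where d: "d > 0" "\<And>y. dist y z < d \<Longrightarrow> dist (F y) (F z) < \<epsilon>"
    using assms(4) unfolding continuous_at_eps_delta by (metis dist_norm)
  define r where "r = min d \<rho> / 2"
  have r: "0 < r" "r < d" "r < \<rho>" using d(1) assms(3) by (auto simp: r_def)
  have im: "F ` cball z r \<subseteq> ball (F z) \<epsilon>" using r d(2) by (fastforce simp: dist_commute)
  have c: "continuous_on (cball z r) F" "inj_on F (cball z r)"
    using r continuous_on_subset[OF assms(1)] inj_on_subset[OF assms(2)] by (auto simp: subset_iff)
  have pi: "path_image (circlepath z r) = sphere z r" using r by simp
  have 1: "simple_path (F \<circ> circlepath z r)"
  proof (rule simple_path_continuous_image)
    show "simple_path (circlepath z r)" using r by (simp add: simple_path_circlepath)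
    show "continuous_on (path_image (circlepath z r)) F" "inj_on F (path_image (circlepath z r))"
      unfolding pi using continuous_on_subset[OF c(1)] inj_on_subset[OF c(2)] sphere_cball by blast+
  qed
  have 2: "path_image (F \<circ> circlepath z r) \<subseteq> cball (F z) \<epsilon> - {F z}"
  proof -
    have "F z \<notin> F ` sphere z r" using inj_on_image_mem_iff[OF c(2), of z "sphere z r"] r by auto
    moreover have "F ` sphere z r \<subseteq> F ` cball z r" by (intro image_mono) auto
    ultimately show ?thesis using im ball_subset_cball[of "F z" \<epsilon>]
      unfolding path_image_compose pi by blast
  qed
  show ?thesis by (rule that[OF r(1) r(3) im 1 _ 2 c]) (simp add: pathfinish_compose pathstart_compose)
qed

text \<open>The image of a small circle under \<open>F\<close> winds once around \<open>F z\<close>,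
  so for the purposes of \<open>G\<close> it may be exchanged for a round circle around
  \<open>F z\<close>.\<close>

lemma op_at_comp:
  fixes F G :: "complex \<Rightarrow> complex"
  assumes F: "continuous_on (ball z \<rho>) F" "inj_on F (ball z \<rho>)" "0 < \<rho>"
    and G: "continuous_on (ball (F z) \<sigma>) G" "inj_on G (ball (F z) \<sigma>)" "0 < \<sigma>"
    and op: "op_at F z"
  shows "op_at (G \<circ> F) z \<longleftrightarrow> op_at G (F z)"
proof -
  define \<epsilon> where "\<epsilon> = \<sigma> / 2"
  have e: "0 < \<epsilon>" "cball (F z) \<epsilon> \<subseteq> ball (F z) \<sigma>" using G(3) by (auto simp: \<epsilon>_def)
  have G': "continuous_on (cball (F z) \<epsilon>) G" "inj_on G (cball (F z) \<epsilon>)"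
    using e continuous_on_subset[OF G(1)] inj_on_subset[OF G(2)] by auto
  obtain r where r: "0 < r" "r < \<rho>" and im: "F ` cball z r \<subseteq> ball (F z) \<epsilon>"
    and p: "simple_path (F \<circ> circlepath z r)" "pathfinish (F \<circ> circlepath z r) = pathstart (F \<circ> circlepath z r)"
      "path_image (F \<circ> circlepath z r) \<subseteq> cball (F z) \<epsilon> - {F z}"
    and cF: "continuous_on (cball z r) F" "inj_on F (cball z r)"
    using image_circle_setup[OF F e(1)] .
  have w1: "winding_number (F \<circ> circlepath z r) (F z) = 1"
    using op op_at_iff[OF cF r(1)] by simp
  have "winding_number (G \<circ> (F \<circ> circlepath z r)) (G (F z)) =
        winding_number (G \<circ> circlepath (F z) \<epsilon>) (G (F z))"
    using e p w1 G' by (intro winding_number_compose_cong) (auto simp: simple_path_imp_path winding_number_circlepath)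
  moreover have "op_at (G \<circ> F) z \<longleftrightarrow> winding_number ((G \<circ> F) \<circ> circlepath z r) ((G \<circ> F) z) = 1"
  proof (rule op_at_iff)
    have "F ` cball z r \<subseteq> cball (F z) \<epsilon>" using im by force
    then show "continuous_on (cball z r) (G \<circ> F)" "inj_on (G \<circ> F) (cball z r)"
      using cF continuous_on_subset[OF G'(1)] inj_on_subset[OF G'(2)]
      by (blast intro: continuous_on_compose comp_inj_on)+
  qed (fact r)
  ultimately show ?thesis using op_at_iff[OF G' e(1)] by (simp add: o_assoc)
qed

text \<open>The image of the circle is a simple loop, so it winds -1, 0 or 1 times around
  \<open>F z\<close>. By comparison with a constant loop or a reversed circle, the values 0 and -1
  would give \<open>G \<circ> F\<close> the winding number 0 or -1 instead of 1.\<close>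

lemma op_at_cancel:
  fixes F G :: "complex \<Rightarrow> complex"
  assumes F: "continuous_on (ball z \<rho>) F" "inj_on F (ball z \<rho>)" "0 < \<rho>"
    and G: "continuous_on (ball (F z) \<sigma>) G" "inj_on G (ball (F z) \<sigma>)" "0 < \<sigma>"
    and op: "op_at G (F z)" "op_at (G \<circ> F) z"
  shows "op_at F z"
proof -
  define \<epsilon> where "\<epsilon> = \<sigma> / 2"
  have e: "0 < \<epsilon>" "cball (F z) \<epsilon> \<subseteq> ball (F z) \<sigma>" using G(3) by (auto simp: \<epsilon>_def)
  have G': "continuous_on (cball (F z) \<epsilon>) G" "inj_on G (cball (F z) \<epsilon>)"
    using e continuous_on_subset[OF G(1)] inj_on_subset[OF G(2)] by auto
  obtain r where r: "0 < r" "r < \<rho>" and im: "F ` cball z r \<subseteq> ball (F z) \<epsilon>"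
    and p: "simple_path (F \<circ> circlepath z r)" "pathfinish (F \<circ> circlepath z r) = pathstart (F \<circ> circlepath z r)"
      "path_image (F \<circ> circlepath z r) \<subseteq> cball (F z) \<epsilon> - {F z}"
    and cF: "continuous_on (cball z r) F" "inj_on F (cball z r)"
    using image_circle_setup[OF F e(1)] .
  let ?p = "F \<circ> circlepath z r" and ?w = "F z"
  have im': "F ` cball z r \<subseteq> cball (F z) \<epsilon>" using im by force
  have wGF: "winding_number (G \<circ> ?p) (G ?w) = 1"
  proof -
    have "continuous_on (cball z r) (G \<circ> F)" "inj_on (G \<circ> F) (cball z r)"
      using im' cF continuous_on_subset[OF G'(1)] inj_on_subset[OF G'(2)]
      by (blast intro: continuous_on_compose comp_inj_on)+
    then show ?thesis using op(2) op_at_iff[of z r "G \<circ> F"] r(1) by (simp add: o_assoc)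
  qed
  have wG: "winding_number (G \<circ> circlepath ?w \<epsilon>) (G ?w) = 1"
    using op(1) op_at_iff[OF G' e(1)] by simp
  have cong: "winding_number (G \<circ> ?p) (G ?w) = winding_number (G \<circ> q) (G ?w)"
    if "path q" "pathfinish q = pathstart q" "path_image q \<subseteq> cball ?w \<epsilon> - {?w}"
      "winding_number ?p ?w = winding_number q ?w" for q
    using that e p G' by (intro winding_number_compose_cong) (auto simp: simple_path_imp_path)
  have "winding_number ?p ?w \<in> {-1, 0, 1}"
    using p by (intro simple_closed_path_winding_number_cases) auto
  moreover have "winding_number ?p ?w \<noteq> 0"
  proof
    assume "winding_number ?p ?w = 0"
    then have "winding_number (G \<circ> ?p) (G ?w) = winding_number (G \<circ> linepath (?w + \<epsilon>) (?w + \<epsilon>)) (G ?w)"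
      using e by (intro cong) (auto simp: dist_norm)
    also have "G \<circ> linepath (?w + \<epsilon>) (?w + \<epsilon>) = linepath (G (?w + \<epsilon>)) (G (?w + \<epsilon>))"
      by (auto simp: linepath_def scaleR_conv_of_real algebra_simps)
    also have "winding_number \<dots> (G ?w) = 0"
    proof -
      have "G (?w + \<epsilon>) \<noteq> G ?w" using inj_onD[OF G'(2), of "?w + \<epsilon>" ?w] e by (auto simp: dist_norm)
      then show ?thesis by simp
    qed
    finally have "winding_number (G \<circ> ?p) (G ?w) = 0" .
    then show False unfolding wGF by simp
  qed
  moreover have "winding_number ?p ?w \<noteq> -1"
  proof
    assume *: "winding_number ?p ?w = -1"
    have pi: "path_image (circlepath ?w \<epsilon>) = sphere ?w \<epsilon>" using e by simp
    have "winding_number (G \<circ> ?p) (G ?w) = winding_number (G \<circ> reversepath (circlepath ?w \<epsilon>)) (G ?w)"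
    proof (rule cong)
      show "winding_number ?p ?w = winding_number (reversepath (circlepath ?w \<epsilon>)) ?w"
        using e * by (subst winding_number_reversepath) (auto simp: winding_number_circlepath)
    qed (use e in \<open>auto\<close>)
    also have "G \<circ> reversepath (circlepath ?w \<epsilon>) = reversepath (G \<circ> circlepath ?w \<epsilon>)"
      by (auto simp: reversepath_def)
    also have "winding_number \<dots> (G ?w) = - winding_number (G \<circ> circlepath ?w \<epsilon>) (G ?w)"
    proof (rule winding_number_reversepath)
      show "path (G \<circ> circlepath ?w \<epsilon>)"
        using e by (intro path_continuous_image) (auto intro: continuous_on_subset[OF G'(1)])
      show "G ?w \<notin> path_image (G \<circ> circlepath ?w \<epsilon>)"
        using e pi inj_on_image_mem_iff[OF G'(2), of ?w "sphere ?w \<epsilon>"] by (auto simp: path_image_compose)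
    qed
    finally show False unfolding wGF wG by simp
  qed
  ultimately have "winding_number ?p ?w = 1" by blast
  then show ?thesis using op_at_iff[OF cF r(1)] by simp
qed

section \<open>Germs with a dominant linear part\<close>

lemma winding_number_rotated_circlepath:
  assumes "\<alpha> \<noteq> 0" "0 < r"
  shows "winding_number (\<lambda>t. c + \<alpha> * (circlepath 0 r t)) c = 1"
proof -
  define p where "p = (\<lambda>t::real. c + \<alpha> * (r * exp (2 * of_real pi * \<i> * of_real t)))"
  have p: "(\<lambda>t. c + \<alpha> * (circlepath 0 r t)) = p" by (simp add: p_def circlepath fun_eq_iff)
  have der: "(p has_vector_derivative (2 * of_real pi * \<i>) * (\<alpha> * (r * exp (2 * of_real pi * \<i> * of_real t)))) (at t within X)" for t X
    unfolding p_def
    apply (rule has_vector_derivative_real_field)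
    apply (rule derivative_eq_intros | simp)+
    done
  have ne: "c \<notin> path_image p" using assms by (auto simp: path_image_def p_def)
  have vp: "valid_path p"
    unfolding valid_path_def
  proof (rule C1_differentiable_imp_piecewise)
    show "p C1_differentiable_on {0..1}"
      unfolding C1_differentiable_on_def
      by (rule exI[of _ "\<lambda>t. (2 * of_real pi * \<i>) * (\<alpha> * (r * exp (2 * of_real pi * \<i> * of_real t)))"])
        (use der in \<open>auto intro!: continuous_intros\<close>)
  qed
  have "((\<lambda>w. 1 / (w - c)) has_contour_integral (2 * of_real pi * \<i>)) p"
    unfolding has_contour_integral_def
  proof (rule has_integral_eq[rotated])
    show "((\<lambda>t. 2 * of_real pi * \<i>) has_integral (2 * of_real pi * \<i>)) {0..1::real}"
      using has_integral_const_real[of "2 * of_real pi * \<i>" 0 1] by simp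
    show "2 * of_real pi * \<i> = 1 / (p t - c) * vector_derivative p (at t within {0..1})" if "t \<in> {0..1}" for t
    proof -
      have "vector_derivative p (at t within {0..1}) = (2 * of_real pi * \<i>) * (\<alpha> * (r * exp (2 * of_real pi * \<i> * of_real t)))"
        using that by (intro vector_derivative_at_within_ivl der) auto
      moreover have "p t - c = \<alpha> * (r * exp (2 * of_real pi * \<i> * of_real t))" by (simp add: p_def)
      moreover have "\<alpha> * (r * exp (2 * of_real pi * \<i> * of_real t)) \<noteq> 0" using assms by simp
      ultimately show ?thesis by (simp only: ) (simp add: divide_simps)
    qed
  qed
  then have "contour_integral p (\<lambda>w. 1 / (w - c)) = 2 * of_real pi * \<i>" by (rule contour_integral_unique)
  then show ?thesis using winding_number_valid_path[OF vp ne] by (simp add: p)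
qed

text \<open>A Rouche-type comparison: at each parameter the image of the circle is closer to its
  image under the linear part than the latter is to \<open>F z\<close>, so the two loops wind
  equally often.\<close>

lemma op_at_dominant_linear:
  assumes cont: "continuous_on (ball z \<rho>) F" and "0 < \<rho>" and "\<alpha> \<noteq> 0"
    and lin: "\<And>y. y \<in> ball z \<rho> \<Longrightarrow> y \<noteq> z \<Longrightarrow> cmod (F y - F z - \<alpha> * (y - z)) < cmod \<alpha> * cmod (y - z)"
  shows "op_at F z"
  unfolding op_at_def
proof (intro exI[of _ \<rho>] conjI allI impI)
  fix r assume r: "0 < r \<and> r < \<rho>"
  have "winding_number (F \<circ> circlepath z r) (F z) = winding_number (\<lambda>t. F z + \<alpha> * circlepath 0 r t) (F z)"
  proof (rule winding_number_nearby_loops_eq)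
    show "path (\<lambda>t. F z + \<alpha> * circlepath 0 r t)"
      unfolding path_def circlepath by (intro continuous_intros)
    have "sphere z r \<subseteq> ball z \<rho>" using r by auto
    then show "path (F \<circ> circlepath z r)"
      using r by (intro path_continuous_image) (auto intro: continuous_on_subset[OF cont])
    fix t :: real assume "t \<in> {0..1}"
    define y where "y = circlepath z r t"
    have y: "y - z = circlepath 0 r t" by (simp add: y_def circlepath)
    have "y \<in> sphere z r" using r by (simp add: y_def circlepath dist_norm norm_mult norm_exp_eq_Re)
    then have "y \<in> ball z \<rho>" "y \<noteq> z" using r by auto
    from lin[OF this] show "cmod ((F \<circ> circlepath z r) t - (F z + \<alpha> * circlepath 0 r t)) < cmod (F z + \<alpha> * circlepath 0 r t - F z)"
      using y by (simp add: y_def norm_mult algebra_simps)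
  qed (auto simp: pathfinish_def pathstart_def circlepath)
  then show "winding_number (F \<circ> circlepath z r) (F z) = 1"
    using winding_number_rotated_circlepath[OF \<open>\<alpha> \<noteq> 0\<close>] r by simp
qed fact

lemma op_at_deriv:
  assumes cont: "continuous_on (ball z \<rho>) F" and "0 < \<rho>" and "(F has_field_derivative \<alpha>) (at z)" "\<alpha> \<noteq> 0"
  shows "op_at F z"
proof -
  have "((\<lambda>y. (F y - F z) / (y - z)) \<longlongrightarrow> \<alpha>) (at z)"
    using assms(3) by (simp add: has_field_derivative_iff)
  then have "eventually (\<lambda>y. dist ((F y - F z) / (y - z)) \<alpha> < cmod \<alpha>) (at z)"
    using assms(4) by (intro tendstoD) auto
  then obtain d where d: "d > 0" "\<And>y. y \<noteq> z \<Longrightarrow> dist y z < d \<Longrightarrow> cmod ((F y - F z) / (y - z) - \<alpha>) < cmod \<alpha>"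
    unfolding eventually_at dist_norm by auto
  show ?thesis
  proof (rule op_at_dominant_linear)
    show "0 < min d \<rho>" using d(1) assms(2) by simp
    show "continuous_on (ball z (min d \<rho>)) F" by (rule continuous_on_subset[OF cont]) auto
    fix y assume y: "y \<in> ball z (min d \<rho>)" "y \<noteq> z"
    have "F y - F z - \<alpha> * (y - z) = ((F y - F z) / (y - z) - \<alpha>) * (y - z)"
      using y by (simp add: field_simps)
    then show "cmod (F y - F z - \<alpha> * (y - z)) < cmod \<alpha> * cmod (y - z)"
      using d(2)[of y] y by (simp add: norm_mult dist_commute)
  qed fact
qed

text \<open>Every real-linear map of the plane has the form
  \<open>\<alpha> * z + \<beta> * cnj z\<close>, with determinant |\<alpha>|^2 - |\<beta>|^2; the
  hypothesis says that this determinant is positive.\<close>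

lemma op_at_real_linear:
  assumes "cmod \<beta> < cmod \<alpha>"
  shows "op_at (\<lambda>z. \<alpha> * z + \<beta> * cnj z + c) z"
proof (rule op_at_dominant_linear[of z 1])
  show "continuous_on (ball z 1) (\<lambda>z. \<alpha> * z + \<beta> * cnj z + c)" by (intro continuous_intros)
  show "\<alpha> \<noteq> 0" using assms by auto
  fix y assume "y \<noteq> z"
  have "\<alpha> * y + \<beta> * cnj y + c - (\<alpha> * z + \<beta> * cnj z + c) - \<alpha> * (y - z) = \<beta> * cnj (y - z)"
    by (simp add: algebra_simps)
  then show "cmod (\<alpha> * y + \<beta> * cnj y + c - (\<alpha> * z + \<beta> * cnj z + c) - \<alpha> * (y - z)) < cmod \<alpha> * cmod (y - z)"
    using assms \<open>y \<noteq> z\<close> by (simp only: norm_mult complex_mod_cnj) simp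
qed simp

lemma op_at_cong:
  assumes "0 < \<rho>" "\<And>y. y \<in> ball z \<rho> \<Longrightarrow> F y = G y" "op_at F z"
  shows "op_at G z"
proof -
  obtain \<sigma> where \<sigma>: "\<sigma> > 0" "\<And>r. 0 < r \<Longrightarrow> r < \<sigma> \<Longrightarrow> winding_number (F \<circ> circlepath z r) (F z) = 1"
    using assms(3) unfolding op_at_def by blast
  show ?thesis unfolding op_at_def
  proof (intro exI[of _ "min \<rho> \<sigma>"] conjI allI impI)
    fix r assume r: "0 < r \<and> r < min \<rho> \<sigma>"
    have "winding_number (G \<circ> circlepath z r) (G z) = winding_number (F \<circ> circlepath z r) (G z)"
    proof (rule winding_number_cong)
      fix t :: real
      have "circlepath z r t \<in> ball z \<rho>" using r by (simp add: circlepath dist_norm norm_mult norm_exp_eq_Re)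
      then show "(G \<circ> circlepath z r) t = (F \<circ> circlepath z r) t" using assms(2) by simp
    qed
    then show "winding_number (G \<circ> circlepath z r) (G z) = 1"
      using \<sigma>(2)[of r] r assms(1) assms(2)[of z] by simp
  qed (use assms(1) \<sigma>(1) in auto)
qed

lemma op_at_id: "op_at (\<lambda>z. z) z"
  using op_at_deriv[of z 1 "\<lambda>z. z" 1] by simp

subsection \<open>Charts and local degrees\<close>

lemma is_chartD:
  assumes "is_chart X (V, \<psi>)"
  shows "openin X V" "inj_on \<psi> V"
    "\<And>N. openin X N \<Longrightarrow> open (\<psi> ` (V \<inter> N))"
    "\<And>G. open G \<Longrightarrow> openin X {x \<in> V. \<psi> x \<in> G}"
proof -
  have V: "openin X V" "open (\<psi> ` V)"
    and h: "homeomorphic_map (subtopology X V) (top_of_set (\<psi> ` V)) \<psi>"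
    using assms by (auto simp: is_chart_def)
  have VX: "V \<subseteq> topspace X" using V(1) by (rule openin_subset)
  show "openin X V" by fact
  show "inj_on \<psi> V"
    using homeomorphic_imp_injective_map[OF h] VX by (simp add: Int_absorb1)
  show "open (\<psi> ` (V \<inter> N))" if "openin X N" for N
  proof -
    have "openin (subtopology X V) (V \<inter> N)" using that by (simp add: openin_subtopology_Int2)
    then have "openin (top_of_set (\<psi> ` V)) (\<psi> ` (V \<inter> N))"
      using homeomorphic_imp_open_map[OF h] unfolding open_map_def by blast
    then show ?thesis using V(2) openin_open_eq by blast
  qed
  show "openin X {x \<in> V. \<psi> x \<in> G}" if "open G" for G
  proof -
    have "openin (top_of_set (\<psi> ` V)) (\<psi> ` V \<inter> G)" using that by (rule openin_open_Int)
    then have "openin (subtopology X V) {x \<in> topspace (subtopology X V). \<psi> x \<in> \<psi> ` V \<inter> G}"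
      using homeomorphic_imp_continuous_map[OF h] by (rule openin_continuous_map_preimage[rotated])
    moreover have "{x \<in> topspace (subtopology X V). \<psi> x \<in> \<psi> ` V \<inter> G} = {x \<in> V. \<psi> x \<in> G}"
      using VX by (auto simp: topspace_subtopology)
    ultimately show ?thesis using V(1) openin_trans_full by metis
  qed
qed

lemma is_chartI:
  assumes V: "openin X V" and inj: "inj_on \<psi> V"
    and op: "\<And>N. openin X N \<Longrightarrow> N \<subseteq> V \<Longrightarrow> open (\<psi> ` N)"
    and cont: "\<And>G. open G \<Longrightarrow> openin X {x \<in> V. \<psi> x \<in> G}"
  shows "is_chart X (V, \<psi>)"
proof -
  have VX: "V \<subseteq> topspace X" using V(1) by (rule openin_subset)
  have tV: "topspace (subtopology X V) = V" using VX by (simp add: Int_absorb1)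
  have "homeomorphic_map (subtopology X V) (top_of_set (\<psi> ` V)) \<psi>"
  proof (rule bijective_open_imp_homeomorphic_map)
    have "openin (subtopology X V) {x \<in> V. \<psi> x \<in> G}" if "open G" for G
    proof -
      have "openin (subtopology X V) (V \<inter> {x \<in> V. \<psi> x \<in> G})" by (rule openin_subtopology_Int2) (rule cont[OF that])
      then show ?thesis by (simp add: Int_absorb1 subset_iff)
    qed
    then have "continuous_map (subtopology X V) euclidean \<psi>"
      unfolding continuous_map_def tV by (simp add: open_openin[symmetric])
    then show "continuous_map (subtopology X V) (top_of_set (\<psi> ` V)) \<psi>"
      by (simp add: continuous_map_in_subtopology tV image_subset_iff_funcset)
    show "open_map (subtopology X V) (top_of_set (\<psi> ` V)) \<psi>"
      unfolding open_map_def
    proof (intro allI impI)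
      fix N assume N: "openin (subtopology X V) N"
      then have "openin X N" "N \<subseteq> V" using V openin_trans_full openin_subset[OF N] tV by auto
      then have "open (\<psi> ` N)" "\<psi> ` N \<subseteq> \<psi> ` V" using op by auto
      then show "openin (top_of_set (\<psi> ` V)) (\<psi> ` N)" by (simp add: open_subset)
    qed
  qed (use inj tV in auto)
  moreover have "open (\<psi> ` V)" using op[OF V] by simp
  ultimately show ?thesis using V by (simp add: is_chart_def)
qed

lemma transition_map:
  assumes \<psi>: "is_chart X (V, \<psi>)" and \<omega>: "is_chart X (W, \<omega>)"
  shows "open (\<psi> ` (V \<inter> W))" "continuous_on (\<psi> ` (V \<inter> W)) (\<omega> \<circ> inv_into V \<psi>)"
    "inj_on (\<omega> \<circ> inv_into V \<psi>) (\<psi> ` (V \<inter> W))"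
proof -
  note p = is_chartD[OF \<psi>] and o = is_chartD[OF \<omega>]
  show op: "open (\<psi> ` (V \<inter> W))" using p(3) o(1) by blast
  show "continuous_on (\<psi> ` (V \<inter> W)) (\<omega> \<circ> inv_into V \<psi>)"
    unfolding continuous_on_open_vimage[OF op]
  proof (intro allI impI)
    fix G :: "complex set" assume "open G"
    have "(\<omega> \<circ> inv_into V \<psi>) -` G \<inter> \<psi> ` (V \<inter> W) = \<psi> ` (V \<inter> {x \<in> W. \<omega> x \<in> G})"
      using p(2) by (auto simp: inv_into_f_f image_iff intro!: bexI)
    moreover have "open (\<psi> ` (V \<inter> {x \<in> W. \<omega> x \<in> G}))"
      using p(3)[OF o(4)[OF \<open>open G\<close>]] .
    ultimately show "open ((\<omega> \<circ> inv_into V \<psi>) -` G \<inter> \<psi> ` (V \<inter> W))" by simp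
  qed
  show "inj_on (\<omega> \<circ> inv_into V \<psi>) (\<psi> ` (V \<inter> W))"
    using p(2) o(2) by (auto simp: inj_on_def inv_into_f_f)
qed

lemma orientation_compatible_imp_op_at:
  assumes \<psi>: "is_chart X (V, \<psi>)" and \<omega>: "is_chart X (W, \<omega>)"
    and comp: "orientation_compatible (V, \<psi>) (W, \<omega>)" and x: "x \<in> V" "x \<in> W"
  shows "op_at (\<omega> \<circ> inv_into V \<psi>) (\<psi> x)"
proof -
  have "open (\<psi> ` (V \<inter> W))" by (rule transition_map[OF \<psi> \<omega>])
  moreover have "\<psi> x \<in> \<psi> ` (V \<inter> W)" using x by blast
  ultimately obtain e where e: "e > 0" "cball (\<psi> x) e \<subseteq> \<psi> ` (V \<inter> W)"
    using open_contains_cball by blast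
  have "winding_number ((\<omega> \<circ> inv_into V \<psi>) \<circ> circlepath (\<psi> x) e) ((\<omega> \<circ> inv_into V \<psi>) (\<psi> x)) = 1"
    using comp e unfolding orientation_compatible_def by (auto simp: o_assoc)
  then show ?thesis
    using op_at_iff[OF continuous_on_subset[OF transition_map(2)[OF \<psi> \<omega>] e(2)]
        inj_on_subset[OF transition_map(3)[OF \<psi> \<omega>] e(2)] e(1)] by blast
qed

text \<open>Points with coordinate 0 are exempt because the chart built later is a power of a
  coordinate, so the comparison through the plane breaks down at its centre. Any disc contains other
  points, and one of them settles the orientation of the whole disc.\<close>

lemma orientation_compatibleI:
  assumes \<psi>: "is_chart X (V, \<psi>)" and \<omega>: "is_chart X (W, \<omega>)"
    and op: "\<And>x. x \<in> V \<Longrightarrow> x \<in> W \<Longrightarrow> \<psi> x \<noteq> 0 \<Longrightarrow> op_at (\<omega> \<circ> inv_into V \<psi>) (\<psi> x)"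
  shows "orientation_compatible (V, \<psi>) (W, \<omega>)"
  unfolding orientation_compatible_def
proof (clarify)
  fix z :: complex and r :: real assume r: "0 < r" and sub: "cball z r \<subseteq> \<psi> ` (V \<inter> W)"
  let ?F = "\<omega> \<circ> inv_into V \<psi>"
  have c: "continuous_on (cball z r) ?F" "inj_on ?F (cball z r)"
    using continuous_on_subset[OF transition_map(2)[OF \<psi> \<omega>] sub] inj_on_subset[OF transition_map(3)[OF \<psi> \<omega>] sub]
    by auto
  define y where "y = (if z = 0 then of_real (r / 2) else z)"
  have y: "y \<noteq> 0" "y \<in> ball z r" using r by (auto simp: y_def dist_norm)
  then have "y \<in> cball z r" by auto
  then obtain x where "x \<in> V" "x \<in> W" "y = \<psi> x" using sub by blast
  then have "op_at ?F y" using op y by blast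
  then have "op_at ?F z"
    using op_at_nearby[of z r ?F y] y(2) c continuous_on_subset[OF c(1)] inj_on_subset[OF c(2)] ball_subset_cball by blast
  then show "winding_number (\<omega> \<circ> inv_into V \<psi> \<circ> circlepath z r) (\<omega> (inv_into V \<psi> z)) = 1"
    using op_at_iff[OF c r] by simp
qed

text \<open>All d-th roots of \<open>a y ^ d\<close> have the modulus of \<open>a y\<close>, so each
  of them is attained in the disc; injectivity of \<open>\<psi>\<close> turns equal powers into
  equal images.\<close>

lemma card_power_fiber:
  assumes bij: "bij_betw a W (ball (0::complex) \<delta>)" and d: "d \<ge> 1"
    and eq: "\<And>y. y \<in> W \<Longrightarrow> \<psi> (f y) = a y ^ d" and inj: "inj_on \<psi> (f ` W)"
    and y: "y \<in> W" "a y \<noteq> 0"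
  shows "card {y' \<in> W. f y' = f y} = d"
proof -
  have "bij_betw a {y' \<in> W. f y' = f y} {w. w ^ d = a y ^ d}"
    unfolding bij_betw_def
  proof
    show "inj_on a {y' \<in> W. f y' = f y}" using bij by (auto simp: bij_betw_def inj_on_def)
    show "a ` {y' \<in> W. f y' = f y} = {w. w ^ d = a y ^ d}"
    proof (intro subset_antisym subsetI)
      fix w assume "w \<in> {w. w ^ d = a y ^ d}"
      then have w: "w ^ d = a y ^ d" by simp
      then have "cmod w ^ d = cmod (a y) ^ d" by (metis norm_power)
      then have "cmod w = cmod (a y)" using d by (simp add: power_eq_iff_eq_base)
      moreover have "a y \<in> ball 0 \<delta>" using bij y bij_betwE by blast
      ultimately have "w \<in> ball 0 \<delta>" by simp
      then have "w \<in> a ` W" using bij unfolding bij_betw_def by blast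
      then obtain y' where y': "y' \<in> W" "w = a y'" by blast
      have "\<psi> (f y') = \<psi> (f y)" using eq y' y(1) w by simp
      then have "f y' = f y" using inj y' y(1) by (auto simp: inj_on_def)
      then show "w \<in> a ` {y' \<in> W. f y' = f y}" using y' by blast
    next
      fix w assume "w \<in> a ` {y' \<in> W. f y' = f y}"
      then show "w \<in> {w. w ^ d = a y ^ d}" using eq y(1) by (auto) (metis)
    qed
  qed
  then have "card {y' \<in> W. f y' = f y} = card {w. w ^ d = a y ^ d}" by (rule bij_betw_same_card)
  also have "\<dots> = d" using y d by (intro card_nth_roots) auto
  finally show ?thesis .
qed

lemma chart_ball:
  assumes c: "is_chart X (U, \<phi>)" and p: "p \<in> U" "\<phi> p = 0" and N: "openin X N" "p \<in> N"
  obtains \<epsilon> where "\<epsilon> > 0" "{x \<in> U. cmod (\<phi> x) < \<epsilon>} \<subseteq> N"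
    "openin X {x \<in> U. cmod (\<phi> x) < \<epsilon>}" "bij_betw \<phi> {x \<in> U. cmod (\<phi> x) < \<epsilon>} (ball 0 \<epsilon>)"
proof -
  note cD = is_chartD[OF c]
  have "open (\<phi> ` (U \<inter> N))" using cD(3) N by blast
  moreover have "0 \<in> \<phi> ` (U \<inter> N)" using p N by force
  ultimately obtain \<epsilon> where e: "\<epsilon> > 0" "ball 0 \<epsilon> \<subseteq> \<phi> ` (U \<inter> N)"
    using open_contains_ball by blast
  have eq: "{x \<in> U. cmod (\<phi> x) < \<epsilon>} = {x \<in> U. \<phi> x \<in> ball 0 \<epsilon>}" by auto
  show ?thesis
  proof (rule that[OF e(1)])
    show "{x \<in> U. cmod (\<phi> x) < \<epsilon>} \<subseteq> N"
    proof
      fix x assume "x \<in> {x \<in> U. cmod (\<phi> x) < \<epsilon>}"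
      then have "x \<in> U" "\<phi> x \<in> \<phi> ` (U \<inter> N)" using e(2) by auto
      then show "x \<in> N" using cD(2) by (auto simp: inj_on_def)
    qed
    show "openin X {x \<in> U. cmod (\<phi> x) < \<epsilon>}" unfolding eq by (rule cD(4)) simp
    show "bij_betw \<phi> {x \<in> U. cmod (\<phi> x) < \<epsilon>} (ball 0 \<epsilon>)"
      unfolding bij_betw_def using e(2) by (auto intro: inj_on_subset[OF cD(2)])
  qed
qed

lemma oriented_chartD:
  "oriented_chart X \<A> c \<Longrightarrow> is_chart X c"
  "oriented_chart X \<A> c \<Longrightarrow> c' \<in> \<A> \<Longrightarrow> orientation_compatible c c'"
  by (auto simp: oriented_chart_def)

lemma has_local_degreeE:
  assumes "has_local_degree X \<A> Y \<B> f p d"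
  obtains U \<phi> V \<psi> where "d \<ge> 1" "oriented_chart X \<A> (U, \<phi>)" "p \<in> U" "\<phi> p = 0"
    "oriented_chart Y \<B> (V, \<psi>)" "f p \<in> V" "\<psi> (f p) = 0" "f ` U \<subseteq> V" "\<forall>x\<in>U. \<psi> (f x) = \<phi> x ^ d"
  using assms unfolding has_local_degree_def by (elim conjE exE) (rule that)

text \<open>Counting nearby preimages describes the degree without charts, which is what makes it
  unique. The clause \<open>W \<noteq> {p}\<close> guarantees a point at which to count.\<close>

lemma local_degree_fiber:
  assumes d: "has_local_degree X \<A> Y \<B> f p d" and N: "openin X N" "p \<in> N"
  obtains W where "openin X W" "p \<in> W" "W \<subseteq> N" "W \<noteq> {p}"
    "\<And>q. q \<in> W \<Longrightarrow> q \<noteq> p \<Longrightarrow> card {q' \<in> W. f q' = f q} = d"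
proof -
  obtain U \<phi> V \<psi> where d1: "d \<ge> 1" and c0: "oriented_chart X \<A> (U, \<phi>)" and c': "p \<in> U" "\<phi> p = 0"
    and v0: "oriented_chart Y \<B> (V, \<psi>)" and v': "f p \<in> V" "\<psi> (f p) = 0" "f ` U \<subseteq> V"
    and eq': "\<forall>x\<in>U. \<psi> (f x) = \<phi> x ^ d"
    using has_local_degreeE[OF d] .
  note eq = bspec[OF eq'] and c = oriented_chartD(1)[OF c0] c' and v = oriented_chartD(1)[OF v0] v'(3)
  obtain \<epsilon> where e: "\<epsilon> > 0" "{x \<in> U. cmod (\<phi> x) < \<epsilon>} \<subseteq> N"
    "openin X {x \<in> U. cmod (\<phi> x) < \<epsilon>}" "bij_betw \<phi> {x \<in> U. cmod (\<phi> x) < \<epsilon>} (ball 0 \<epsilon>)"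
    using chart_ball[OF c N] by blast
  let ?W = "{x \<in> U. cmod (\<phi> x) < \<epsilon>}"
  show ?thesis
  proof (rule that[OF e(3) _ e(2)])
    show "p \<in> ?W" using c e by simp
    have "complex_of_real (\<epsilon> / 2) \<in> ball 0 \<epsilon>" using e(1) by simp
    then obtain q where "q \<in> ?W" "\<phi> q = complex_of_real (\<epsilon> / 2)"
      using e(4) by (metis (no_types, lifting) bij_betw_imp_surj_on imageE)
    then show "?W \<noteq> {p}"     proof -
      have "q \<noteq> p" using c(3) e(1) \<open>\<phi> q = complex_of_real (\<epsilon> / 2)\<close> by auto
      then show ?thesis using \<open>q \<in> ?W\<close> by blast
    qed
    fix q assume q: "q \<in> ?W" "q \<noteq> p"
    then have "\<phi> q \<noteq> 0" using inj_onD[OF is_chartD(2)[OF c(1)], of q p] c by auto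
    then show "card {q' \<in> ?W. f q' = f q} = d"
    proof (intro card_power_fiber[where a = \<phi> and \<delta> = \<epsilon> and \<psi> = \<psi>])
      show "inj_on \<psi> (f ` ?W)" using v(2) by (intro inj_on_subset[OF is_chartD(2)[OF v(1)]]) blast
    qed (use q d1 eq e(4) in auto)
  qed
qed

text \<open>A fibre counted in a smaller neighbourhood is contained in the one counted in a larger
  neighbourhood, and the latter is finite since its cardinality is positive.\<close>

lemma local_degree_fiber_unique:
  fixes d d' :: nat
  assumes d: "\<And>N. openin X N \<Longrightarrow> p \<in> N \<Longrightarrow> \<exists>W. openin X W \<and> p \<in> W \<and> W \<subseteq> N \<and> W \<noteq> {p} \<and>
        (\<forall>q\<in>W. q \<noteq> p \<longrightarrow> card {q' \<in> W. f q' = f q} = d)" and d1: "d \<ge> 1"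
    and d': "\<And>N. openin X N \<Longrightarrow> p \<in> N \<Longrightarrow> \<exists>W. openin X W \<and> p \<in> W \<and> W \<subseteq> N \<and> W \<noteq> {p} \<and>
        (\<forall>q\<in>W. q \<noteq> p \<longrightarrow> card {q' \<in> W. f q' = f q} = d')"
    and p: "p \<in> topspace X"
  shows "d' \<le> d"
proof -
  obtain W where W: "openin X W" "p \<in> W" "\<And>q. q \<in> W \<Longrightarrow> q \<noteq> p \<Longrightarrow> card {q' \<in> W. f q' = f q} = d"
    using d[OF openin_topspace p] by blast
  obtain W' where W': "W' \<subseteq> W" "p \<in> W'" "W' \<noteq> {p}" "\<And>q. q \<in> W' \<Longrightarrow> q \<noteq> p \<Longrightarrow> card {q' \<in> W'. f q' = f q} = d'"
    using d'[OF W(1,2)] by blast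
  obtain q where q: "q \<in> W'" "q \<noteq> p" using W'(2,3) by blast
  have "card {q' \<in> W. f q' = f q} = d" using W q W' by blast
  then have "finite {q' \<in> W. f q' = f q}" using d1 by (intro card_ge_0_finite) simp
  then have "card {q' \<in> W'. f q' = f q} \<le> card {q' \<in> W. f q' = f q}" using W'(1) by (intro card_mono) auto
  moreover have "card {q' \<in> W'. f q' = f q} = d'" using W'(4) q by blast
  ultimately show ?thesis using \<open>card {q' \<in> W. f q' = f q} = d\<close> by simp
qed

text \<open>Fibre counts are compared in both orders; this gives the definite description
  \<open>local_degree\<close> its meaning.\<close>

lemma has_local_degree_unique:
  assumes "has_local_degree X \<A> Y \<B> f p d" "has_local_degree X \<A> Y \<B> f p d'"
  shows "d' = d"
proof -
  have ge: "d \<ge> 1" "d' \<ge> 1" using assms by (auto simp: has_local_degree_def)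
  have p: "p \<in> topspace X" using assms(1)
    by (elim has_local_degreeE) (metis is_chartD(1) openin_subset oriented_chartD(1) subsetD)
  have *: "\<exists>W. openin X W \<and> p \<in> W \<and> W \<subseteq> N \<and> W \<noteq> {p} \<and> (\<forall>q\<in>W. q \<noteq> p \<longrightarrow> card {q' \<in> W. f q' = f q} = d)"
    if "has_local_degree X \<A> Y \<B> f p d" "openin X N" "p \<in> N" for N d
    using local_degree_fiber[OF that] by metis
  show ?thesis
    using local_degree_fiber_unique[where d = d and d' = d', OF *[OF assms(1)] ge(1) *[OF assms(2)] p]
      local_degree_fiber_unique[where d = d' and d' = d, OF *[OF assms(2)] ge(2) *[OF assms(1)] p] by linarith
qed

lemma local_degree_eq: "has_local_degree X \<A> X \<A> f p d \<Longrightarrow> local_degree X \<A> f p = d"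
  unfolding local_degree_def by (rule the_equality) (auto intro: has_local_degree_unique)

text \<open>A value of modulus below \<epsilon>^d has a d-th root of modulus below \<epsilon>, so
  every small disc of the source chart covers a neighbourhood of the image point.\<close>

lemma branched_covering_map_open:
  assumes f: "branched_covering_map X \<A> Y \<B> f"
  shows "open_map X Y f"
  unfolding open_map_def
proof (intro allI impI)
  fix N assume N: "openin X N"
  show "openin Y (f ` N)"
  proof (subst openin_subopen, intro ballI)
    fix q assume "q \<in> f ` N"
    then obtain p where p: "p \<in> N" "q = f p" by blast
    then have "p \<in> topspace X" using N openin_subset by blast
    then obtain d where d: "has_local_degree X \<A> Y \<B> f p d"
      using f unfolding branched_covering_map_def by blast
    obtain U \<phi> V \<psi> where d1: "d \<ge> 1" and c0: "oriented_chart X \<A> (U, \<phi>)" and c': "p \<in> U" "\<phi> p = 0"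
    and v0: "oriented_chart Y \<B> (V, \<psi>)" and v': "f p \<in> V" "\<psi> (f p) = 0" "f ` U \<subseteq> V"
    and eq': "\<forall>x\<in>U. \<psi> (f x) = \<phi> x ^ d"
      using has_local_degreeE[OF d] .
    note eq = bspec[OF eq'] and c = oriented_chartD(1)[OF c0] c' and v = oriented_chartD(1)[OF v0] v'
    obtain \<epsilon> where e: "\<epsilon> > 0" "{x \<in> U. cmod (\<phi> x) < \<epsilon>} \<subseteq> N"
      "bij_betw \<phi> {x \<in> U. cmod (\<phi> x) < \<epsilon>} (ball 0 \<epsilon>)"
      using chart_ball[OF c N p(1)] by blast
    let ?T = "{y \<in> V. \<psi> y \<in> ball 0 (\<epsilon> ^ d)}"
    have "openin Y ?T" by (rule is_chartD(4)[OF v(1)]) simp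
    moreover have "q \<in> ?T" using v p e by simp
    moreover have "?T \<subseteq> f ` N"
    proof
      fix y assume y: "y \<in> ?T"
      obtain w where w: "w ^ d = \<psi> y"
      proof (cases "\<psi> y = 0")
        case True then show ?thesis using that[of 0] d1 by simp
      next
        case False
        have "card {z. z ^ d = \<psi> y} = d" using False d1 by (intro card_nth_roots) auto
        then show ?thesis using that d1 by (metis (mono_tags, lifting) card.empty empty_Collect_eq not_one_le_zero)
      qed
      then have "cmod w ^ d < \<epsilon> ^ d" using y by (auto simp: norm_power[symmetric])
      then have "w \<in> ball 0 \<epsilon>" using e(1) by (simp add: power_less_imp_less_base)
      then have "w \<in> \<phi> ` {x \<in> U. cmod (\<phi> x) < \<epsilon>}" using e(3) unfolding bij_betw_def by blast
      then obtain x where x: "x \<in> U" "x \<in> N" "w = \<phi> x" using e(2) by blast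
      then have "\<psi> (f x) = \<psi> y" using eq w by simp
      moreover have "f x \<in> V" using v(4) x by blast
      ultimately have "f x = y" using is_chartD(2)[OF v(1)] y by (auto simp: inj_on_def)
      then show "y \<in> f ` N" using x by blast
    qed
    ultimately show "\<exists>T. openin Y T \<and> q \<in> T \<and> T \<subseteq> f ` N" by blast
  qed
qed

subsection \<open>Branching of maps defined on the plane\<close>

text \<open>For a primitive m-th root of unity \<open>\<zeta>\<close> the quotient
  \<open>s (\<zeta> * w) / s w\<close> is an n-th root of unity depending continuously on w in a
  connected punctured disc, hence a constant \<open>\<xi>\<close>. Injectivity of \<open>s\<close>
  makes the order of \<open>\<xi>\<close> exactly m, so \<open>s\<close> conjugates one rotation of
  order m into another.\<close>

lemma power_equivariant:
  fixes s :: "complex \<Rightarrow> complex"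
  assumes cont: "continuous_on (ball 0 \<epsilon>) s" and inj: "inj_on s (ball 0 \<epsilon>)" and s0: "s 0 = 0"
    and e: "\<epsilon> > 0" and m: "m \<ge> 1" and n: "n \<ge> 1"
    and H: "\<And>w w'. w \<in> ball 0 \<epsilon> \<Longrightarrow> w' \<in> ball 0 \<epsilon> \<Longrightarrow> w ^ m = w' ^ m \<Longrightarrow> s w ^ n = s w' ^ n"
  shows "m dvd n" "\<And>w w'. w \<in> ball 0 \<epsilon> \<Longrightarrow> w' \<in> ball 0 \<epsilon> \<Longrightarrow> s w ^ m = s w' ^ m \<longleftrightarrow> w ^ m = w' ^ m"
proof -
  define \<zeta> where "\<zeta> = exp (2 * of_real pi * \<i> / of_nat m)"
  have zj: "\<zeta> ^ j = exp (2 * of_real pi * \<i> * of_nat j / of_nat m)" for j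
    by (simp add: \<zeta>_def exp_of_nat_mult[symmetric] mult_ac)
  have z1: "\<zeta> ^ j = 1 \<longleftrightarrow> m dvd j" for j
    unfolding zj by (rule complex_root_unity_eq_1[OF m])
  have roots: "{z. z ^ m = 1} = {\<zeta> ^ j | j. j < m}"
    unfolding zj by (rule complex_roots_unity[OF m])
  have nz: "cmod \<zeta> = 1" by (simp add: \<zeta>_def norm_exp_eq_Re)
  let ?P = "ball (0::complex) \<epsilon> - {0}"
  have inP: "\<zeta> ^ j * w \<in> ?P" if "w \<in> ?P" for w j
    using that nz by (auto simp: norm_mult norm_power)
  have s_nz: "s w \<noteq> 0" if "w \<in> ?P" for w
    using inj_onD[OF inj, of w 0] that e s0 by auto
  define q where "q = (\<lambda>w. s (\<zeta> * w) / s w)"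
  have qroot: "q w ^ n = 1" if "w \<in> ?P" for w
  proof -
    have "\<zeta> * w \<in> ?P" using inP[OF that, of 1] by simp
    then have "s (\<zeta> * w) ^ n = s w ^ n"
      using that z1[of m] by (intro H) (auto simp: power_mult_distrib)
    then show ?thesis using s_nz[OF that] by (simp add: q_def power_divide)
  qed
  have "continuous_on ?P q"
    unfolding q_def
  proof (intro continuous_intros)
    show "continuous_on ?P s" by (rule continuous_on_subset[OF cont]) auto
    show "continuous_on ?P (\<lambda>w. s (\<zeta> * w))"
    proof (rule continuous_on_compose2[OF cont])
      show "continuous_on ?P (\<lambda>w. \<zeta> * w)" by (intro continuous_intros)
      show "(\<lambda>w. \<zeta> * w) ` ?P \<subseteq> ball 0 \<epsilon>" using nz by (auto simp: norm_mult)
    qed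
  qed (use s_nz in blast)
  moreover have "connected ?P"
    using e by (intro connected_punctured_convex) (auto simp: aff_dim_open)
  moreover have "finite (q ` ?P)"
    by (rule finite_subset[OF _ finite_roots_unity[OF n, where 'a = complex]]) (use qroot in auto)
  ultimately have "q constant_on ?P" using continuous_finite_range_constant by blast
  then obtain \<xi> where xi: "\<And>w. w \<in> ?P \<Longrightarrow> q w = \<xi>" unfolding constant_on_def by blast
  define w0 where "w0 = complex_of_real (\<epsilon> / 2)"
  have w0: "w0 \<in> ?P" using e by (simp add: w0_def)
  have step: "s (\<zeta> ^ j * w) = \<xi> ^ j * s w" if "w \<in> ?P" for w j
  proof (induction j)
    case (Suc j)
    have "q (\<zeta> ^ j * w) = \<xi>" using xi inP[OF that] by blast
    then have "s (\<zeta> ^ Suc j * w) = \<xi> * s (\<zeta> ^ j * w)"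
      using s_nz[OF inP[OF that, of j]] by (simp add: q_def field_simps)
    then show ?case using Suc by simp
  qed simp
  have xin: "\<xi> ^ n = 1" using qroot[OF w0] xi[OF w0] by simp
  have xi_nz: "\<xi> \<noteq> 0" using xin n by (metis power_eq_0_iff zero_neq_one zero_power not_one_le_zero gr0I)
  have xi1: "m dvd j" if "\<xi> ^ j = 1" for j
  proof -
    have "s (\<zeta> ^ j * w0) = s w0" using step[OF w0, of j] that by simp
    then have "\<zeta> ^ j * w0 = w0" using inj_onD[OF inj, of "\<zeta> ^ j * w0" w0] inP[OF w0, of j] w0 by auto
    then show ?thesis using w0 z1 by simp
  qed
  show "m dvd n" using xi1[OF xin] .
  have xim: "\<xi> ^ m = 1" using step[OF w0, of m] z1[of m] s_nz[OF w0] by simp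
  \<comment> \<open>\<open>\<xi>\<close> has order m, so its powers exhaust the m-th roots of unity;
    this gives the implication from \<open>s w ^ m = s w' ^ m\<close> below.\<close>
  have xroots: "{z. z ^ m = 1} = {\<xi> ^ j | j. j < m}"
  proof -
    have injx: "inj_on (\<lambda>j. \<xi> ^ j) {..<m}"
    proof (rule linorder_inj_onI)
      fix i j assume ij: "i < j" "i \<in> {..<m}" "j \<in> {..<m}"
      show "\<xi> ^ i \<noteq> \<xi> ^ j"
      proof
        assume "\<xi> ^ i = \<xi> ^ j"
        moreover have "\<xi> ^ j = \<xi> ^ i * \<xi> ^ (j - i)" using ij by (simp add: power_add[symmetric])
        ultimately have "\<xi> ^ (j - i) = 1" using xi_nz by simp
        then have "m dvd j - i" by (rule xi1)
        then show False using ij by (auto dest: dvd_imp_le)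
      qed
    qed auto
    have "(\<lambda>j. \<xi> ^ j) ` {..<m} = {z. z ^ m = 1}"
    proof (rule card_subset_eq)
      show "finite {z::complex. z ^ m = 1}" using m by (rule finite_roots_unity)
      show "(\<lambda>j. \<xi> ^ j) ` {..<m} \<subseteq> {z. z ^ m = 1}"
        using xim by (auto simp: power_mult[symmetric] mult.commute[of _ m]) (simp add: power_mult)
      show "card ((\<lambda>j. \<xi> ^ j) ` {..<m}) = card {z::complex. z ^ m = 1}"
        using m card_image[OF injx] by (simp add: card_roots_unity_eq)
    qed
    then show ?thesis by auto
  qed
  show "s w ^ m = s w' ^ m \<longleftrightarrow> w ^ m = w' ^ m" if w: "w \<in> ball 0 \<epsilon>" "w' \<in> ball 0 \<epsilon>" for w w'
  proof (cases "w = 0 \<or> w' = 0")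
    case True
    have "s v = 0 \<longleftrightarrow> v = 0" if "v \<in> ball 0 \<epsilon>" for v
      using inj_onD[OF inj, of v 0] that e s0 by auto
    from this[OF w(1)] this[OF w(2)] True show ?thesis using m by (auto simp: power_0_left s0)
  next
    case False
    then have P: "w \<in> ?P" "w' \<in> ?P" using w by auto
    show ?thesis
    proof
      assume "w ^ m = w' ^ m"
      then have "(w' / w) ^ m = 1" using False by (simp add: power_divide)
      then obtain j where "w' / w = \<zeta> ^ j" using roots by blast
      then have "w' = \<zeta> ^ j * w" using False by (simp add: field_simps)
      then have "s w' = \<xi> ^ j * s w" using step[OF P(1)] by simp
      then have "s w' ^ m = (\<xi> ^ m) ^ j * s w ^ m" by (simp add: power_mult_distrib power_mult[symmetric] mult.commute)
      then show "s w ^ m = s w' ^ m" using xim by simp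
    next
      assume "s w ^ m = s w' ^ m"
      then have "(s w' / s w) ^ m = 1" using s_nz[OF P(1)] s_nz[OF P(2)] by (simp add: power_divide)
      then obtain j where "s w' / s w = \<xi> ^ j" using xroots by blast
      then have "s w' = \<xi> ^ j * s w" using s_nz[OF P(1)] by (simp add: field_simps)
      then have "s w' = s (\<zeta> ^ j * w)" using step[OF P(1)] by simp
      then have "w' = \<zeta> ^ j * w" using inj_onD[OF inj] inP[OF P(1), of j] P by blast
      then have "w' ^ m = (\<zeta> ^ m) ^ j * w ^ m" by (simp add: power_mult_distrib power_mult[symmetric] mult.commute)
      then show "w ^ m = w' ^ m" using z1[of m] by simp
    qed
  qed
qed

text \<open>The source carries the orientation of the standard coordinate, enforced by \<^const>\<open>op_at\<close> on
  the local coordinate \<open>a\<close>, which need not extend to a chart of an atlas.\<close>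

definition plane_degree :: "'a topology \<Rightarrow> 'a chart set \<Rightarrow> (complex \<Rightarrow> 'a) \<Rightarrow> complex \<Rightarrow> nat \<Rightarrow> bool" where
  "plane_degree X \<A> P z d \<longleftrightarrow> d \<ge> 1 \<and> (\<exists>a \<rho> V \<psi>. \<rho> > 0 \<and> continuous_on (ball z \<rho>) a \<and> inj_on a (ball z \<rho>) \<and>
      a z = 0 \<and> op_at a z \<and> oriented_chart X \<A> (V, \<psi>) \<and> P ` ball z \<rho> \<subseteq> V \<and> (\<forall>y\<in>ball z \<rho>. \<psi> (P y) = a y ^ d))"

lemma plane_degreeE:
  assumes "plane_degree X \<A> P z d"
  obtains a \<rho> V \<psi> where "d \<ge> 1" "\<rho> > 0" "continuous_on (ball z \<rho>) a" "inj_on a (ball z \<rho>)" "a z = 0" "op_at a z"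
    "oriented_chart X \<A> (V, \<psi>)" "P ` ball z \<rho> \<subseteq> V" "\<forall>y\<in>ball z \<rho>. \<psi> (P y) = a y ^ d"
  using assms unfolding plane_degree_def by (elim conjE exE) (rule that)

text \<open>\<open>a\<close> is only continuous and injective; invariance of domain supplies the
  disc in its image on which the roots are counted.\<close>

lemma plane_degree_fiber:
  assumes d: "plane_degree X \<A> P z d" and N: "open N" "z \<in> N"
  obtains W where "open W" "z \<in> W" "W \<subseteq> N" "W \<noteq> {z}"
    "\<And>q. q \<in> W \<Longrightarrow> q \<noteq> z \<Longrightarrow> card {q' \<in> W. P q' = P q} = d"
proof -
  obtain a \<rho> V \<psi> where d1: "d \<ge> 1" and r: "\<rho> > 0" and a: "continuous_on (ball z \<rho>) a" "inj_on a (ball z \<rho>)" "a z = 0" "op_at a z"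
    and v: "oriented_chart X \<A> (V, \<psi>)" "P ` ball z \<rho> \<subseteq> V" and eq: "\<forall>y\<in>ball z \<rho>. \<psi> (P y) = a y ^ d"
    using plane_degreeE[OF d] .
  let ?B = "ball z \<rho> \<inter> N"
  have B: "open ?B" "continuous_on ?B a" "inj_on a ?B"
    using N continuous_on_subset[OF a(1)] inj_on_subset[OF a(2)] by auto
  then have "open (a ` ?B)" by (intro invariance_of_domain)
  moreover have "0 \<in> a ` ?B" using a(3) r N by force
  ultimately obtain \<delta> where \<delta>: "\<delta> > 0" "ball 0 \<delta> \<subseteq> a ` ?B" using open_contains_ball by blast
  define W where "W = ?B \<inter> a -` ball 0 \<delta>"
  have W: "open W" unfolding W_def using B by (intro continuous_open_preimage) auto
  have zW: "z \<in> W" using r N \<delta> a(3) by (simp add: W_def)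
  have "a ` W = ball 0 \<delta>" using \<delta> by (auto simp: W_def)
  then have bij: "bij_betw a W (ball 0 \<delta>)" using inj_on_subset[OF B(3), of W] by (auto simp: bij_betw_def W_def)
  show ?thesis
  proof (rule that[OF W zW])
    show "W \<subseteq> N" by (auto simp: W_def)
    show "W \<noteq> {z}" using W not_open_singleton by auto
    fix q assume q: "q \<in> W" "q \<noteq> z"
    have "a q \<noteq> 0" using inj_onD[OF B(3), of q z] q a(3) zW by (auto simp: W_def)
    moreover have "inj_on \<psi> (P ` W)"
      by (rule inj_on_subset[OF is_chartD(2)[OF oriented_chartD(1)[OF v(1)]]]) (use v(2) in \<open>auto simp: W_def\<close>)
    ultimately show "card {q' \<in> W. P q' = P q} = d"
      using bij d1 q eq by (intro card_power_fiber[where a = a and \<delta> = \<delta> and \<psi> = \<psi>]) (auto simp: W_def)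
  qed
qed

lemma power_locally:
  fixes y :: complex
  assumes "y \<noteq> 0" "d \<ge> 1"
  shows "op_at (\<lambda>w. w ^ d) y" "\<exists>\<sigma>>0. inj_on (\<lambda>w. w ^ d) (ball y \<sigma>)"
proof -
  have der: "((\<lambda>w. w ^ d) has_field_derivative of_nat d * y ^ (d - 1)) (at y)"
    by (auto intro!: derivative_eq_intros)
  have nz: "of_nat d * y ^ (d - 1) \<noteq> 0" using assms by simp
  show "op_at (\<lambda>w. w ^ d) y"
    by (rule op_at_deriv[of y 1, OF _ _ der nz]) (auto intro!: continuous_intros)
  have dnz: "deriv (\<lambda>w. w ^ d) y \<noteq> 0" using DERIV_imp_deriv[OF der] nz by simp
  have "(\<lambda>w. w ^ d) holomorphic_on UNIV" by (intro holomorphic_intros)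
  then obtain r where "r > 0" "inj_on (\<lambda>w. w ^ d) (ball y r)"
    by (rule has_complex_derivative_locally_injective[OF _ UNIV_I open_UNIV dnz])
  then show "\<exists>\<sigma>>0. inj_on (\<lambda>w. w ^ d) (ball y \<sigma>)" by blast
qed

text \<open>Away from the zero of \<open>a\<close> the power map has nonzero derivative, so
  \<open>a x ^ d\<close> is itself an orientation-preserving local coordinate, although it is not
  injective near \<open>z\<close> when d > 1.\<close>

lemma op_at_power:
  assumes a: "continuous_on (ball z \<rho>) a" "inj_on a (ball z \<rho>)" and y: "y \<in> ball z \<rho>" "a y \<noteq> 0"
    and op: "op_at a z" and d: "d \<ge> 1"
  obtains \<tau> where "\<tau> > 0" "ball y \<tau> \<subseteq> ball z \<rho>" "continuous_on (ball y \<tau>) (\<lambda>x. a x ^ d)" "inj_on (\<lambda>x. a x ^ d) (ball y \<tau>)"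
    "op_at (\<lambda>x. a x ^ d) y"
proof -
  have opy: "op_at a y" using op_at_nearby[OF a y(1)] op by blast
  obtain \<sigma> where \<sigma>: "\<sigma> > 0" "inj_on (\<lambda>w. w ^ d) (ball (a y) \<sigma>)" using power_locally(2)[OF y(2) d] by blast
  have "open (ball z \<rho> \<inter> a -` ball (a y) \<sigma>)" by (rule continuous_open_preimage[OF a(1)]) auto
  moreover have "y \<in> ball z \<rho> \<inter> a -` ball (a y) \<sigma>" using y \<sigma> by simp
  ultimately obtain \<tau> where \<tau>: "\<tau> > 0" "ball y \<tau> \<subseteq> ball z \<rho> \<inter> a -` ball (a y) \<sigma>" using open_contains_ball by blast
  have ay: "continuous_on (ball y \<tau>) a" "inj_on a (ball y \<tau>)"
    using \<tau> continuous_on_subset[OF a(1)] inj_on_subset[OF a(2)] by auto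
  show ?thesis
  proof (rule that[OF \<tau>(1)])
    show "ball y \<tau> \<subseteq> ball z \<rho>" using \<tau> by auto
    show "continuous_on (ball y \<tau>) (\<lambda>x. a x ^ d)" by (intro continuous_intros ay)
    have "inj_on (\<lambda>w. w ^ d) (a ` ball y \<tau>)" using \<tau> by (intro inj_on_subset[OF \<sigma>(2)]) auto
    then show "inj_on (\<lambda>x. a x ^ d) (ball y \<tau>)" using comp_inj_on[OF ay(2)] by (simp add: o_def)
    have "op_at ((\<lambda>w. w ^ d) \<circ> a) y"
      using op_at_comp[OF ay \<tau>(1) _ \<sigma>(2,1) opy] power_locally(1)[OF y(2) d] by (simp add: continuous_intros)
    then show "op_at (\<lambda>x. a x ^ d) y" by (simp add: o_def)
  qed
qed

lemma open_power_image:
  assumes "open S" "d \<ge> 1"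
  shows "open ((\<lambda>w::complex. w ^ d) ` S)"
proof (rule open_mapping_thm[where S = UNIV])
  show "\<not> (\<lambda>w::complex. w ^ d) constant_on UNIV"
  proof
    assume "(\<lambda>w::complex. w ^ d) constant_on UNIV"
    then obtain c where "\<And>w::complex. w ^ d = c" unfolding constant_on_def by blast
    from this[of 0] this[of 1] show False using assms(2) by (simp add: power_0_left split: if_splits)
  qed
qed (use assms in \<open>auto intro!: holomorphic_intros\<close>)


lemma op_at_oriented_chart_transition:
  assumes "oriented_chart X \<A> (V, \<psi>)" and W: "(W, \<omega>) \<in> \<A>" "is_chart X (W, \<omega>)" and x: "x \<in> V" "x \<in> W"
  shows "op_at (\<omega> \<circ> inv_into V \<psi>) (\<psi> x)"
  by (rule orientation_compatible_imp_op_at[OF oriented_chartD(1)[OF assms(1)] W(2) oriented_chartD(2)[OF assms(1) W(1)] x])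

text \<open>The local degree of a quotient. Near \<open>P z\<close> the new coordinate is \<open>P y \<mapsto> a2 (H y) ^ d1\<close>;
  it is well defined because \<open>H\<close> maps fibres of \<open>P\<close> into fibres of \<open>P\<close>.\<close>

lemma local_degree_factor:
  fixes P :: "complex \<Rightarrow> 'a" and H :: "complex \<Rightarrow> complex"
  assumes d1: "plane_degree X \<A> P z d1" and d2: "plane_degree X \<A> P (H z) d2"
    and contP: "continuous_map euclidean X P" and opP: "open_map euclidean X P"
    and H: "continuous_on UNIV H" "inj H" "op_at H z"
    and fP: "\<And>y. f (P y) = P (H y)" and atl: "\<And>c. c \<in> \<A> \<Longrightarrow> is_chart X c"
  shows "d1 dvd d2" "has_local_degree X \<A> X \<A> f (P z) (d2 div d1)"
proof -
  obtain a \<rho>1 V1 \<psi>1 where m: "d1 \<ge> 1" and r1: "\<rho>1 > 0" and a: "continuous_on (ball z \<rho>1) a" "inj_on a (ball z \<rho>1)"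
    and az: "a z = 0" and opa: "op_at a z" and v1: "oriented_chart X \<A> (V1, \<psi>1)" and PV1: "P ` ball z \<rho>1 \<subseteq> V1"
    and eq1: "\<forall>y\<in>ball z \<rho>1. \<psi>1 (P y) = a y ^ d1"
    using plane_degreeE[OF d1] .
  obtain a2 \<rho>2 V2 \<psi>2 where n: "d2 \<ge> 1" and r2: "\<rho>2 > 0" and a2: "continuous_on (ball (H z) \<rho>2) a2" "inj_on a2 (ball (H z) \<rho>2)"
    and a2z: "a2 (H z) = 0" and opa2: "op_at a2 (H z)" and v2: "oriented_chart X \<A> (V2, \<psi>2)" and PV2: "P ` ball (H z) \<rho>2 \<subseteq> V2"
    and eq2: "\<forall>y\<in>ball (H z) \<rho>2. \<psi>2 (P y) = a2 y ^ d2"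
    using plane_degreeE[OF d2] .
  note c1 = oriented_chartD(1)[OF v1] and c2 = oriented_chartD(1)[OF v2]
  have "open (H -` ball (H z) \<rho>2)" using H(1) by (simp add: continuous_on_open_vimage)
  moreover have "z \<in> H -` ball (H z) \<rho>2" using r2 by simp
  ultimately obtain \<rho>3 where r3: "\<rho>3 > 0" "ball z \<rho>3 \<subseteq> H -` ball (H z) \<rho>2" using open_contains_ball by blast
  define \<rho> where "\<rho> = min \<rho>1 \<rho>3"
  let ?B = "ball z \<rho>"
  have B1: "?B \<subseteq> ball z \<rho>1" and B2: "H ` ?B \<subseteq> ball (H z) \<rho>2" and rpos: "\<rho> > 0"
    using r1 r3 by (auto simp: \<rho>_def)
  have aB: "continuous_on ?B a" "inj_on a ?B"
    using continuous_on_subset[OF a(1) B1] inj_on_subset[OF a(2) B1] by auto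
  \<comment> \<open>A second coordinate at \<open>z\<close>, pulled back from the one at
    \<open>H z\<close>; in it the composite \<open>f \<circ> P\<close> is the power
    \<open>d2\<close>.\<close>
  define b where "b = a2 \<circ> H"
  have bB: "continuous_on ?B b" "inj_on b ?B"
    unfolding b_def
    using continuous_on_compose[OF continuous_on_subset[OF H(1)] continuous_on_subset[OF a2(1) B2]]
      comp_inj_on[OF inj_on_subset[OF H(2)] inj_on_subset[OF a2(2) B2]] by auto
  have bz: "b z = 0" by (simp add: b_def a2z)
  have opb: "op_at b z"
  proof -
    have "continuous_on (ball z 1) H" "inj_on H (ball z 1)" using H continuous_on_subset inj_on_subset by blast+
    then show ?thesis unfolding b_def using op_at_comp[of z 1 H, OF _ _ _ a2 r2 H(3)] opa2 by simp
  qed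
  have "open (a ` ?B)" using aB by (intro invariance_of_domain) auto
  moreover have "0 \<in> a ` ?B" using az rpos by force
  ultimately obtain \<epsilon> where e: "\<epsilon> > 0" "ball 0 \<epsilon> \<subseteq> a ` ?B" using open_contains_ball by blast
  define D where "D = ?B \<inter> a -` ball 0 \<epsilon>"
  have D: "open D" unfolding D_def using aB by (intro continuous_open_preimage) auto
  have DB: "D \<subseteq> ?B" and zD: "z \<in> D" using rpos e az by (auto simp: D_def)
  have aD: "a ` D = ball 0 \<epsilon>" using e by (auto simp: D_def)
  define r where "r = inv_into ?B a"
  have rD: "\<And>y. y \<in> D \<Longrightarrow> r (a y) = y" using aB(2) DB by (auto simp: r_def inv_into_f_f)
  have r_in: "r w \<in> D" and ar: "a (r w) = w" if "w \<in> ball 0 \<epsilon>" for w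
  proof -
    have "w \<in> a ` D" using that aD by blast
    then obtain y where "y \<in> D" "w = a y" by blast
    then show "r w \<in> D" "a (r w) = w" using rD by auto
  qed
  have contr: "continuous_on (ball 0 \<epsilon>) r"
    unfolding continuous_on_open_vimage[OF open_ball]
  proof (intro allI impI)
    fix G :: "complex set" assume "open G"
    have "r -` G \<inter> ball 0 \<epsilon> = a ` (D \<inter> G)"
    proof (intro subset_antisym subsetI)
      fix w assume "w \<in> r -` G \<inter> ball 0 \<epsilon>"
      then have "r w \<in> D \<inter> G" "w = a (r w)" using r_in ar by auto
      then show "w \<in> a ` (D \<inter> G)" by blast
    next
      fix w assume "w \<in> a ` (D \<inter> G)"
      then show "w \<in> r -` G \<inter> ball 0 \<epsilon>" using rD aD by auto
    qed
    moreover have "open (a ` (D \<inter> G))"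
      using D \<open>open G\<close> DB by (intro invariance_of_domain continuous_on_subset[OF aB(1)] inj_on_subset[OF aB(2)]) auto
    ultimately show "open (r -` G \<inter> ball 0 \<epsilon>)" by simp
  qed
  \<comment> \<open>The change of coordinates from \<open>a\<close> to \<open>b\<close>, to which
    the rigidity of maps respecting power fibres applies.\<close>
  define s where "s = b \<circ> r"
  have rim: "r ` ball 0 \<epsilon> \<subseteq> ?B" using r_in DB by blast
  have injr: "inj_on r (ball 0 \<epsilon>)" using ar by (metis inj_onI)
  have s: "continuous_on (ball 0 \<epsilon>) s" "inj_on s (ball 0 \<epsilon>)" "s 0 = 0"
    unfolding s_def
    using continuous_on_compose[OF contr continuous_on_subset[OF bB(1) rim]]
      comp_inj_on[OF injr inj_on_subset[OF bB(2) rim]] rD[OF zD] az bz by auto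
  have P1: "P y = P y' \<longleftrightarrow> a y ^ d1 = a y' ^ d1" if "y \<in> D" "y' \<in> D" for y y'
  proof -
    have "y \<in> ball z \<rho>1" "y' \<in> ball z \<rho>1" using that DB B1 by auto
    moreover from this have "P y \<in> V1" "P y' \<in> V1" using PV1 by auto
    ultimately show ?thesis using eq1 inj_onD[OF is_chartD(2)[OF c1], of "P y" "P y'"] by metis
  qed
  have b2: "\<psi>2 (f (P y)) = b y ^ d2" if "y \<in> D" for y
    using eq2 B2 DB that by (auto simp: fP b_def)
  have Hs: "s w ^ d2 = s w' ^ d2" if "w \<in> ball 0 \<epsilon>" "w' \<in> ball 0 \<epsilon>" "w ^ d1 = w' ^ d1" for w w'
  proof -
    have "P (r w) = P (r w')" using P1 r_in ar that by simp
    then show ?thesis using b2[OF r_in[OF that(1)]] b2[OF r_in[OF that(2)]] by (simp add: s_def)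
  qed
  show dvd: "d1 dvd d2" by (rule power_equivariant(1)[OF s e(1) m n Hs])
  have pe: "s w ^ d1 = s w' ^ d1 \<longleftrightarrow> w ^ d1 = w' ^ d1" if "w \<in> ball 0 \<epsilon>" "w' \<in> ball 0 \<epsilon>" for w w'
    by (rule power_equivariant(2)[OF s e(1) m n Hs]) (use that in auto)
  have P2: "P y = P y' \<longleftrightarrow> b y ^ d1 = b y' ^ d1" if "y \<in> D" "y' \<in> D" for y y'
  proof -
    have "a y \<in> ball 0 \<epsilon>" "a y' \<in> ball 0 \<epsilon>" using that aD by blast+
    from pe[OF this] show ?thesis using P1[OF that] rD that by (simp add: s_def)
  qed
  \<comment> \<open>By \<open>P2\<close> the value of \<open>b\<close> raised to \<open>d1\<close>
    depends only on the image point, so the choice of preimage in \<open>\<kappa>\<close> is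
    immaterial and \<open>\<kappa>\<close> is injective.\<close>
  define U where "U = P ` D"
  define \<kappa> where "\<kappa> = (\<lambda>q. b (SOME y. y \<in> D \<and> P y = q) ^ d1)"
  have chi: "\<kappa> (P y) = b y ^ d1" if "y \<in> D" for y
  proof -
    have "(SOME y'. y' \<in> D \<and> P y' = P y) \<in> D \<and> P (SOME y'. y' \<in> D \<and> P y' = P y) = P y"
      by (rule someI[of _ y]) (use that in simp)
    then show ?thesis unfolding \<kappa>_def using P2 that by blast
  qed
  have opimP: "openin X (P ` S)" if "open S" for S
    using opP that unfolding open_map_def by (simp add: open_openin[symmetric])
  have opvimP: "open (P -` S)" if "openin X S" for S
    using openin_continuous_map_preimage[OF contP that] by (simp add: open_openin[symmetric] vimage_def)
  have bD: "continuous_on D b" "inj_on b D" using continuous_on_subset[OF bB(1) DB] inj_on_subset[OF bB(2) DB] .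
  have chart: "is_chart X (U, \<kappa>)"
  proof (rule is_chartI)
    show "openin X U" unfolding U_def by (rule opimP[OF D])
    show "inj_on \<kappa> U" unfolding U_def using chi P2 by (auto simp: inj_on_def)
    fix N assume N: "openin X N" "N \<subseteq> U"
    have "\<kappa> ` N = (\<lambda>w. w ^ d1) ` b ` (D \<inter> P -` N)"
    proof (intro subset_antisym subsetI)
      fix w assume "w \<in> \<kappa> ` N"
      then obtain q where q: "q \<in> N" "w = \<kappa> q" by blast
      then obtain y where "y \<in> D" "q = P y" using N(2) unfolding U_def by blast
      then show "w \<in> (\<lambda>w. w ^ d1) ` b ` (D \<inter> P -` N)" using chi q by auto
    qed (use chi[symmetric] in auto)
    moreover have "open (b ` (D \<inter> P -` N))"
      using D opvimP[OF N(1)]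
      by (intro invariance_of_domain continuous_on_subset[OF bD(1)] inj_on_subset[OF bD(2)]) auto
    ultimately show "open (\<kappa> ` N)" using open_power_image[OF _ m] by simp
  next
    fix G :: "complex set" assume "open G"
    have "{q \<in> U. \<kappa> q \<in> G} = P ` (D \<inter> (\<lambda>y. b y ^ d1) -` G)"
      unfolding U_def using chi by auto
    moreover have "open (D \<inter> (\<lambda>y. b y ^ d1) -` G)"
      using bD D \<open>open G\<close> by (intro continuous_open_preimage continuous_intros)
    ultimately show "openin X {q \<in> U. \<kappa> q \<in> G}" using opimP by simp
  qed
  \<comment> \<open>Off the centre the transition from \<open>\<kappa>\<close> is compared with that
    from the oriented chart \<open>\<psi>1\<close>: composed with the coordinates
    \<open>b y ^ d1\<close> and \<open>a y ^ d1\<close> respectively, both equal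
    \<open>\<omega> \<circ> P\<close> on the plane.\<close>
  have "orientation_compatible (U, \<kappa>) c" if cA: "c \<in> \<A>" for c
  proof -
    obtain W \<omega> where c: "c = (W, \<omega>)" by (cases c)
    have W: "(W, \<omega>) \<in> \<A>" "is_chart X (W, \<omega>)" using cA atl c by auto
    show ?thesis unfolding c
    proof (rule orientation_compatibleI[OF chart W(2)])
      fix x assume x: "x \<in> U" "x \<in> W" "\<kappa> x \<noteq> 0"
      then obtain y where y: "y \<in> D" "x = P y" by (auto simp: U_def)
      have yz: "y \<noteq> z" using x(3) chi[OF y(1)] y(2) bz m by auto
      have by0: "b y \<noteq> 0" and ay0: "a y \<noteq> 0"
        using inj_onD[OF bD(2), of y z] inj_onD[OF inj_on_subset[OF aB(2) DB], of y z] y(1) zD yz bz az by auto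
      have yB: "y \<in> ball z \<rho>" using y DB by blast
      obtain \<tau>1 where t1: "\<tau>1 > 0" "ball y \<tau>1 \<subseteq> ball z \<rho>" "continuous_on (ball y \<tau>1) (\<lambda>x. a x ^ d1)"
        "inj_on (\<lambda>x. a x ^ d1) (ball y \<tau>1)" "op_at (\<lambda>x. a x ^ d1) y"
        using op_at_power[OF aB yB ay0 opa m] .
      obtain \<tau>2 where t2: "\<tau>2 > 0" "ball y \<tau>2 \<subseteq> ball z \<rho>" "continuous_on (ball y \<tau>2) (\<lambda>x. b x ^ d1)"
        "inj_on (\<lambda>x. b x ^ d1) (ball y \<tau>2)" "op_at (\<lambda>x. b x ^ d1) y"
        using op_at_power[OF bB yB by0 opb m] .
      have xV1: "x \<in> V1" using y PV1 DB B1 by auto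
      have ea: "\<psi>1 x = a y ^ d1" using eq1 yB B1 y(2) by auto
      have eb: "\<kappa> x = b y ^ d1" using chi y by simp
      let ?T1 = "\<omega> \<circ> inv_into V1 \<psi>1" and ?T2 = "\<omega> \<circ> inv_into U \<kappa>"
      have "\<psi>1 x \<in> \<psi>1 ` (V1 \<inter> W)" using x xV1 by blast
      then obtain \<sigma>1 where s1: "\<sigma>1 > 0" "ball (\<psi>1 x) \<sigma>1 \<subseteq> \<psi>1 ` (V1 \<inter> W)"
        using transition_map(1)[OF c1 W(2)] open_contains_ball by blast
      have "\<kappa> x \<in> \<kappa> ` (U \<inter> W)" using x by blast
      then obtain \<sigma>2 where s2: "\<sigma>2 > 0" "ball (\<kappa> x) \<sigma>2 \<subseteq> \<kappa> ` (U \<inter> W)"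
        using transition_map(1)[OF chart W(2)] open_contains_ball by blast
      note T1 = continuous_on_subset[OF transition_map(2)[OF c1 W(2)] s1(2)] inj_on_subset[OF transition_map(3)[OF c1 W(2)] s1(2)]
      note T2 = continuous_on_subset[OF transition_map(2)[OF chart W(2)] s2(2)] inj_on_subset[OF transition_map(3)[OF chart W(2)] s2(2)]
      have opT1: "op_at ?T1 (\<psi>1 x)"
        by (rule op_at_oriented_chart_transition[OF v1 W xV1 x(2)])
      have "op_at (?T1 \<circ> (\<lambda>x. a x ^ d1)) y"
        using op_at_comp[OF t1(3,4,1) T1[unfolded ea] s1(1) t1(5)] opT1 by (simp add: ea)
      moreover have "open (D \<inter> P -` W)" using D opvimP[OF is_chartD(1)[OF W(2)]] by blast
      then obtain \<tau>3 where t3: "\<tau>3 > 0" "ball y \<tau>3 \<subseteq> D \<inter> P -` W"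
    proof -
      assume "open (D \<inter> P -` W)"
      moreover have "y \<in> D \<inter> P -` W" using y x by simp
      ultimately show ?thesis using that open_contains_ball by blast
    qed
      have "(?T1 \<circ> (\<lambda>x. a x ^ d1)) y' = (?T2 \<circ> (\<lambda>x. b x ^ d1)) y'" if "y' \<in> ball y \<tau>3" for y'
      proof -
        have y': "y' \<in> D" "y' \<in> ball z \<rho>1" using that t3(2) DB B1 by blast+
        have "P y' \<in> V1" using y'(2) PV1 by blast
        then have "inv_into V1 \<psi>1 (a y' ^ d1) = P y'"
          using eq1 y' inv_into_f_f[OF is_chartD(2)[OF c1], of "P y'"] PV1 by auto
        moreover have "inv_into U \<kappa> (b y' ^ d1) = P y'"
          using chi[OF y'(1)] inv_into_f_f[OF is_chartD(2)[OF chart], of "P y'"] y' by (auto simp: U_def)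
        ultimately show ?thesis by simp
      qed
      ultimately have "op_at (?T2 \<circ> (\<lambda>x. b x ^ d1)) y" using op_at_cong[OF t3(1)] by blast
      then show "op_at ?T2 (\<kappa> x)"
        using op_at_comp[OF t2(3,4,1) T2[unfolded eb] s2(1) t2(5)] by (simp add: eb)
    qed
  qed
  then have oc: "oriented_chart X \<A> (U, \<kappa>)" using chart unfolding oriented_chart_def by blast
  show "has_local_degree X \<A> X \<A> f (P z) (d2 div d1)"
    unfolding has_local_degree_def
  proof (intro conjI exI)
    show "1 \<le> d2 div d1" using dvd n m by (auto elim!: dvdE simp: Suc_le_eq)
    show "oriented_chart X \<A> (U, \<kappa>)" "oriented_chart X \<A> (V2, \<psi>2)" by fact+
    show "P z \<in> U" using zD by (simp add: U_def)
    show "\<kappa> (P z) = 0" using chi[OF zD] bz m by simp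
    show "f (P z) \<in> V2" using PV2 r2 by (auto simp: fP)
    show "\<psi>2 (f (P z)) = 0" using b2[OF zD] bz n by simp
    show "f ` U \<subseteq> V2"
    proof
      fix q assume "q \<in> f ` U"
      then obtain y where y: "y \<in> D" "q = P (H y)" unfolding U_def by (auto simp: fP)
      then have "H y \<in> ball (H z) \<rho>2" using B2 DB by blast
      then show "q \<in> V2" using PV2 y by blast
    qed
    show "\<forall>x\<in>U. \<psi>2 (f x) = \<kappa> x ^ (d2 div d1)"
      using b2 chi dvd by (auto simp: U_def power_mult[symmetric])
  qed
qed

section \<open>The real plane as the complex plane\<close>

definition plane_of_complex :: "complex \<Rightarrow> real^2" where
  "plane_of_complex z = vector [Re z, Im z]"

lemma plane_of_complex_nth [simp]: "plane_of_complex z $ 1 = Re z" "plane_of_complex z $ 2 = Im z"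
  by (auto simp: plane_of_complex_def)

lemma complex_of_plane_inverse [simp]:
  "complex_of_plane (plane_of_complex z) = z" "plane_of_complex (complex_of_plane x) = x"
  by (auto simp: complex_of_plane_def vec_eq_iff forall_2)

lemma complex_of_plane_eq_iff [simp]: "complex_of_plane x = complex_of_plane y \<longleftrightarrow> x = y"
  by (metis complex_of_plane_inverse(2))

lemma dist_plane_of_complex [simp]: "dist (plane_of_complex z) (plane_of_complex w) = dist z w"
  by (simp add: dist_norm norm_vec_def L2_set_def sum_2 cmod_def)

lemma dist_complex_of_plane [simp]: "dist (complex_of_plane x) (complex_of_plane y) = dist x y"
  by (metis complex_of_plane_inverse(2) dist_plane_of_complex)

lemma continuous_on_plane_of_complex [continuous_intros]: "continuous_on S plane_of_complex"
  by (rule continuous_onI) auto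

lemma continuous_on_complex_of_plane [continuous_intros]: "continuous_on S complex_of_plane"
  by (rule continuous_onI) auto

lemma complex_of_plane_image: "complex_of_plane ` S = plane_of_complex -` S"
  by (auto simp: image_iff) (metis complex_of_plane_inverse)

lemma open_complex_of_plane_image: "open S \<Longrightarrow> open (complex_of_plane ` S)"
  unfolding complex_of_plane_image
  using continuous_on_plane_of_complex[of UNIV] by (simp add: continuous_on_open_vimage)

lemma open_complex_of_plane_vimage: "open S \<Longrightarrow> open (complex_of_plane -` S)"
  using continuous_on_complex_of_plane[of UNIV] by (simp add: continuous_on_open_vimage)

subsection \<open>Lattices\<close>

text \<open>The determinant of a pair of vectors. Dividing by \<open>cross2 u v\<close> gives
  coordinates with respect to the basis u, v.\<close>

definition cross2 :: "real^2 \<Rightarrow> real^2 \<Rightarrow> real" where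
  "cross2 x y = x $ 1 * y $ 2 - x $ 2 * y $ 1"

lemma cross2_linear:
  "cross2 (x + y) z = cross2 x z + cross2 y z" "cross2 x (y + z) = cross2 x y + cross2 x z"
  "cross2 (c *\<^sub>R x) z = c * cross2 x z" "cross2 x (c *\<^sub>R z) = c * cross2 x z"
  "cross2 (x - y) z = cross2 x z - cross2 y z" "cross2 x (y - z) = cross2 x y - cross2 x z"
  "cross2 x x = 0" "cross2 0 x = 0" "cross2 x 0 = 0"
  by (auto simp: cross2_def algebra_simps)

text \<open>Lagrange's identity: the squares of the determinant and of the inner product add up to
  the squared product of the norms.\<close>

lemma abs_cross2_le: "\<bar>cross2 x y\<bar> \<le> norm x * norm y"
proof -
  have "(cross2 x y)\<^sup>2 + (x \<bullet> y)\<^sup>2 = (norm x * norm y)\<^sup>2"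
    by (simp add: power_mult_distrib power2_norm_eq_inner inner_vec_def sum_2 cross2_def)
       (simp add: algebra_simps power2_eq_square)
  then have "(cross2 x y)\<^sup>2 \<le> (norm x * norm y)\<^sup>2" by (smt (verit) zero_le_power2)
  then show ?thesis by (metis abs_le_square_iff abs_mult abs_norm_cancel)
qed

text \<open>Cramer's rule with the denominator cleared.\<close>

lemma cross2_expand: "cross2 u v *\<^sub>R x = cross2 x v *\<^sub>R u + cross2 u x *\<^sub>R v"
  by (simp add: vec_eq_iff forall_2 cross2_def) (simp add: algebra_simps)

lemma cross2_nz_if_independent:
  assumes "independent {u, v}" "u \<noteq> v"
  shows "cross2 u v \<noteq> 0"
proof
  assume 0: "cross2 u v = 0"
  have "u \<noteq> 0" using assms(1) by (metis dependent_zero insertI1)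
  have "(u $ 1 *\<^sub>R v - v $ 1 *\<^sub>R u) = 0" "(u $ 2 *\<^sub>R v - v $ 2 *\<^sub>R u) = 0"
    using 0 by (auto simp: cross2_def vec_eq_iff forall_2 algebra_simps)
  moreover have "u $ 1 \<noteq> 0 \<or> u $ 2 \<noteq> 0" using \<open>u \<noteq> 0\<close> by (auto simp: vec_eq_iff forall_2)
  ultimately obtain c d where "c \<noteq> 0" "c *\<^sub>R v = d *\<^sub>R u" by auto
  then have "v = (d / c) *\<^sub>R u" by (metis divideR_right divide_inverse_commute scaleR_scaleR)
  then have "v \<in> span {u}" by (metis insertI1 span_base span_scale)
  then have "dependent {u, v}" using assms(2) 
    by (metis dependent_def insertCI insert_Diff_if insert_absorb insert_commute singletonD Diff_insert_absorb empty_iff)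
  then show False using assms(1) by simp
qed

lemma rank2_latticeE:
  assumes "rank2_lattice L"
  obtains u v where "cross2 u v \<noteq> 0" "L = {of_int m *\<^sub>R u + of_int n *\<^sub>R v | m n. True}"
proof -
  obtain u v where uv: "u \<noteq> v" "independent {u, v}" and L: "L = {of_int m *\<^sub>R u + of_int n *\<^sub>R v | m n. True}"
    using assms unfolding rank2_lattice_def by blast
  show ?thesis by (rule that[OF cross2_nz_if_independent[OF uv(2,1)] L])
qed

lemma rank2_lattice_closed:
  assumes "rank2_lattice L"
  shows "0 \<in> L" "x \<in> L \<Longrightarrow> y \<in> L \<Longrightarrow> x + y \<in> L" "x \<in> L \<Longrightarrow> y \<in> L \<Longrightarrow> x - y \<in> L" "x \<in> L \<Longrightarrow> - x \<in> L"
    "x \<in> L \<Longrightarrow> of_int k *\<^sub>R x \<in> L"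
proof -
  obtain u v where L: "L = {of_int m *\<^sub>R u + of_int n *\<^sub>R v | m n. True}"
    by (rule rank2_latticeE[OF assms])
  have I: "of_int m *\<^sub>R u + of_int n *\<^sub>R v \<in> L" for m n by (auto simp: L)
  show "0 \<in> L" using I[of 0 0] by simp
  show add: "x + y \<in> L" if xy: "x \<in> L" "y \<in> L" for x y
  proof -
    obtain m n m' n' where "x = of_int m *\<^sub>R u + of_int n *\<^sub>R v" "y = of_int m' *\<^sub>R u + of_int n' *\<^sub>R v"
      using xy unfolding L by blast
    then show ?thesis using I[of "m + m'" "n + n'"] by (simp add: algebra_simps)
  qed
  show mult: "of_int k *\<^sub>R x \<in> L" if x: "x \<in> L" for x k
  proof -
    obtain m n where "x = of_int m *\<^sub>R u + of_int n *\<^sub>R v" using x unfolding L by blast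
    then show ?thesis using I[of "k * m" "k * n"] by (simp add: algebra_simps)
  qed
  show neg: "- x \<in> L" if "x \<in> L" for x using mult[OF that, of "-1"] by simp
  show "x - y \<in> L" if "x \<in> L" "y \<in> L"
    using add[OF that(1) neg[OF that(2)]] by simp
qed

text \<open>Lattice vectors have integer coordinates, so a nonzero coordinate makes the determinant
  with a basis vector at least the covolume in size, whereas this determinant is at most the norm
  times the length of the basis vector.\<close>

lemma rank2_lattice_discrete:
  assumes "rank2_lattice L"
  obtains s where "s > 0" "\<And>l. l \<in> L \<Longrightarrow> l \<noteq> 0 \<Longrightarrow> s \<le> norm l"
proof -
  obtain u v where uv: "cross2 u v \<noteq> 0" and L: "L = {of_int m *\<^sub>R u + of_int n *\<^sub>R v | m n. True}"
    using rank2_latticeE[OF assms] .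
  define s where "s = \<bar>cross2 u v\<bar> / (norm u + norm v)"
  have pos: "norm u > 0" "norm v > 0" using uv by (auto simp: cross2_linear)
  then have p: "norm u + norm v > 0" by (rule add_pos_pos)
  show ?thesis
  proof (rule that)
    show "s > 0" using uv p by (simp add: s_def)
    fix l assume l: "l \<in> L" "l \<noteq> 0"
    then obtain m n where mn: "l = of_int m *\<^sub>R u + of_int n *\<^sub>R v" unfolding L by blast
    have c: "cross2 l v = m * cross2 u v" "cross2 u l = n * cross2 u v" unfolding mn by (simp_all add: cross2_linear)
    have "m \<noteq> 0 \<or> n \<noteq> 0" using l(2) mn by auto
    then have "\<bar>cross2 u v\<bar> \<le> \<bar>cross2 l v\<bar> \<or> \<bar>cross2 u v\<bar> \<le> \<bar>cross2 u l\<bar>"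
    proof
      assume "m \<noteq> 0"
      then have "1 \<le> \<bar>real_of_int m\<bar>" by linarith
      then show ?thesis unfolding c by (simp add: abs_mult mult_le_cancel_right1)
    next
      assume "n \<noteq> 0"
      then have "1 \<le> \<bar>real_of_int n\<bar>" by linarith
      then show ?thesis unfolding c by (simp add: abs_mult mult_le_cancel_right1)
    qed
    then have "\<bar>cross2 u v\<bar> \<le> norm l * (norm u + norm v)"
    proof
      assume "\<bar>cross2 u v\<bar> \<le> \<bar>cross2 l v\<bar>"
      also have "\<dots> \<le> norm l * norm v" by (rule abs_cross2_le)
      also have "\<dots> \<le> norm l * (norm u + norm v)" by (intro mult_left_mono) auto
      finally show ?thesis .
    next
      assume "\<bar>cross2 u v\<bar> \<le> \<bar>cross2 u l\<bar>"
      also have "\<dots> \<le> norm u * norm l" by (rule abs_cross2_le)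
      also have "\<dots> = norm l * norm u" by simp
      also have "\<dots> \<le> norm l * (norm u + norm v)" by (intro mult_left_mono) auto
      finally show ?thesis .
    qed
    then show "s \<le> norm l" using p by (simp add: s_def field_simps)
  qed
qed

lemma torus_proj_eq_iff:
  assumes "rank2_lattice L"
  shows "torus_proj L x = torus_proj L y \<longleftrightarrow> x - y \<in> L"
proof
  assume "torus_proj L x = torus_proj L y"
  moreover have "x \<in> torus_proj L x" using rank2_lattice_closed(1)[OF assms] by (simp add: torus_proj_def)
  ultimately show "x - y \<in> L" by (simp add: torus_proj_def)
next
  assume xy: "x - y \<in> L"
  have "z - x \<in> L \<longleftrightarrow> z - y \<in> L" for z
    using rank2_lattice_closed(2)[OF assms, of "z - x" "x - y"] rank2_lattice_closed(3)[OF assms, of "z - y" "x - y"] xy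
    by auto
  then show "torus_proj L x = torus_proj L y" by (simp add: torus_proj_def)
qed

text \<open>The saturation of \<open>W\<close> is a union of its lattice translates, each of them
  open.\<close>

lemma openin_torus_image:
  assumes L: "rank2_lattice L" and W: "open W"
  shows "openin (torus L) (torus_proj L ` W)"
proof -
  have "torus_proj L -` (torus_proj L ` W) = (\<Union>l\<in>L. (+) l ` W)"
  proof (intro subset_antisym subsetI)
    fix x assume "x \<in> torus_proj L -` (torus_proj L ` W)"
    then obtain w where w: "w \<in> W" "x - w \<in> L" using torus_proj_eq_iff[OF L] by auto
    then have "x = (x - w) + w" by simp
    then show "x \<in> (\<Union>l\<in>L. (+) l ` W)" using w by blast
  next
    fix x assume "x \<in> (\<Union>l\<in>L. (+) l ` W)"
    then obtain l w where "l \<in> L" "w \<in> W" "x = l + w" by blast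
    then have "torus_proj L x = torus_proj L w" using torus_proj_eq_iff[OF L] by simp
    then show "x \<in> torus_proj L -` (torus_proj L ` W)" using \<open>w \<in> W\<close> by auto
  qed
  moreover have "open (\<Union>l\<in>L. (+) l ` W)" using W by (intro open_UN ballI open_translation)
  ultimately show ?thesis unfolding openin_torus by auto
qed

lemma torus_atlas_chart:
  assumes L: "rank2_lattice L" and W: "open W" "inj_on (torus_proj L) W"
  shows "is_chart (torus L) (torus_proj L ` W, complex_of_plane \<circ> inv_into W (torus_proj L))"
proof -
  let ?T = "complex_of_plane \<circ> inv_into W (torus_proj L)"
  have T: "?T (torus_proj L w) = complex_of_plane w" if "w \<in> W" for w using W(2) that by simp
  show ?thesis
  proof (rule is_chartI)
    show "openin (torus L) (torus_proj L ` W)" by (rule openin_torus_image[OF L W(1)])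
    show "inj_on ?T (torus_proj L ` W)"
      using T by (intro inj_onI) auto
    fix N assume N: "openin (torus L) N" "N \<subseteq> torus_proj L ` W"
    have "?T ` N = complex_of_plane ` (W \<inter> torus_proj L -` N)"
    proof (intro subset_antisym subsetI)
      fix z assume "z \<in> ?T ` N"
      then obtain q where q: "q \<in> N" "z = ?T q" by blast
      then obtain w where "w \<in> W" "q = torus_proj L w" using N(2) by blast
      then show "z \<in> complex_of_plane ` (W \<inter> torus_proj L -` N)" using T q by auto
    next
      fix z assume "z \<in> complex_of_plane ` (W \<inter> torus_proj L -` N)"
      then obtain w where w: "w \<in> W" "torus_proj L w \<in> N" "z = complex_of_plane w" by blast
      then have "z = ?T (torus_proj L w)" using T by simp
      then show "z \<in> ?T ` N" using w by blast
    qed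
    moreover have "open (W \<inter> torus_proj L -` N)" using N(1) W(1) unfolding openin_torus by auto
    ultimately show "open (?T ` N)" using open_complex_of_plane_image by simp
  next
    fix G :: "complex set" assume "open G"
    have "{q \<in> torus_proj L ` W. ?T q \<in> G} = torus_proj L ` (W \<inter> complex_of_plane -` G)"
      using T by (auto simp del: comp_apply)
    then show "openin (torus L) {q \<in> torus_proj L ` W. ?T q \<in> G}"
      using openin_torus_image[OF L open_Int[OF W(1) open_complex_of_plane_vimage[OF \<open>open G\<close>]]] by simp
  qed
qed

text \<open>The torus chart, read through the projection, is the coordinate \<open>a\<close>. Its
  orientation is obtained by cancellation: followed by the transition to an atlas chart, a local
  inverse of the projection, it is the identity of the plane.\<close>

lemma has_local_degree_imp_plane_degree:
  assumes L: "rank2_lattice L"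
    and d: "has_local_degree (torus L) (torus_atlas L) X \<A> \<Theta> (torus_proj L x) d"
  shows "plane_degree X \<A> (\<lambda>z. \<Theta> (torus_proj L (plane_of_complex z))) (complex_of_plane x) d"
proof -
  let ?p = "torus_proj L" and ?z = "complex_of_plane x"
  obtain U \<phi> V \<psi> where d1: "d \<ge> 1" and c0: "oriented_chart (torus L) (torus_atlas L) (U, \<phi>)"
    and c: "?p x \<in> U" "\<phi> (?p x) = 0"
    and v: "oriented_chart X \<A> (V, \<psi>)" "\<Theta> (?p x) \<in> V" "\<psi> (\<Theta> (?p x)) = 0" "\<Theta> ` U \<subseteq> V"
    and eq: "\<forall>x\<in>U. \<psi> (\<Theta> x) = \<phi> x ^ d"
    using has_local_degreeE[OF d] .
  note cU = oriented_chartD(1)[OF c0]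
  obtain s where s: "s > 0" "\<And>l. l \<in> L \<Longrightarrow> l \<noteq> 0 \<Longrightarrow> s \<le> norm l" by (rule rank2_lattice_discrete[OF L]) blast
  have "open (?p -` U)" using is_chartD(1)[OF cU] unfolding openin_torus by blast
  then obtain \<rho>0 where r0: "\<rho>0 > 0" "ball x \<rho>0 \<subseteq> ?p -` U" using c(1) open_contains_ball_eq[of "?p -` U"] by blast
  \<comment> \<open>With radius at most s / 2, points of the disc are closer together than the lower
    bound s for nonzero lattice vectors, so the projection is injective on it.\<close>
  define \<rho> where "\<rho> = min \<rho>0 (s / 2)"
  have r: "\<rho> > 0" using r0 s by (simp add: \<rho>_def)
  define W where "W = ball x \<rho>"
  have W: "open W" "x \<in> W" "?p ` W \<subseteq> U" using r0 r by (auto simp: W_def \<rho>_def)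
  have injW: "inj_on ?p W"
  proof (rule inj_onI, rule ccontr)
    fix y y' assume y: "y \<in> W" "y' \<in> W" "?p y = ?p y'" "y \<noteq> y'"
    then have "s \<le> norm (y - y')" using s(2) torus_proj_eq_iff[OF L] by simp
    moreover have "dist y y' < s" using y(1,2) dist_triangle[of y y' x] by (simp add: W_def \<rho>_def dist_commute)
    ultimately show False by (simp add: dist_norm)
  qed
  define T where "T = complex_of_plane \<circ> inv_into W ?p"
  have TA: "(?p ` W, T) \<in> torus_atlas L" unfolding torus_atlas_def T_def using W(1) injW by blast
  have Tc: "is_chart (torus L) (?p ` W, T)" unfolding T_def by (rule torus_atlas_chart[OF L W(1) injW])
  define a where "a = (\<lambda>z. \<phi> (?p (plane_of_complex z)))"
  have ballW: "plane_of_complex z \<in> W \<longleftrightarrow> z \<in> ball ?z \<rho>" for z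
    using dist_plane_of_complex[of ?z z] by (simp add: W_def del: dist_plane_of_complex)
  have ca: "continuous_on (ball ?z \<rho>) a"
    unfolding continuous_on_open_vimage[OF open_ball]
  proof (intro allI impI)
    fix G :: "complex set" assume "open G"
    have "a -` G \<inter> ball ?z \<rho> = complex_of_plane ` (W \<inter> ?p -` {q \<in> U. \<phi> q \<in> G})"
      unfolding complex_of_plane_image using ballW W(3) by (auto simp: a_def)
    moreover have "open (?p -` {q \<in> U. \<phi> q \<in> G})"
      using is_chartD(4)[OF cU \<open>open G\<close>] unfolding openin_torus by blast
    then have "open (complex_of_plane ` (W \<inter> ?p -` {q \<in> U. \<phi> q \<in> G}))"
      by (intro open_complex_of_plane_image open_Int W(1))
    ultimately show "open (a -` G \<inter> ball ?z \<rho>)" by simp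
  qed
  have ia: "inj_on a (ball ?z \<rho>)"
  proof (rule inj_onI)
    fix z w assume zw: "z \<in> ball ?z \<rho>" "w \<in> ball ?z \<rho>" "a z = a w"
    then have w: "plane_of_complex z \<in> W" "plane_of_complex w \<in> W" using ballW by auto
    then have "?p (plane_of_complex z) = ?p (plane_of_complex w)"
      using inj_onD[OF is_chartD(2)[OF cU]] zw(3) W(3) unfolding a_def by blast
    then have "plane_of_complex z = plane_of_complex w" using inj_onD[OF injW] w by blast
    then show "z = w" by (metis complex_of_plane_inverse(1))
  qed
  have az: "a ?z = 0" using c by (simp add: a_def)
  let ?G = "T \<circ> inv_into U \<phi>"
  have xs: "?p x \<in> U" "?p x \<in> ?p ` W" using c W by auto
  have opG: "op_at ?G (a ?z)"
    using op_at_oriented_chart_transition[OF c0 TA Tc xs] by (simp add: a_def)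
  have "a ?z \<in> \<phi> ` (U \<inter> ?p ` W)" using xs by (auto simp: a_def)
  then obtain \<sigma> where sg: "\<sigma> > 0" "ball (a ?z) \<sigma> \<subseteq> \<phi> ` (U \<inter> ?p ` W)"
    using transition_map(1)[OF cU Tc] open_contains_ball by blast
  have "op_at (?G \<circ> a) ?z"
  proof (rule op_at_cong[OF r _ op_at_id])
    fix y assume "y \<in> ball ?z \<rho>"
    then have yW: "plane_of_complex y \<in> W" using ballW by simp
    then have "inv_into U \<phi> (a y) = ?p (plane_of_complex y)"
      using inv_into_f_f[OF is_chartD(2)[OF cU]] W(3) unfolding a_def by blast
    then show "y = (?G \<circ> a) y" using yW injW by (simp add: T_def)
  qed
  then have "op_at a ?z"
    using op_at_cancel[OF ca ia r continuous_on_subset[OF transition_map(2)[OF cU Tc] sg(2)]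
        inj_on_subset[OF transition_map(3)[OF cU Tc] sg(2)] sg(1) opG] by blast
  then show ?thesis unfolding plane_degree_def
  proof (intro conjI exI)
    show "(\<lambda>z. \<Theta> (?p (plane_of_complex z))) ` ball ?z \<rho> \<subseteq> V" using ballW W(3) v(4) by blast
    show "\<forall>y\<in>ball ?z \<rho>. \<psi> (\<Theta> (?p (plane_of_complex y))) = a y ^ d"
      using ballW W(3) eq unfolding a_def by blast
  qed (use d1 r ca ia az v(1) in auto)
qed

subsection \<open>Eigenvalues and iterates of linear maps\<close>

lemma quadratic_roots:
  fixes t d :: complex
  obtains \<alpha> \<beta> where "\<alpha> + \<beta> = t" "\<alpha> * \<beta> = d" "cmod \<alpha> \<le> cmod \<beta>"
proof -
  define w where "w = csqrt (t\<^sup>2 - 4 * d)"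
  have w: "w * w = t * t - 4 * d" unfolding w_def by (metis power2_csqrt power2_eq_square)
  have 1: "(t + w) / 2 + (t - w) / 2 = t" "(t - w) / 2 + (t + w) / 2 = t" by (simp_all add: field_simps)
  have 2: "(t + w) / 2 * ((t - w) / 2) = d" "(t - w) / 2 * ((t + w) / 2) = d"
    using w by (simp_all add: field_simps)
  show ?thesis
    by (cases "cmod ((t + w) / 2) \<le> cmod ((t - w) / 2)") (use that[OF 1(1) 2(1)] that[OF 1(2) 2(2)] in auto)
qed

lemma linear_plane_entries:
  assumes "linear (A :: real^2 \<Rightarrow> real^2)"
  shows "A x $ 1 = matrix A $ 1 $ 1 * x $ 1 + matrix A $ 1 $ 2 * x $ 2"
    "A x $ 2 = matrix A $ 2 $ 1 * x $ 1 + matrix A $ 2 $ 2 * x $ 2"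
proof -
  have "A x = matrix A *v x" using assms by (simp add: matrix_works)
  then show "A x $ 1 = matrix A $ 1 $ 1 * x $ 1 + matrix A $ 1 $ 2 * x $ 2"
    "A x $ 2 = matrix A $ 2 $ 1 * x $ 1 + matrix A $ 2 $ 2 * x $ 2"
    by (simp_all add: matrix_vector_mult_def sum_2)
qed

lemma eigenvalues_eq_roots:
  fixes A :: "real^2 \<Rightarrow> real^2"
  shows "k \<in> eigenvalues A \<longleftrightarrow>
    k * k - complex_of_real (matrix A $ 1 $ 1 + matrix A $ 2 $ 2) * k + complex_of_real (det (matrix A)) = 0"
proof -
  define p q r s where "p = complex_of_real (matrix A $ 1 $ 1)" and "q = complex_of_real (matrix A $ 1 $ 2)"
    and "r = complex_of_real (matrix A $ 2 $ 1)" and "s = complex_of_real (matrix A $ 2 $ 2)"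
  have ev: "map_matrix complex_of_real (matrix A) *v v = k *s v \<longleftrightarrow>
      p * v $ 1 + q * v $ 2 = k * v $ 1 \<and> r * v $ 1 + s * v $ 2 = k * v $ 2" for v :: "complex^2"
    by (simp add: vec_eq_iff forall_2 matrix_vector_mult_def sum_2 map_matrix_def p_def q_def r_def s_def)
  have nz: "v \<noteq> 0 \<longleftrightarrow> v $ 1 \<noteq> 0 \<or> v $ 2 \<noteq> 0" for v :: "complex^2"
    by (simp add: vec_eq_iff forall_2)
  have poly: "k * k - complex_of_real (matrix A $ 1 $ 1 + matrix A $ 2 $ 2) * k + complex_of_real (det (matrix A))
      = (p - k) * (s - k) - q * r"
    by (simp add: p_def q_def r_def s_def det_2 algebra_simps)
  show ?thesis unfolding poly
  proof
    assume "k \<in> eigenvalues A"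
    then obtain v :: "complex^2" where v: "v $ 1 \<noteq> 0 \<or> v $ 2 \<noteq> 0" "p * v $ 1 + q * v $ 2 = k * v $ 1" "r * v $ 1 + s * v $ 2 = k * v $ 2"
      unfolding eigenvalues_def using ev nz by blast
    have e: "(p - k) * v $ 1 = - q * v $ 2" "(s - k) * v $ 2 = - r * v $ 1"
      using v(2,3) by (auto simp: algebra_simps)
    have "((p - k) * (s - k) - q * r) * v $ 1 = (s - k) * ((p - k) * v $ 1) - q * (r * v $ 1)" by (simp add: algebra_simps)
    also have "\<dots> = - q * ((s - k) * v $ 2 + r * v $ 1)" unfolding e(1) by (simp add: algebra_simps)
    finally have 1: "((p - k) * (s - k) - q * r) * v $ 1 = 0" unfolding e(2) by simp
    have "((p - k) * (s - k) - q * r) * v $ 2 = (p - k) * ((s - k) * v $ 2) - r * (q * v $ 2)" by (simp add: algebra_simps)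
    also have "\<dots> = - r * ((p - k) * v $ 1 + q * v $ 2)" unfolding e(2) by (simp add: algebra_simps)
    finally have 2: "((p - k) * (s - k) - q * r) * v $ 2 = 0" unfolding e(1) by simp
    show "(p - k) * (s - k) - q * r = 0" using 1 2 v(1) by auto
  next
    assume z: "(p - k) * (s - k) - q * r = 0"
    have I: "k \<in> eigenvalues A" if "a \<noteq> 0 \<or> b \<noteq> 0" "p * a + q * b = k * a" "r * a + s * b = k * b" for a b
    proof -
      have "vector [a, b] \<noteq> (0::complex^2)" using that(1) nz[of "vector [a, b]"] by simp
      moreover have "map_matrix complex_of_real (matrix A) *v vector [a, b] = k *s vector [a, b]"
        unfolding ev using that by simp
      ultimately show ?thesis unfolding eigenvalues_def by blast
    qed
    \<comment> \<open>A vector annihilated by a nonzero row of the singular matrix A - k is an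
      eigenvector; if both rows vanish, any nonzero vector will do.\<close>
    show "k \<in> eigenvalues A"
    proof (cases "q = 0 \<and> p = k")
      case False
      then show ?thesis using z by (intro I[of q "k - p"]) (auto simp: algebra_simps)
    next
      case qp: True
      show ?thesis
      proof (cases "s = k \<and> r = 0")
        case False
        then show ?thesis using qp by (intro I[of "s - k" "- r"]) (auto simp: algebra_simps)
      next
        case True
        then show ?thesis using qp by (intro I[of 1 0]) auto
      qed
    qed
  qed
qed

lemma eigenvalues_pair:
  fixes A :: "real^2 \<Rightarrow> real^2"
  obtains \<alpha> \<beta> where "eigenvalues A = {\<alpha>, \<beta>}" "cmod \<alpha> \<le> cmod \<beta>"
    "\<alpha> + \<beta> = complex_of_real (matrix A $ 1 $ 1 + matrix A $ 2 $ 2)" "\<alpha> * \<beta> = complex_of_real (det (matrix A))"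
proof -
  obtain \<alpha> \<beta> where ab: "\<alpha> + \<beta> = complex_of_real (matrix A $ 1 $ 1 + matrix A $ 2 $ 2)"
    "\<alpha> * \<beta> = complex_of_real (det (matrix A))" "cmod \<alpha> \<le> cmod \<beta>"
    by (rule quadratic_roots)
  have "k * k - (\<alpha> + \<beta>) * k + \<alpha> * \<beta> = (k - \<alpha>) * (k - \<beta>)" for k by (simp add: algebra_simps)
  then have "eigenvalues A = {\<alpha>, \<beta>}"
    using eigenvalues_eq_roots[of _ A] unfolding ab(1,2)[symmetric] by (auto simp: set_eq_iff)
  then show ?thesis using that ab by blast
qed

text \<open>By Cayley-Hamilton, \<open>y = (B - \<alpha>) x\<close> is an eigenvector for \<open>\<beta>\<close>, so the orbit of \<open>x\<close> satisfies
  \<open>B (B ^ n x) = \<alpha> B ^ n x + \<beta> ^ n y\<close>.\<close>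

lemma funpow_growth:
  fixes B :: "real^2 \<Rightarrow> real^2" and p q r s :: real
  assumes B: "\<And>x. B x $ 1 = p * x $ 1 + q * x $ 2" "\<And>x. B x $ 2 = r * x $ 1 + s * x $ 2"
    and ab: "\<alpha> + \<beta> = complex_of_real (p + s)" "\<alpha> * \<beta> = complex_of_real (p * s - q * r)"
    and rho: "cmod \<alpha> \<le> \<rho>" "cmod \<beta> \<le> \<rho>" "0 < \<rho>"
  shows "\<exists>c>0. \<forall>n x. norm ((B ^^ n) x) \<le> c * (real n + 1) * \<rho> ^ n * norm x"
proof -
  define e1 e2 where "e1 = (\<lambda>n x. complex_of_real ((B ^^ n) x $ 1))" and "e2 = (\<lambda>n x. complex_of_real ((B ^^ n) x $ 2))"
  define y1 y2 where "y1 = (\<lambda>x. e1 1 x - \<alpha> * e1 0 x)" and "y2 = (\<lambda>x. e2 1 x - \<alpha> * e2 0 x)"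
  have step: "e1 (Suc n) x = p * e1 n x + q * e2 n x" "e2 (Suc n) x = r * e1 n x + s * e2 n x" for n x
    by (simp_all add: e1_def e2_def B)
  have beta: "\<beta> = p + s - \<alpha>" using ab(1) by (simp add: algebra_simps)
  have ch: "\<alpha> * \<alpha> = (p + s) * \<alpha> - (p * s - q * r)"
    using ab(2) unfolding beta by (simp add: algebra_simps)
  have By: "p * y1 x + q * y2 x = \<beta> * y1 x" "r * y1 x + s * y2 x = \<beta> * y2 x" for x
  proof -
    have y: "y1 x = (p - \<alpha>) * e1 0 x + q * e2 0 x" "y2 x = r * e1 0 x + (s - \<alpha>) * e2 0 x"
      unfolding y1_def y2_def One_nat_def step by (simp_all add: algebra_simps)
    have "p * y1 x + q * y2 x - \<beta> * y1 x = (\<alpha> * \<alpha> * (- 1) + (p + s) * \<alpha> - (p * s - q * r)) * e1 0 x"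
      unfolding y beta by (simp add: algebra_simps)
    then show "p * y1 x + q * y2 x = \<beta> * y1 x" unfolding ch by (simp add: algebra_simps)
    have "r * y1 x + s * y2 x - \<beta> * y2 x = (\<alpha> * \<alpha> * (- 1) + (p + s) * \<alpha> - (p * s - q * r)) * e2 0 x"
      unfolding y beta by (simp add: algebra_simps)
    then show "r * y1 x + s * y2 x = \<beta> * y2 x" unfolding ch by (simp add: algebra_simps)
  qed
  have rec: "e1 (Suc n) x = \<alpha> * e1 n x + \<beta> ^ n * y1 x \<and> e2 (Suc n) x = \<alpha> * e2 n x + \<beta> ^ n * y2 x" for n x
  proof (induction n)
    case 0 show ?case by (simp add: y1_def y2_def)
  next
    case (Suc n)
    have "e1 (Suc (Suc n)) x = \<alpha> * (p * e1 n x + q * e2 n x) + \<beta> ^ n * (p * y1 x + q * y2 x)"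
      by (subst step) (simp add: Suc algebra_simps)
    moreover have "e2 (Suc (Suc n)) x = \<alpha> * (r * e1 n x + s * e2 n x) + \<beta> ^ n * (r * y1 x + s * y2 x)"
      by (subst step) (simp add: Suc algebra_simps)
    ultimately show ?case unfolding By step[symmetric] by simp
  qed
  define E where "E = (\<lambda>n x. cmod (e1 n x) + cmod (e2 n x))"
  define Y where "Y = (\<lambda>x. cmod (y1 x) + cmod (y2 x))"
  have Erec: "E (Suc n) x \<le> \<rho> * E n x + \<rho> ^ n * Y x" for n x
  proof -
    have bn: "cmod (\<beta> ^ n) \<le> \<rho> ^ n" unfolding norm_power by (rule power_mono[OF rho(2)]) simp
    have b: "cmod (\<alpha> * a + \<beta> ^ n * c) \<le> \<rho> * cmod a + \<rho> ^ n * cmod c" for a c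
    proof -
      have "cmod (\<alpha> * a + \<beta> ^ n * c) \<le> cmod \<alpha> * cmod a + cmod (\<beta> ^ n) * cmod c"
        by (metis norm_mult norm_triangle_ineq)
      also have "\<dots> \<le> \<rho> * cmod a + \<rho> ^ n * cmod c"
        using rho(1) bn by (intro add_mono mult_right_mono) auto
      finally show ?thesis .
    qed
    have "E (Suc n) x \<le> (\<rho> * cmod (e1 n x) + \<rho> ^ n * cmod (y1 x)) + (\<rho> * cmod (e2 n x) + \<rho> ^ n * cmod (y2 x))"
      unfolding E_def using rec[where n = n and x = x] b by (simp add: add_mono)
    then show ?thesis by (simp add: E_def Y_def algebra_simps)
  qed
  \<comment> \<open>Each of the n steps contributes at most \<open>\<rho> ^ (n - 1) * Y x\<close>;
    this is the linear factor, which a Jordan block really produces.\<close>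
  have Ebd: "E n x \<le> \<rho> ^ n * (E 0 x + real n * Y x / \<rho>)" for n x
  proof (induction n)
    case (Suc n)
    have "E (Suc n) x \<le> \<rho> * E n x + \<rho> ^ n * Y x" by (rule Erec)
    also have "\<dots> \<le> \<rho> * (\<rho> ^ n * (E 0 x + real n * Y x / \<rho>)) + \<rho> ^ n * Y x"
      using Suc rho(3) by (intro add_right_mono mult_left_mono) auto
    also have "\<dots> = \<rho> ^ Suc n * (E 0 x + real (Suc n) * Y x / \<rho>)"
      using rho(3) by (simp add: field_simps)
    finally show ?case .
  qed simp
  have E0: "E 0 x \<le> 2 * norm x" for x
    unfolding E_def e1_def e2_def using component_le_norm_cart[of x 1] component_le_norm_cart[of x 2] by simp
  have Elow: "norm ((B ^^ n) x) \<le> E n x" for n x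
  proof -
    have "norm ((B ^^ n) x) \<le> (\<Sum>i\<in>UNIV. \<bar>(B ^^ n) x $ i\<bar>)" by (rule norm_le_l1_cart)
    then show ?thesis by (simp add: sum_2 E_def e1_def e2_def)
  qed
  define K where "K = \<bar>p\<bar> + \<bar>q\<bar> + \<bar>r\<bar> + \<bar>s\<bar> + 2 * cmod \<alpha>"
  have Yb: "Y x \<le> K * norm x" for x
  proof -
    have x: "\<bar>x $ 1\<bar> \<le> norm x" "\<bar>x $ 2\<bar> \<le> norm x"
      using component_le_norm_cart[of x 1] component_le_norm_cart[of x 2] by auto
    have c: "cmod (complex_of_real a * complex_of_real b) \<le> \<bar>a\<bar> * norm x" if "\<bar>b\<bar> \<le> norm x" for a b
      using that by (simp add: norm_mult mult_left_mono)
    have ca: "cmod (\<alpha> * complex_of_real b) \<le> cmod \<alpha> * norm x" if "\<bar>b\<bar> \<le> norm x" for b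
      using that by (simp add: norm_mult mult_left_mono)
    have "y1 x = p * complex_of_real (x $ 1) + q * complex_of_real (x $ 2) - \<alpha> * complex_of_real (x $ 1)"
      unfolding y1_def One_nat_def step by (simp add: e1_def e2_def)
    then have 1: "cmod (y1 x) \<le> \<bar>p\<bar> * norm x + \<bar>q\<bar> * norm x + cmod \<alpha> * norm x"
      using c[OF x(1), of p] c[OF x(2), of q] ca[OF x(1)] norm_triangle_ineq4 norm_triangle_ineq by (smt (verit))
    have "y2 x = r * complex_of_real (x $ 1) + s * complex_of_real (x $ 2) - \<alpha> * complex_of_real (x $ 2)"
      unfolding y2_def One_nat_def step by (simp add: e1_def e2_def)
    then have 2: "cmod (y2 x) \<le> \<bar>r\<bar> * norm x + \<bar>s\<bar> * norm x + cmod \<alpha> * norm x"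
      using c[OF x(1), of r] c[OF x(2), of s] ca[OF x(2)] norm_triangle_ineq4 norm_triangle_ineq by (smt (verit))
    show ?thesis using 1 2 by (simp add: Y_def K_def algebra_simps)
  qed
  have K0: "K \<ge> 0" by (simp add: K_def)
  define c where "c = 2 + K / \<rho>"
  show ?thesis
  proof (intro exI[of _ c] conjI allI)
    show c0: "0 < c" using K0 rho(3) by (simp add: c_def add_pos_nonneg)
    fix n x
    have "norm ((B ^^ n) x) \<le> \<rho> ^ n * (E 0 x + real n * Y x / \<rho>)" using Elow Ebd order_trans by blast
    also have "\<dots> \<le> \<rho> ^ n * (2 * norm x + real n * (K * norm x) / \<rho>)"
      using E0[of x] Yb[of x] rho(3) by (intro mult_left_mono add_mono divide_right_mono) auto
    also have "\<dots> \<le> \<rho> ^ n * (c * (real n + 1) * norm x)"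
    proof (rule mult_left_mono)
      have "2 * norm x + real n * (K * norm x) / \<rho> \<le> 2 * (real n + 1) * norm x + (real n + 1) * (K / \<rho>) * norm x"
      proof (rule add_mono)
        show "2 * norm x \<le> 2 * (real n + 1) * norm x" by (simp add: algebra_simps)
        have "real n * (K / \<rho> * norm x) \<le> (real n + 1) * (K / \<rho> * norm x)"
          using K0 rho(3) by (intro mult_right_mono) auto
        then show "real n * (K * norm x) / \<rho> \<le> (real n + 1) * (K / \<rho>) * norm x" by (simp add: mult_ac)
      qed
      then show "2 * norm x + real n * (K * norm x) / \<rho> \<le> c * (real n + 1) * norm x"
        by (simp add: c_def algebra_simps)
    qed (use rho in simp)
    finally show "norm ((B ^^ n) x) \<le> c * (real n + 1) * \<rho> ^ n * norm x" by (simp add: mult_ac)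
  qed
qed

text \<open>The inverse of \<open>A\<close> has the eigenvalues 1/\<alpha> and 1/\<beta>, both of
  modulus at most \<open>1 / lam\<close>, which bounds its iterates. As for the slowly growing
  vector: a real \<alpha> has a real eigenvector, and a non-real one is conjugate to \<beta>, so
  that both have modulus \<open>lam\<close> and every nonzero vector qualifies.\<close>

lemma linear_expansion:
  fixes A :: "real^2 \<Rightarrow> real^2"
  assumes lin: "linear A" and det: "det (matrix A) > 0"
  defines "lam \<equiv> Min (cmod ` eigenvalues A)"
  obtains Ai c v where "linear Ai" "\<And>x. A (Ai x) = x" "\<And>x. Ai (A x) = x" "lam > 0" "c > 0" "v \<noteq> 0"
    "\<And>n x. norm ((Ai ^^ n) x) \<le> c * (real n + 1) * (1 / lam) ^ n * norm x"
    "\<And>n. norm ((A ^^ n) v) \<le> c * (real n + 1) * lam ^ n * norm v" "lam \<in> cmod ` eigenvalues A"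
proof -
  obtain \<alpha> \<beta> where ev: "eigenvalues A = {\<alpha>, \<beta>}" "cmod \<alpha> \<le> cmod \<beta>"
    and ab: "\<alpha> + \<beta> = complex_of_real (matrix A $ 1 $ 1 + matrix A $ 2 $ 2)" "\<alpha> * \<beta> = complex_of_real (det (matrix A))"
    by (rule eigenvalues_pair)
  define p q r s where "p = matrix A $ 1 $ 1" and "q = matrix A $ 1 $ 2" and "r = matrix A $ 2 $ 1" and "s = matrix A $ 2 $ 2"
  define D where "D = p * s - q * r"
  have D: "D = det (matrix A)" "D > 0" using det by (auto simp: D_def p_def q_def r_def s_def det_2)
  have A: "A x $ 1 = p * x $ 1 + q * x $ 2" "A x $ 2 = r * x $ 1 + s * x $ 2" for x
    using linear_plane_entries[OF lin, of x] by (auto simp: p_def q_def r_def s_def)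
  have lam: "lam = cmod \<alpha>" using ev by (simp add: lam_def)
  have ab': "\<alpha> + \<beta> = complex_of_real (p + s)" "\<alpha> * \<beta> = complex_of_real D" using ab D by (auto simp: p_def s_def)
  have nz: "\<alpha> \<noteq> 0" "\<beta> \<noteq> 0" using ab'(2) D(2) by auto
  define Ai where "Ai = (\<lambda>x::real^2. (vector [(s * x $ 1 - q * x $ 2) / D, (p * x $ 2 - r * x $ 1) / D] :: real^2))"
  have Ai: "Ai x $ 1 = (s / D) * x $ 1 + (- q / D) * x $ 2" "Ai x $ 2 = (- r / D) * x $ 1 + (p / D) * x $ 2" for x
    by (simp_all add: Ai_def field_simps diff_divide_distrib)
  have "linear Ai"
    by (rule linearI) (simp_all add: vec_eq_iff forall_2 Ai algebra_simps)
  have Dn: "D \<noteq> 0" using D by simp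
  have inv1: "A (Ai x) = x" for x
  proof -
    have "p * ((s / D) * x $ 1 + (- q / D) * x $ 2) + q * ((- r / D) * x $ 1 + (p / D) * x $ 2) = (D / D) * x $ 1"
      "r * ((s / D) * x $ 1 + (- q / D) * x $ 2) + s * ((- r / D) * x $ 1 + (p / D) * x $ 2) = (D / D) * x $ 2"
      unfolding D_def by (simp_all add: field_simps)
    then show ?thesis using Dn by (simp add: vec_eq_iff forall_2 A Ai)
  qed
  have inv2: "Ai (A x) = x" for x
  proof -
    have "(s / D) * (p * x $ 1 + q * x $ 2) + (- q / D) * (r * x $ 1 + s * x $ 2) = (D / D) * x $ 1"
      "(- r / D) * (p * x $ 1 + q * x $ 2) + (p / D) * (r * x $ 1 + s * x $ 2) = (D / D) * x $ 2"
      unfolding D_def by (simp_all add: field_simps)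
    then show ?thesis using Dn by (simp add: vec_eq_iff forall_2 A Ai)
  qed
  have lam0: "lam > 0" using nz lam by simp
  have sum: "1 / \<alpha> + 1 / \<beta> = complex_of_real (s / D + p / D)"
  proof -
    have "1 / \<alpha> + 1 / \<beta> = (\<alpha> + \<beta>) / (\<alpha> * \<beta>)" using nz by (simp add: field_simps)
    then show ?thesis unfolding ab' by (simp add: add_divide_distrib add.commute)
  qed
  have prod: "1 / \<alpha> * (1 / \<beta>) = complex_of_real ((s / D) * (p / D) - (- q / D) * (- r / D))"
  proof -
    have "(s / D) * (p / D) - (- q / D) * (- r / D) = D / (D * D)" by (simp add: D_def diff_divide_distrib mult_ac)
    also have "\<dots> = 1 / D" using Dn by simp
    finally have e: "(s / D) * (p / D) - (- q / D) * (- r / D) = 1 / D" .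
    have "1 / \<alpha> * (1 / \<beta>) = 1 / (\<alpha> * \<beta>)" by simp
    also have "\<dots> = complex_of_real (1 / D)" unfolding ab'(2) by simp
    finally show ?thesis unfolding e .
  qed
  have "cmod (1 / \<alpha>) \<le> 1 / lam" "cmod (1 / \<beta>) \<le> 1 / lam"
    using ev(2) lam nz by (auto simp: norm_divide divide_simps)
  then obtain c1 where c1: "c1 > 0" "\<And>n x. norm ((Ai ^^ n) x) \<le> c1 * (real n + 1) * (1 / lam) ^ n * norm x"
    using funpow_growth[OF Ai sum prod, of "1 / lam"] lam0 by auto
  obtain c2 v where c2: "c2 > 0" "v \<noteq> 0" "\<And>n. norm ((A ^^ n) v) \<le> c2 * (real n + 1) * lam ^ n * norm v"
  proof (cases "Im \<alpha> = 0")
    case True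
    define a where "a = Re \<alpha>"
    have a: "\<alpha> = complex_of_real a" using True by (simp add: a_def complex_eq_iff)
    have "\<alpha> \<in> eigenvalues A" using ev by simp
    then obtain w :: "complex^2" where w: "w \<noteq> 0" "map_matrix complex_of_real (matrix A) *v w = \<alpha> *s w"
      unfolding eigenvalues_def by blast
    have w': "p * w $ 1 + q * w $ 2 = \<alpha> * w $ 1" "r * w $ 1 + s * w $ 2 = \<alpha> * w $ 2"
      using w(2) by (simp_all add: vec_eq_iff forall_2 matrix_vector_mult_def sum_2 map_matrix_def p_def q_def r_def s_def)
    define v1 v2 :: "real^2" where "v1 = vector [Re (w $ 1), Re (w $ 2)]" and "v2 = vector [Im (w $ 1), Im (w $ 2)]"
    have Re: "Re (p * w $ 1 + q * w $ 2) = Re (\<alpha> * w $ 1)" "Re (r * w $ 1 + s * w $ 2) = Re (\<alpha> * w $ 2)"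
      "Im (p * w $ 1 + q * w $ 2) = Im (\<alpha> * w $ 1)" "Im (r * w $ 1 + s * w $ 2) = Im (\<alpha> * w $ 2)" using w' by auto
    \<comment> \<open>\<open>A\<close> and \<alpha> are real, so the real and imaginary parts of a
      complex eigenvector satisfy the same equation, and one of them is nonzero.\<close>
    have "A v1 = a *\<^sub>R v1" "A v2 = a *\<^sub>R v2"
      using Re unfolding a by (simp_all add: vec_eq_iff forall_2 A v1_def v2_def)
    moreover have "v1 \<noteq> 0 \<or> v2 \<noteq> 0"
      using w(1) by (auto simp: vec_eq_iff forall_2 v1_def v2_def complex_eq_iff)
    ultimately obtain v where v: "v \<noteq> 0" "A v = a *\<^sub>R v" by blast
    have An: "(A ^^ n) v = (a ^ n) *\<^sub>R v" for n
      by (induction n) (auto simp: linear_scale[OF lin] v(2))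
    have "norm ((A ^^ n) v) \<le> 1 * (real n + 1) * lam ^ n * norm v" for n
    proof -
      have "norm ((A ^^ n) v) = lam ^ n * norm v" unfolding An by (simp add: lam a power_abs)
      also have "\<dots> \<le> (real n + 1) * (lam ^ n * norm v)"
        using mult_right_mono[of 1 "real n + 1" "lam ^ n * norm v"] lam0 by simp
      finally show ?thesis by (simp add: mult_ac)
    qed
    then show ?thesis using that[of 1 v] v by auto
  next
    case False
    have root: "\<alpha> * \<alpha> - complex_of_real (p + s) * \<alpha> + complex_of_real D = 0"
      unfolding ab'[symmetric] by (simp add: algebra_simps)
    then have "cnj (\<alpha> * \<alpha> - complex_of_real (p + s) * \<alpha> + complex_of_real D) = 0" by simp
    then have "cnj \<alpha> * cnj \<alpha> - complex_of_real (p + s) * cnj \<alpha> + complex_of_real D = 0" by simp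
    then have "(cnj \<alpha> - \<alpha>) * (cnj \<alpha> - \<beta>) = 0" unfolding ab'[symmetric] by (simp add: algebra_simps)
    then have "cnj \<alpha> = \<beta>" using False by (auto simp: complex_eq_iff)
    then have "cmod \<beta> = lam" using lam by (metis complex_mod_cnj)
    then obtain c where c: "c > 0" "\<And>n x. norm ((A ^^ n) x) \<le> c * (real n + 1) * lam ^ n * norm x"
      using funpow_growth[OF A ab'[unfolded D_def], of lam] lam lam0 by auto
    show ?thesis using that[of c "axis 1 1"] c(1) c(2)[where x = "axis 1 1"] by (simp add: axis_eq_0_iff)
  qed
  show ?thesis
  proof (rule that[of Ai "max c1 c2" v])
    show "norm ((Ai ^^ n) x) \<le> max c1 c2 * (real n + 1) * (1 / lam) ^ n * norm x" for n x
    proof -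
      have "c1 * ((real n + 1) * (1 / lam) ^ n * norm x) \<le> max c1 c2 * ((real n + 1) * (1 / lam) ^ n * norm x)"
        using lam0 by (intro mult_right_mono) auto
      then show ?thesis using order_trans[OF c1(2)[where n = n and x = x]] by (simp only: mult.assoc)
    qed
    show "norm ((A ^^ n) v) \<le> max c1 c2 * (real n + 1) * lam ^ n * norm v" for n
    proof -
      have "c2 * ((real n + 1) * lam ^ n * norm v) \<le> max c1 c2 * ((real n + 1) * lam ^ n * norm v)"
        using lam0 by (intro mult_right_mono) auto
      then show ?thesis using order_trans[OF c2(3)[of n]] by (simp only: mult.assoc)
    qed
    show "lam \<in> cmod ` eigenvalues A" using lam ev by simp
  qed (use \<open>linear Ai\<close> inv1 inv2 lam0 c1 c2 in auto)
qed

subsection \<open>Finite cyclic groups of torus automorphisms\<close>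

lemma finite_cyclic_group_powers:
  assumes "group G" "cyclic_group G" "finite (carrier G)"
  obtains a m where "a \<in> carrier G" "m > 0" "a [^]\<^bsub>G\<^esub> (m::nat) = \<one>\<^bsub>G\<^esub>" "\<And>g. g \<in> carrier G \<Longrightarrow> \<exists>j::nat. g = a [^]\<^bsub>G\<^esub> j"
proof -
  interpret group G by fact
  obtain a where a: "a \<in> carrier G" "carrier G = range (\<lambda>n::int. a [^]\<^bsub>G\<^esub> n)"
    using assms(2) cyclic_group by blast
  define m where "m = order G"
  have m: "m > 0" using assms(3) by (simp add: m_def order_gt_0_iff_finite)
  have am: "a [^]\<^bsub>G\<^esub> m = \<one>\<^bsub>G\<^esub>" unfolding m_def by (rule pow_order_eq_1[OF a(1)])
  show ?thesis
  proof (rule that[OF a(1) m am])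
    fix g assume "g \<in> carrier G"
    then obtain n :: int where n: "g = a [^]\<^bsub>G\<^esub> n" using a(2) by blast
    \<comment> \<open>Adding a multiple of the group order makes the exponent nonnegative without
      changing the power.\<close>
    define j where "j = nat (n + \<bar>n\<bar> * int m)"
    have nn: "n + \<bar>n\<bar> * int m \<ge> 0" using m by (smt (verit) mult_le_cancel_left1 of_nat_0_less_iff)
    have "a [^]\<^bsub>G\<^esub> (\<bar>n\<bar> * int m) = (a [^]\<^bsub>G\<^esub> int m) [^]\<^bsub>G\<^esub> \<bar>n\<bar>"
      using a(1) by (simp add: int_pow_pow mult.commute)
    also have "\<dots> = \<one>\<^bsub>G\<^esub>" using am by (simp add: int_pow_int)
    finally have "a [^]\<^bsub>G\<^esub> (n + \<bar>n\<bar> * int m) = g" using a(1) n by (simp add: int_pow_mult)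
    moreover have "a [^]\<^bsub>G\<^esub> (n + \<bar>n\<bar> * int m) = a [^]\<^bsub>G\<^esub> j" using nn by (simp add: j_def flip: int_pow_int)
    ultimately show "\<exists>j::nat. g = a [^]\<^bsub>G\<^esub> j" by metis
  qed
qed

lemma linear_det_cross2:
  assumes "linear R"
  shows "cross2 (R x) (R y) = det (matrix R) * cross2 x y"
  unfolding cross2_def linear_plane_entries[OF assms] det_2 by (simp add: algebra_simps)

lemma funpow_linear: "linear R \<Longrightarrow> linear (R ^^ n)" for R :: "'v::real_vector \<Rightarrow> 'v"
proof (induction n)
  case (Suc n)
  then have "linear (R \<circ> (R ^^ n))" by (intro linear_compose) auto
  then show ?case by (simp only: funpow.simps)
qed (simp add: linear_id)

lemma parallel_components:
  fixes a b c d :: real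
  assumes "a * d = b * c"
  shows "(a * a + b * b) * c = (a * c + b * d) * a" "(a * a + b * b) * d = (a * c + b * d) * b"
proof -
  have "(a * a + b * b) * c - (a * c + b * d) * a = b * (b * c - a * d)" by (simp add: algebra_simps)
  then show "(a * a + b * b) * c = (a * c + b * d) * a" using assms by simp
  have "(a * a + b * b) * d - (a * c + b * d) * b = a * (a * d - b * c)" by (simp add: algebra_simps)
  then show "(a * a + b * b) * d = (a * c + b * d) * b" using assms by simp
qed

text \<open>Finite order and positive determinant force determinant 1. A map of determinant 1 with a
  fixed vector \<open>v\<close> is a shear along \<open>v\<close>, and a nontrivial shear has
  infinite order.\<close>

lemma finite_order_fixed_vector:
  fixes S :: "real^2 \<Rightarrow> real^2"
  assumes S: "linear S" "det (matrix S) > 0" "m > 0" "\<And>y. (S ^^ m) y = y" and v: "v \<noteq> 0" "S v = v"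
  shows "S w = w"
proof -
  let ?d = "det (matrix S)"
  have pw: "cross2 ((S ^^ n) x) ((S ^^ n) y) = ?d ^ n * cross2 x y" for n x y
    by (induction n) (auto simp: linear_det_cross2[OF S(1)])
  have "?d ^ m = 1"
    using pw[of m "axis 1 1" "axis 2 1"] S(4) by (simp add: cross2_def axis_def)
  then have d1: "?d = 1" using S(2,3) by (metis less_imp_le power_eq_1_iff norm_ge_zero real_norm_def abs_of_pos not_gr0)
  have c0: "cross2 v (S w - w) = 0" using linear_det_cross2[OF S(1), of v w] v(2) d1 by (simp add: cross2_linear)
  define z where "z = S w - w"
  have "v $ 1 * z $ 2 = v $ 2 * z $ 1" using c0 by (simp add: cross2_def z_def)
  from parallel_components[OF this] have "(v \<bullet> v) *\<^sub>R z = (v \<bullet> z) *\<^sub>R v"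
    by (simp add: vec_eq_iff forall_2 inner_vec_def sum_2)
  then have "(1 / (v \<bullet> v)) *\<^sub>R ((v \<bullet> v) *\<^sub>R z) = (1 / (v \<bullet> v)) *\<^sub>R ((v \<bullet> z) *\<^sub>R v)" by simp
  then have "z = ((v \<bullet> z) / (v \<bullet> v)) *\<^sub>R v" using v(1) by simp
  then obtain t where "S w - w = t *\<^sub>R v" unfolding z_def by blast
  then have t: "S w = w + t *\<^sub>R v" by (simp add: algebra_simps)
  have "(S ^^ n) w = w + (real n * t) *\<^sub>R v" for n
    by (induction n) (auto simp: linear_add[OF S(1)] linear_scale[OF S(1)] t v(2) algebra_simps)
  from this[of m] have "(real m * t) *\<^sub>R v = 0" using S(4) by simp
  then show ?thesis using v(1) S(3) t by simp
qed

text \<open>A generator acts by an affine map, so the fibres of \<open>\<Theta>\<close> are the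
  orbits of its iterates modulo \<open>L\<close>. Its linear part \<open>R\<close> has finite order
  because R^m - 1 is linear with values in the discrete set \<open>L\<close>. The disjunction on
  \<open>c\<close> records what remains when the generator is a translation.\<close>

lemma torus_group_affine:
  assumes L: "rank2_lattice L" and G: "group G" "cyclic_group G" "finite (carrier G)"
    and ind: "induced_by_rigid_action L G act \<Theta>"
  obtains R c m where "linear R" "det (matrix R) > 0" "m > 0" "\<forall>x\<in>L. R x \<in> L" "\<forall>x. (R ^^ m) x = x"
    "real m *\<^sub>R c \<in> L \<or> (\<exists>x. R x \<noteq> x)"
    "\<forall>x y. \<Theta> (torus_proj L x) = \<Theta> (torus_proj L y) \<longleftrightarrow> (\<exists>j. x - ((\<lambda>y. R y + c) ^^ j) y \<in> L)"
proof -
  let ?p = "torus_proj L" and ?E = "topspace (torus L)"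
  have E: "?E = range ?p" by (rule topspace_torus)
  obtain a m where a: "a \<in> carrier G" "m > 0" "a [^]\<^bsub>G\<^esub> (m::nat) = \<one>\<^bsub>G\<^esub>" "\<And>g. g \<in> carrier G \<Longrightarrow> \<exists>j::nat. g = a [^]\<^bsub>G\<^esub> j"
    by (rule finite_cyclic_group_powers[OF G]) blast
  interpret group G by fact
  interpret group_action G ?E act using ind by (simp add: induced_by_rigid_action_def)
  obtain R where "torus_endomorphism_of L (act a) R"
    using ind a(1) unfolding induced_by_rigid_action_def torus_automorphism_def by blast
  then obtain c where R: "linear R" "det (matrix R) > 0" and c0': "\<forall>x y. x - y \<in> L \<longrightarrow> (R x + c) - (R y + c) \<in> L"
    and c': "\<forall>x. act a (?p x) = ?p (R x + c)"
    unfolding torus_endomorphism_of_def by (elim conjE exE)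
  note c0 = c0'[rule_format] and c = c'[rule_format]
  let ?k = "\<lambda>y. R y + c"
  have RL: "R x \<in> L" if "x \<in> L" for x using c0[of x 0] that linear_0[OF R(1)] by simp
  have actj: "act (a [^]\<^bsub>G\<^esub> (j::nat)) (?p y) = ?p ((?k ^^ j) y)" for j y
  proof (induction j arbitrary: y)
    case 0
    have "act \<one>\<^bsub>G\<^esub> = (\<lambda>x\<in>?E. x)" using id_eq_one by simp
    then show ?case by (simp add: E)
  next
    case (Suc j)
    have "act (a [^]\<^bsub>G\<^esub> Suc j) (?p y) = act (a [^]\<^bsub>G\<^esub> j) (act a (?p y))"
      using a(1) E by (simp add: composition_rule)
    moreover have "(?k ^^ Suc j) y = (?k ^^ j) (?k y)" by (simp only: funpow_Suc_right o_apply)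
    ultimately show ?case using Suc c by (simp del: funpow.simps)
  qed
  have "act \<one>\<^bsub>G\<^esub> (?p y) = ?p y" for y
    using actj[of 0 y] by simp
  then have km: "(?k ^^ m) y - y \<in> L" for y
    using actj[of m y] a(3) torus_proj_eq_iff[OF L] by metis
  have kR: "(?k ^^ j) y = (R ^^ j) y + (?k ^^ j) 0" for j y
  proof (induction j)
    case (Suc j)
    have "(?k ^^ Suc j) y = R ((R ^^ j) y + (?k ^^ j) 0) + c" using Suc by simp
    then show ?case by (simp add: linear_add[OF R(1)])
  qed simp
  have lm: "linear (R ^^ m)" by (rule funpow_linear[OF R(1)])
  have Rm: "(R ^^ m) y = y" for y
  proof (rule ccontr)
    assume ne: "(R ^^ m) y \<noteq> y"
    obtain s where s: "s > 0" "\<And>l. l \<in> L \<Longrightarrow> l \<noteq> 0 \<Longrightarrow> s \<le> norm l" by (rule rank2_lattice_discrete[OF L]) blast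
    define w where "w = (R ^^ m) y - y"
    have w: "w \<noteq> 0" using ne by (simp add: w_def)
    \<comment> \<open>Scaling by \<open>e\<close> turns a nonzero value of the linear map R^m - 1
      into a lattice vector of length s / 2.\<close>
    define e where "e = s / (2 * norm w)"
    have e: "e > 0" using s w by (simp add: e_def)
    have "(?k ^^ m) (e *\<^sub>R y) - e *\<^sub>R y - ((?k ^^ m) 0 - 0) \<in> L"
      using rank2_lattice_closed(3)[OF L km km] .
    also have "(?k ^^ m) (e *\<^sub>R y) - e *\<^sub>R y - ((?k ^^ m) 0 - 0) = e *\<^sub>R w"
      by (subst kR) (simp add: w_def linear_scale[OF lm] algebra_simps)
    finally have "s \<le> norm (e *\<^sub>R w)" using s(2)[of "e *\<^sub>R w"] e w by simp
    then show False using s(1) w by (simp add: e_def)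
  qed
  have mc: "real m *\<^sub>R c \<in> L \<or> (\<exists>x. R x \<noteq> x)"
  proof (rule disjCI)
    assume "\<not> (\<exists>x. R x \<noteq> x)"
    then have "(?k ^^ j) 0 = real j *\<^sub>R c" for j by (induction j) (auto simp: algebra_simps)
    then show "real m *\<^sub>R c \<in> L" using km[of 0] by simp
  qed
  have "\<Theta> (?p x) = \<Theta> (?p y) \<longleftrightarrow> (\<exists>j. x - (?k ^^ j) y \<in> L)" for x y
  proof -
    have "\<Theta> (?p x) = \<Theta> (?p y) \<longleftrightarrow> (\<exists>g\<in>carrier G. ?p x = act g (?p y))"
      using ind E unfolding induced_by_rigid_action_def by blast
    also have "\<dots> \<longleftrightarrow> (\<exists>j::nat. ?p x = act (a [^]\<^bsub>G\<^esub> j) (?p y))"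
      using a(1,4) nat_pow_closed by metis
    finally show ?thesis unfolding actj torus_proj_eq_iff[OF L] .
  qed
  then have iff: "\<forall>x y. \<Theta> (?p x) = \<Theta> (?p y) \<longleftrightarrow> (\<exists>j. x - (?k ^^ j) y \<in> L)" by (intro allI)
  have RL': "\<forall>x\<in>L. R x \<in> L" and Rm': "\<forall>x. (R ^^ m) x = x" using RL Rm by auto
  show ?thesis by (rule that[OF R(1,2) a(2) RL' Rm' mc iff])
qed

lemma plane_degree_inj:
  assumes d: "plane_degree X \<A> P z d" and inj: "inj_on P (ball z \<tau>)" "\<tau> > 0"
  shows "d = 1"
proof -
  obtain W where W: "open W" "z \<in> W" "W \<subseteq> ball z \<tau>" "W \<noteq> {z}" "\<And>q. q \<in> W \<Longrightarrow> q \<noteq> z \<Longrightarrow> card {q' \<in> W. P q' = P q} = d"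
    by (rule plane_degree_fiber[OF d open_ball, of z \<tau>]) (use inj(2) in auto)
  obtain q where q: "q \<in> W" "q \<noteq> z" using W by blast
  have "{q' \<in> W. P q' = P q} = {q}" using inj_onD[OF inj(1)] W(3) q by blast
  then show ?thesis using W(5)[OF q] by simp
qed

text \<open>Near \<open>z\<close> but off it, the power of the coordinate is injective on small
  discs, hence so is \<open>P\<close>, and a locally injective map has degree 1.\<close>

lemma plane_degree_isolated:
  assumes d: "plane_degree X \<A> P z d"
  obtains \<rho> where "\<rho> > 0" "\<And>y d'. y \<in> ball z \<rho> \<Longrightarrow> y \<noteq> z \<Longrightarrow> plane_degree X \<A> P y d' \<Longrightarrow> d' = 1"
proof -
  obtain a \<rho> V \<psi> where d1: "d \<ge> 1" and r: "\<rho> > 0" and a: "continuous_on (ball z \<rho>) a" "inj_on a (ball z \<rho>)" "a z = 0" "op_at a z"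
    and v: "oriented_chart X \<A> (V, \<psi>)" "P ` ball z \<rho> \<subseteq> V" and eq: "\<forall>y\<in>ball z \<rho>. \<psi> (P y) = a y ^ d"
    using plane_degreeE[OF d] .
  show ?thesis
  proof (rule that[OF r])
    fix y d' assume y: "y \<in> ball z \<rho>" "y \<noteq> z" and d': "plane_degree X \<A> P y d'"
    have "a y \<noteq> 0" using inj_onD[OF a(2), of y z] y a(3) r by auto
    then obtain \<tau> where t: "\<tau> > 0" "ball y \<tau> \<subseteq> ball z \<rho>" "inj_on (\<lambda>x. a x ^ d) (ball y \<tau>)"
      using op_at_power[OF a(1,2) y(1) _ a(4) d1] by blast
    have "inj_on P (ball y \<tau>)"
    proof (rule inj_onI)
      fix x x' assume x: "x \<in> ball y \<tau>" "x' \<in> ball y \<tau>" "P x = P x'"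
      have "x \<in> ball z \<rho>" "x' \<in> ball z \<rho>" using x t(2) by blast+
      then have "a x ^ d = a x' ^ d" using eq x(3) by metis
      then show "x = x'" using inj_onD[OF t(3)] x by blast
    qed
    then show "d' = 1" by (rule plane_degree_inj[OF d' _ t(1)])
  qed
qed

subsection \<open>Branching of Lattes presentations\<close>

text \<open>Rounding down the coordinates with respect to a basis leaves a remainder no longer than
  the sum of the basis lengths.\<close>

lemma rank2_lattice_cobounded:
  assumes "rank2_lattice L"
  obtains \<rho> where "\<rho> > 0" "\<And>x. \<exists>l\<in>L. norm (x - l) \<le> \<rho>"
proof -
  obtain u v where uv: "cross2 u v \<noteq> 0" and L: "L = {of_int m *\<^sub>R u + of_int n *\<^sub>R v | m n. True}"
    by (rule rank2_latticeE[OF assms])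
  have pos: "norm u > 0" using uv by (auto simp: cross2_linear)
  show ?thesis
  proof (rule that[of "norm u + norm v"])
    show "norm u + norm v > 0" using pos by (simp add: add_pos_nonneg)
    fix x
    define s t where "s = cross2 x v / cross2 u v" and "t = cross2 u x / cross2 u v"
    have "cross2 u v *\<^sub>R x = cross2 u v *\<^sub>R (s *\<^sub>R u + t *\<^sub>R v)"
      using uv cross2_expand[of u v x] by (simp add: s_def t_def scaleR_add_right)
    then have x: "x = s *\<^sub>R u + t *\<^sub>R v" using uv by simp
    define l where "l = of_int \<lfloor>s\<rfloor> *\<^sub>R u + of_int \<lfloor>t\<rfloor> *\<^sub>R v"
    have "x - l = (s - \<lfloor>s\<rfloor>) *\<^sub>R u + (t - \<lfloor>t\<rfloor>) *\<^sub>R v" by (simp add: x l_def algebra_simps)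
    then have "norm (x - l) \<le> \<bar>s - \<lfloor>s\<rfloor>\<bar> * norm u + \<bar>t - \<lfloor>t\<rfloor>\<bar> * norm v"
      by (metis norm_scaleR norm_triangle_ineq)
    also have "\<dots> \<le> 1 * norm u + 1 * norm v"
    proof -
      have "\<bar>s - \<lfloor>s\<rfloor>\<bar> \<le> 1" "\<bar>t - \<lfloor>t\<rfloor>\<bar> \<le> 1" by linarith+
      then show ?thesis by (intro add_mono mult_right_mono) auto
    qed
    finally have "norm (x - l) \<le> norm u + norm v" by simp
    then show "\<exists>l\<in>L. norm (x - l) \<le> norm u + norm v" unfolding L l_def by blast
  qed
qed

lemma op_at_linear_plane:
  assumes A: "linear A" "det (matrix A) > 0"
  shows "op_at (\<lambda>z. complex_of_plane (A (plane_of_complex z) + b)) z"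
proof -
  define p q r s where "p = matrix A $ 1 $ 1" and "q = matrix A $ 1 $ 2" and "r = matrix A $ 2 $ 1" and "s = matrix A $ 2 $ 2"
  \<comment> \<open>The complex coefficients of \<open>A\<close> in the form
    \<open>\<alpha> * z + \<beta> * cnj z\<close>; the difference of their squared moduli is the
    determinant.\<close>
  define \<alpha> \<beta> where "\<alpha> = Complex ((p + s) / 2) ((r - q) / 2)" and "\<beta> = Complex ((p - s) / 2) ((r + q) / 2)"
  have "(cmod \<alpha>)\<^sup>2 - (cmod \<beta>)\<^sup>2 = p * s - q * r"
    unfolding \<alpha>_def \<beta>_def cmod_power2 complex.sel by (simp add: power2_eq_square field_simps)
  also have "\<dots> > 0" using A(2) by (simp add: p_def q_def r_def s_def det_2)
  finally have lt: "cmod \<beta> < cmod \<alpha>" by (simp add: power2_less_imp_less)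
  have "(\<lambda>z. complex_of_plane (A (plane_of_complex z) + b)) = (\<lambda>z. \<alpha> * z + \<beta> * cnj z + complex_of_plane b)"
    by (auto simp: fun_eq_iff complex_eq_iff complex_of_plane_def linear_plane_entries[OF A(1)] p_def q_def r_def s_def
        \<alpha>_def \<beta>_def field_simps)
  then show ?thesis using op_at_real_linear[OF lt] by simp
qed

lemma affine_funpow_diff:
  fixes A :: "'v::real_vector \<Rightarrow> 'v"
  assumes "linear A"
  shows "((\<lambda>x. A x + b) ^^ n) x - ((\<lambda>x. A x + b) ^^ n) y = (A ^^ n) (x - y)"
  by (induction n) (auto simp: linear_diff[OF assms] algebra_simps simp flip: linear_diff[OF assms])

lemma linear_growth_tendsto_0:
  fixes c r :: real
  assumes "0 \<le> r" "r < 1"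
  shows "(\<lambda>n. c * (real n + 1) * r ^ n * K) \<longlonglongrightarrow> 0"
proof -
  have "(\<lambda>n. real n * r ^ n) \<longlonglongrightarrow> 0" using powser_times_n_limit_0[of r] assms by simp
  moreover have "(\<lambda>n. r ^ n) \<longlonglongrightarrow> 0" using assms by (intro LIMSEQ_power_zero) simp
  ultimately have "(\<lambda>n. c * K * (real n * r ^ n + r ^ n)) \<longlonglongrightarrow> c * K * (0 + 0)"
    by (intro tendsto_mult tendsto_add tendsto_const)
  then show ?thesis by (simp add: algebra_simps)
qed

locale lattes_presentation =
  fixes X :: "'a topology" and \<A> :: "'a chart set" and f :: "'a \<Rightarrow> 'a" and A :: "real^2 \<Rightarrow> real^2"
    and L :: "(real^2) set" and \<Theta> :: "(real^2) set \<Rightarrow> 'a" and b :: "real^2"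
  assumes atl: "\<And>c. c \<in> \<A> \<Longrightarrow> is_chart X c"
    and connX: "connected_space X" and hausX: "Hausdorff_space X"
    and L: "rank2_lattice L" and linA: "linear A" and detA: "det (matrix A) > 0"
    and expanding: "\<forall>k\<in>eigenvalues A. cmod k > 1"
    and cover: "branched_covering_map (torus L) (torus_atlas L) X \<A> \<Theta>"
    and semiconj: "\<And>x. f (\<Theta> (torus_proj L x)) = \<Theta> (torus_proj L (A x + b))"
begin

definition Pr :: "real^2 \<Rightarrow> 'a" where "Pr x = \<Theta> (torus_proj L x)"

text \<open>The projection to the torus is unbranched, so this is also the degree of
  \<open>Pr\<close> at \<open>x\<close>.\<close>

definition D :: "real^2 \<Rightarrow> nat" where
  "D x = (SOME d. has_local_degree (torus L) (torus_atlas L) X \<A> \<Theta> (torus_proj L x) d)"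

abbreviation "h \<equiv> (\<lambda>x. A x + b)"

lemma D_local_degree: "has_local_degree (torus L) (torus_atlas L) X \<A> \<Theta> (torus_proj L x) (D x)"
proof -
  have "torus_proj L x \<in> topspace (torus L)" by (simp add: topspace_torus)
  then show ?thesis using cover someI_ex unfolding D_def branched_covering_map_def by metis
qed

lemma D_cong: "torus_proj L x = torus_proj L y \<Longrightarrow> D x = D y"
  by (simp add: D_def)

lemma D_plane_degree: "plane_degree X \<A> (\<lambda>z. Pr (plane_of_complex z)) (complex_of_plane x) (D x)"
  using has_local_degree_imp_plane_degree[OF L D_local_degree] by (simp add: Pr_def)

lemma D_pos: "D x \<ge> 1"
  using D_local_degree by (simp add: has_local_degree_def)

lemma continuous_Pr: "continuous_map euclidean X Pr"
proof -
  have "continuous_map euclidean X (\<Theta> \<circ> torus_proj L)"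
    using quotient_imp_continuous_map[OF quotient_map_torus_proj] cover
    unfolding branched_covering_map_def by (blast intro: continuous_map_compose)
  then show ?thesis by (simp add: Pr_def[abs_def] o_def)
qed

lemma open_Pr: "open_map euclidean X Pr"
  unfolding open_map_def
proof (intro allI impI)
  fix S :: "(real^2) set" assume "openin euclidean S"
  then have "openin (torus L) (torus_proj L ` S)" using openin_torus_image[OF L] by simp
  then have "openin X (\<Theta> ` torus_proj L ` S)"
    using branched_covering_map_open[OF cover] unfolding open_map_def by blast
  then show "openin X (Pr ` S)" by (simp add: image_image Pr_def)
qed

lemma Pr_lattice: "l \<in> L \<Longrightarrow> Pr (x + l) = Pr x"
  using torus_proj_eq_iff[OF L, of "x + l" x] by (simp add: Pr_def)

text \<open>By periodicity a bounded disc already covers the image. The image is therefore compact,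
  hence closed; it is also open and nonempty in a connected space.\<close>

lemma range_Pr: "range Pr = topspace X"
proof -
  obtain \<rho> where r: "\<rho> > 0" "\<And>x. \<exists>l\<in>L. norm (x - l) \<le> \<rho>" by (rule rank2_lattice_cobounded[OF L]) blast
  have "range Pr = Pr ` cball 0 \<rho>"
  proof (intro subset_antisym subsetI)
    fix q assume "q \<in> range Pr"
    then obtain x where x: "q = Pr x" by blast
    obtain l where l: "l \<in> L" "norm (x - l) \<le> \<rho>" using r by blast
    have "q = Pr (x - l)" using Pr_lattice[OF l(1), of "x - l"] x by simp
    then show "q \<in> Pr ` cball 0 \<rho>" using l by simp
  qed auto
  moreover have "compactin X (Pr ` cball 0 \<rho>)"
    by (rule image_compactin[OF _ continuous_Pr]) simp
  ultimately have "closedin X (range Pr)" using hausX by (simp add: compactin_imp_closedin)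
  moreover have "openin X (range Pr)" using open_Pr unfolding open_map_def by simp
  ultimately show ?thesis using connX unfolding connected_space_clopen_in by blast
qed

lemma Pr_in [simp]: "Pr x \<in> topspace X"
  using range_Pr by blast

lemma f_Pr: "f (Pr x) = Pr (h x)"
  using semiconj by (simp add: Pr_def)

lemma f_funpow_Pr: "(f ^^ n) (Pr x) = Pr ((h ^^ n) x)"
  by (induction n) (auto simp: f_Pr)

text \<open>The chain rule for f \<circ> Pr = Pr \<circ> h, in which the affine bijection
  \<open>h\<close> has degree 1.\<close>

lemma local_degree_f: "D (h x) = local_degree X \<A> f (Pr x) * D x"
proof -
  let ?P = "\<lambda>z. Pr (plane_of_complex z)" and ?H = "\<lambda>z. complex_of_plane (h (plane_of_complex z))"
  let ?z = "complex_of_plane x"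
  obtain Ai where Ai: "\<And>x. Ai (A x) = x" by (rule linear_expansion[OF linA detA]) blast
  have d2: "plane_degree X \<A> ?P (?H ?z) (D (h x))" using D_plane_degree[of "h x"] by simp
  have cP: "continuous_map euclidean X ?P"
    using continuous_map_compose[of euclidean euclidean plane_of_complex X Pr] continuous_Pr
      continuous_on_plane_of_complex[of UNIV] by (simp add: o_def)
  have oP: "open_map euclidean X ?P"
    unfolding open_map_def
  proof (intro allI impI)
    fix S :: "complex set" assume "openin euclidean S"
    then have "open (complex_of_plane -` S)" using open_complex_of_plane_vimage by simp
    then have "openin X (Pr ` (complex_of_plane -` S))" using open_Pr unfolding open_map_def by simp
    moreover have "Pr ` (complex_of_plane -` S) = ?P ` S"
      by (auto simp: image_iff) (metis complex_of_plane_inverse)+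
    ultimately show "openin X (?P ` S)" by simp
  qed
  have cH: "continuous_on UNIV ?H"
    by (intro continuous_on_compose2[OF continuous_on_complex_of_plane[of UNIV]] continuous_intros
        continuous_on_compose2[OF linear_continuous_on[of A UNIV]])
       (use linA in \<open>auto intro: linear_conv_bounded_linear[THEN iffD1]\<close>)
  have iH: "inj ?H"
  proof (rule injI)
    fix z w assume "?H z = ?H w"
    then have "plane_of_complex z = plane_of_complex w" using Ai by (metis add_right_cancel complex_of_plane_eq_iff)
    then show "z = w" by (metis complex_of_plane_inverse(1))
  qed
  have fP: "f (?P z) = ?P (?H z)" for z by (simp add: f_Pr)
  note * = local_degree_factor[OF D_plane_degree d2 cP oP cH iH op_at_linear_plane[OF linA detA] fP atl]
  have "local_degree X \<A> f (Pr x) = D (h x) div D x"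
    using local_degree_eq[OF *(2)] by simp
  then show ?thesis using *(1) by simp
qed

lemma D_fiber:
  obtains W where "open W" "x \<in> W" "\<And>q. q \<in> W \<Longrightarrow> q \<noteq> x \<Longrightarrow> card {q' \<in> W. Pr q' = Pr q} = D x"
proof -
  obtain W where W: "open W" "complex_of_plane x \<in> W"
    "\<And>q. q \<in> W \<Longrightarrow> q \<noteq> complex_of_plane x \<Longrightarrow> card {q' \<in> W. Pr (plane_of_complex q') = Pr (plane_of_complex q)} = D x"
    by (rule plane_degree_fiber[OF D_plane_degree open_UNIV UNIV_I]) blast
  show ?thesis
  proof (rule that[of "complex_of_plane -` W"])
    show "open (complex_of_plane -` W)" using W by (intro open_complex_of_plane_vimage)
    fix q assume q: "q \<in> complex_of_plane -` W" "q \<noteq> x"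
    have "bij_betw complex_of_plane {q' \<in> complex_of_plane -` W. Pr q' = Pr q}
        {q' \<in> W. Pr (plane_of_complex q') = Pr (plane_of_complex (complex_of_plane q))}"
      by (rule bij_betwI[where g = plane_of_complex]) auto
    then show "card {q' \<in> complex_of_plane -` W. Pr q' = Pr q} = D x"
      using W(3)[of "complex_of_plane q"] q bij_betw_same_card by fastforce
  qed (use W in auto)
qed

text \<open>The preimages of \<open>y\<close> and \<open>y + u\<close> under a high iterate of \<open>h\<close> are very close to each other, so they
  are not both branch points.\<close>

lemma unbranched_preimage:
  obtains x j where "D x = 1" "torus_proj L ((h ^^ j) x) = torus_proj L y"
proof -
  obtain Ai c v where Ai: "linear Ai" "\<And>x. A (Ai x) = x" "\<And>x. Ai (A x) = x"
    and lam: "Min (cmod ` eigenvalues A) \<in> cmod ` eigenvalues A"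
    and c: "\<And>n x. norm ((Ai ^^ n) x) \<le> c * (real n + 1) * (1 / Min (cmod ` eigenvalues A)) ^ n * norm x"
    by (rule linear_expansion[OF linA detA]) blast
  have lam1: "Min (cmod ` eigenvalues A) > 1" using lam expanding by auto
  obtain u w where uw: "cross2 u w \<noteq> 0" and Leq: "L = {of_int m *\<^sub>R u + of_int n *\<^sub>R w | m n. True}"
    by (rule rank2_latticeE[OF L])
  have u: "u \<noteq> 0" using uw by (auto simp: cross2_linear)
  have uL: "u \<in> L" unfolding Leq by (intro CollectI exI[of _ 1] exI[of _ 0]) simp
  define hi where "hi = (\<lambda>x. Ai (x - b))"
  have hhi: "h (hi x) = x" for x by (simp add: hi_def Ai)
  have hhin: "(h ^^ n) ((hi ^^ n) x) = x" for n x
  proof (induction n arbitrary: x)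
    case (Suc n)
    have "(h ^^ Suc n) ((hi ^^ Suc n) x) = h ((h ^^ n) ((hi ^^ n) (hi x)))"
      by (simp only: funpow.simps(2) o_apply) (simp only: funpow_swap1)
    then show ?case using Suc hhi by simp
  qed simp
  have hi_aff: "hi = (\<lambda>x. Ai x + (- Ai b))" by (simp add: hi_def linear_diff[OF Ai(1)] fun_eq_iff)
  define wj where "wj = (\<lambda>j. (Ai ^^ j) u)"
  have hid: "(hi ^^ j) (y + u) = (hi ^^ j) y + wj j" for j
    using affine_funpow_diff[OF Ai(1), of j "- Ai b" "y + u" y] unfolding hi_aff wj_def by (simp add: algebra_simps)
  have wne: "wj j \<noteq> 0" for j
  proof (induction j)
    case (Suc j)
    have "wj (Suc j) = Ai (wj j)" by (simp add: wj_def)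
    then show ?case using Suc Ai(2)[of "wj j"] linear_0[OF linA] by auto
  qed (simp add: wj_def u)
  have "(\<lambda>j. c * (real j + 1) * (1 / Min (cmod ` eigenvalues A)) ^ j * norm u) \<longlonglongrightarrow> 0"
    using lam1 by (intro linear_growth_tendsto_0) auto
  then have w0: "wj \<longlonglongrightarrow> 0" unfolding wj_def by (rule Lim_null_comparison[rotated]) (use c in auto)
  obtain \<rho> where r: "\<rho> > 0" "\<And>x. \<exists>l\<in>L. norm (x - l) \<le> \<rho>" by (rule rank2_lattice_cobounded[OF L]) blast
  \<comment> \<open>The lattice moves the preimages into a fixed disc, where a subsequence converges
    to some \<open>x\<close>. Close to \<open>x\<close> only \<open>x\<close> itself can be a branch
    point.\<close>
  have "\<forall>j. \<exists>l. l \<in> L \<and> norm ((hi ^^ j) y - l) \<le> \<rho>" using r(2) by blast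
  then obtain l where l: "\<And>j. l j \<in> L" "\<And>j. norm ((hi ^^ j) y - l j) \<le> \<rho>" by metis
  define z where "z = (\<lambda>j. (hi ^^ j) y - l j)"
  have "\<forall>j. z j \<in> cball 0 \<rho>" using l by (simp add: z_def)
  then obtain x \<phi> where x: "strict_mono \<phi>" "(z \<circ> \<phi>) \<longlonglongrightarrow> x"
    using compact_cball[of "0::real^2" \<rho>] unfolding compact_def by metis
  obtain \<epsilon> where e: "\<epsilon> > 0" "\<And>y d'. y \<in> ball (complex_of_plane x) \<epsilon> \<Longrightarrow> y \<noteq> complex_of_plane x \<Longrightarrow>
      plane_degree X \<A> (\<lambda>z. Pr (plane_of_complex z)) y d' \<Longrightarrow> d' = 1"
    by (rule plane_degree_isolated[OF D_plane_degree]) blast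
  have D1: "D q = 1" if "dist q x < \<epsilon>" "q \<noteq> x" for q
    using e(2)[OF _ _ D_plane_degree[of q]] that by (simp add: dist_commute)
  have w0': "(wj \<circ> \<phi>) \<longlonglongrightarrow> 0" using LIMSEQ_subseq_LIMSEQ[OF w0 x(1)] .
  have "eventually (\<lambda>j. dist ((z \<circ> \<phi>) j) x < \<epsilon> / 2) sequentially"
    using tendstoD[OF x(2), of "\<epsilon> / 2"] e(1) by simp
  moreover have "eventually (\<lambda>j. dist ((wj \<circ> \<phi>) j) 0 < \<epsilon> / 2) sequentially"
    using tendstoD[OF w0', of "\<epsilon> / 2"] e(1) by simp
  ultimately have "eventually (\<lambda>j. dist ((z \<circ> \<phi>) j) x < \<epsilon> / 2 \<and> dist ((wj \<circ> \<phi>) j) 0 < \<epsilon> / 2) sequentially"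
    by (rule eventually_conj)
  then obtain j0 where j0: "dist (z (\<phi> j0)) x < \<epsilon> / 2" "norm (wj (\<phi> j0)) < \<epsilon> / 2"
    by (auto simp: eventually_sequentially)
  define j where "j = \<phi> j0"
  have d1: "dist (z j) x < \<epsilon>" using j0 e(1) by (simp add: j_def)
  have d2: "dist (z j + wj j) x < \<epsilon>"
  proof -
    have "dist (z j + wj j) x \<le> dist (z j) x + norm (wj j)"
      using norm_triangle_ineq[of "z j - x" "wj j"] by (simp add: dist_norm algebra_simps)
    then show ?thesis using j0 by (simp add: j_def)
  qed
  have p1: "torus_proj L (z j) = torus_proj L ((hi ^^ j) y)"
    unfolding torus_proj_eq_iff[OF L] using rank2_lattice_closed(4)[OF L l(1)] by (simp add: z_def)
  have p2: "torus_proj L (z j + wj j) = torus_proj L ((hi ^^ j) (y + u))"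
    unfolding torus_proj_eq_iff[OF L] hid using rank2_lattice_closed(4)[OF L l(1)] by (simp add: z_def)
  \<comment> \<open>The two nearby preimages are distinct, so at least one of them is not the
    exceptional point.\<close>
  have "z j \<noteq> x \<or> z j + wj j \<noteq> x" using wne[of j] by auto
  then show ?thesis
  proof
    assume "z j \<noteq> x"
    then have "D ((hi ^^ j) y) = 1" using D1[OF d1] D_cong[OF p1] by simp
    then show ?thesis using that[of "(hi ^^ j) y" j] hhin by simp
  next
    assume "z j + wj j \<noteq> x"
    then have "D ((hi ^^ j) (y + u)) = 1" using D1[OF d2] D_cong[OF p2] by simp
    moreover have "torus_proj L (y + u) = torus_proj L y" unfolding torus_proj_eq_iff[OF L] using uL by simp
    ultimately show ?thesis using that[of "(hi ^^ j) (y + u)" j] hhin by simp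
  qed
qed

lemma local_degree_pos: "local_degree X \<A> f (Pr x) \<ge> 1"
  using local_degree_f[of x] D_pos[of "h x"] by (cases "local_degree X \<A> f (Pr x)") auto

text \<open>On an orbit from an unbranched point to y modulo \<open>L\<close> the degree
  \<open>D\<close> rises from 1 to at least 2, so by the chain rule it passes over a critical point
  of \<open>f\<close>, and \<open>Pr y\<close> is a later image of that point.\<close>

lemma branched_in_post:
  assumes "D y \<ge> 2"
  shows "Pr y \<in> post X \<A> f"
proof -
  obtain x j where x: "D x = 1" "torus_proj L ((h ^^ j) x) = torus_proj L y" by (rule unbranched_preimage)
  have Dj: "D ((h ^^ j) x) \<ge> 2" using D_cong[OF x(2)] assms by simp
  have "\<exists>i<j. local_degree X \<A> f (Pr ((h ^^ i) x)) \<ge> 2"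
  proof (rule ccontr)
    assume "\<not> ?thesis"
    then have ld: "local_degree X \<A> f (Pr ((h ^^ i) x)) = 1" if "i < j" for i
      using local_degree_pos[of "(h ^^ i) x"] that by (metis One_nat_def Suc_1 le_antisym not_less_eq_eq)
    have "D ((h ^^ i) x) = 1" if "i \<le> j" for i
      using that
    proof (induction i)
      case (Suc i)
      then show ?case using local_degree_f[of "(h ^^ i) x"] ld[of i] by simp
    qed (simp add: x)
    then show False using Dj by force
  qed
  then obtain i where i: "i < j" "local_degree X \<A> f (Pr ((h ^^ i) x)) \<ge> 2" by blast
  have "(f ^^ (j - i)) (Pr ((h ^^ i) x)) = (f ^^ (j - i + i)) (Pr x)"
    by (simp only: funpow_add o_apply f_funpow_Pr)
  also have "\<dots> = Pr ((h ^^ j) x)" using i by (simp add: f_funpow_Pr)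
  also have "\<dots> = Pr y" using x(2) by (simp add: Pr_def)
  finally have "(f ^^ (j - i)) (Pr ((h ^^ i) x)) = Pr y" .
  moreover have "Pr ((h ^^ i) x) \<in> critical_points X \<A> f" using i by (simp add: critical_points_def)
  ultimately show ?thesis unfolding post_def using i(1) by (metis (mono_tags, lifting) CollectI One_nat_def Suc_leI zero_less_diff)
qed

text \<open>Induction along an orbit that starts with \<open>D x = 1\<close>: at each step
  \<open>D\<close> is multiplied by the local degree of \<open>f\<close>, and \<open>\<nu>\<close>
  acquires at least the same factor in the sense of divisibility.\<close>

lemma branching_dvd_ramification:
  assumes "ramification_admissible X \<A> f \<nu>"
  shows "enat (D y) dvd \<nu> (Pr y)"
proof -
  obtain x j where x: "D x = 1" "torus_proj L ((h ^^ j) x) = torus_proj L y" by (rule unbranched_preimage)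
  have "enat (D ((h ^^ i) x)) dvd \<nu> (Pr ((h ^^ i) x))" for i
  proof (induction i)
    case 0
    have "enat (D x) = 1" by (simp only: x one_enat_def)
    then show ?case by simp
  next
    case (Suc i)
    let ?z = "(h ^^ i) x"
    have "enat (D (h ?z)) = enat (D ?z) * enat (local_degree X \<A> f (Pr ?z))"
      by (simp add: local_degree_f mult.commute)
    also have "\<dots> dvd \<nu> (Pr ?z) * enat (local_degree X \<A> f (Pr ?z))" using Suc by (intro mult_dvd_mono) auto
    also have "\<dots> dvd \<nu> (f (Pr ?z))" using assms unfolding ramification_admissible_def by simp
    finally show ?case by (simp add: f_Pr)
  qed
  from this[of j] show ?thesis using D_cong[OF x(2)] x(2) by (simp add: Pr_def)
qed

lemma post_nonempty_imp_branched:
  assumes "post X \<A> f \<noteq> {}"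
  obtains y where "D y \<ge> 2"
proof -
  obtain c where "c \<in> critical_points X \<A> f" using assms unfolding post_def by blast
  then have "c \<in> range Pr" "local_degree X \<A> f c \<ge> 2" using range_Pr unfolding critical_points_def by auto
  then obtain x where "local_degree X \<A> f (Pr x) \<ge> 2" by blast
  then have "D (h x) \<ge> 2" using local_degree_f[of x] D_pos[of x]
    by (metis mult.commute mult_le_mono mult.right_neutral)
  then show ?thesis by (rule that)
qed

text \<open>An infinite cofactor is excluded because its product with a positive number is
  infinite.\<close>

lemma enat_dvd_two:
  assumes "enat d dvd 2"
  shows "d dvd 2"
proof -
  obtain k where k: "(2::enat) = enat d * k" using assms by (elim dvdE)
  have "d \<noteq> 0"
  proof
    assume "d = 0"
    then have "(2::enat) = 0" using k by (simp add: zero_enat_def[symmetric])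
    then show False by simp
  qed
  show ?thesis
  proof (cases k)
    case (enat n)
    then have "enat 2 = enat (d * n)" using k by (simp add: numeral_eq_enat)
    then show ?thesis by (metis dvd_triv_left enat.inject)
  next
    case infinity
    then show ?thesis using k \<open>d \<noteq> 0\<close> by (simp add: numeral_eq_enat)
  qed
qed

text \<open>The fixed point \<open>x0\<close> of a generator of \<open>G\<close> is a branch point whose degree is at least the order of
  the generator, and this degree divides 2.\<close>

lemma pillow_structure:
  assumes G: "group G" "cyclic_group G" "finite (carrier G)" and ind: "induced_by_rigid_action L G act \<Theta>"
    and type: "has_orbifold_type X \<A> f [2, 2, 2, 2]"
  obtains x0 where "\<And>x y. Pr (x0 + x) = Pr (x0 + y) \<longleftrightarrow> x - y \<in> L \<or> x + y \<in> L"
    "post X \<A> f = (\<lambda>l. Pr (x0 + (1 / 2) *\<^sub>R l)) ` L" "card (post X \<A> f) = 4"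
proof -
  obtain R c m where R: "linear R" "det (matrix R) > 0" and m: "m > 0" and RL': "\<forall>x\<in>L. R x \<in> L"
    and Rm': "\<forall>x. (R ^^ m) x = x" and mc: "real m *\<^sub>R c \<in> L \<or> (\<exists>x. R x \<noteq> x)"
    and iff': "\<forall>x y. \<Theta> (torus_proj L x) = \<Theta> (torus_proj L y) \<longleftrightarrow> (\<exists>j. x - ((\<lambda>y. R y + c) ^^ j) y \<in> L)"
    using torus_group_affine[OF L G ind] .
  note RL = bspec[OF RL'] and Rm = spec[OF Rm']
  have Priff: "Pr x = Pr y \<longleftrightarrow> (\<exists>j. x - ((\<lambda>y. R y + c) ^^ j) y \<in> L)" for x y
    using spec[OF spec[OF iff', of x], of y] by (simp only: Pr_def)
  let ?k = "\<lambda>y. R y + c"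
  obtain \<nu> ps where nu: "is_ramification_function X \<A> f \<nu>" and ps: "distinct ps" "set ps = post X \<A> f" "map \<nu> ps = [2, 2, 2, 2]"
    using type unfolding has_orbifold_type_def by (elim exE conjE) (rule that)
  have adm: "ramification_admissible X \<A> f \<nu>" using nu by (simp add: is_ramification_function_def)
  have card4: "card (post X \<A> f) = 4"
  proof -
    have "length ps = 4" using arg_cong[OF ps(3), of length] by simp
    then show ?thesis using distinct_card[OF ps(1)] ps(2) by simp
  qed
  have nu2: "\<nu> p = 2" if "p \<in> post X \<A> f" for p
  proof -
    have "\<nu> p \<in> set (map \<nu> ps)" using that ps(2) by simp
    then show ?thesis unfolding ps(3) by simp
  qed
  have D2: "D y = 2" if "D y \<ge> 2" for y
  proof -
    have "enat (D y) dvd 2" using branching_dvd_ramification[OF adm, of y] nu2[OF branched_in_post[OF that]] by simp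
    then have "D y dvd 2" by (rule enat_dvd_two)
    then show ?thesis using that by (auto dest: dvd_imp_le)
  qed
  obtain s where s: "s > 0" "\<And>l. l \<in> L \<Longrightarrow> l \<noteq> 0 \<Longrightarrow> s \<le> norm l" by (rule rank2_lattice_discrete[OF L]) blast
  have Rne: "\<exists>x. R x \<noteq> x"
  proof (rule ccontr)
    assume id: "\<not> (\<exists>x. R x \<noteq> x)"
    then have mcL: "real m *\<^sub>R c \<in> L" using mc by blast
    have kj: "(?k ^^ j) y = y + real j *\<^sub>R c" for j y using id by (induction j) (auto simp: algebra_simps)
    have "post X \<A> f \<noteq> {}" using card4 by auto
    then obtain y where y: "D y \<ge> 2" by (rule post_nonempty_imp_branched)
    \<comment> \<open>When the generator is a translation, m times the difference of two points of a
      fibre is a lattice vector; this radius makes it shorter than every nonzero one. Then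
      \<open>Pr\<close> is unbranched, against the existence of postcritical points.\<close>
    define \<tau> where "\<tau> = s / (2 * real m)"
    have t: "\<tau> > 0" using s m by (simp add: \<tau>_def)
    have "inj_on (\<lambda>z. Pr (plane_of_complex z)) (ball (complex_of_plane y) \<tau>)"
    proof (rule inj_onI)
      fix z z' assume z: "z \<in> ball (complex_of_plane y) \<tau>" "z' \<in> ball (complex_of_plane y) \<tau>"
        and eq: "Pr (plane_of_complex z) = Pr (plane_of_complex z')"
      let ?x = "plane_of_complex z" and ?x' = "plane_of_complex z'"
      obtain j where j: "?x - (?x' + real j *\<^sub>R c) \<in> L" using eq unfolding Priff kj by blast
      have "real_of_int (int m) *\<^sub>R (?x - (?x' + real j *\<^sub>R c)) + real_of_int (int j) *\<^sub>R (real m *\<^sub>R c) \<in> L"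
        by (intro rank2_lattice_closed(2)[OF L] rank2_lattice_closed(5)[OF L] j mcL)
      also have "real_of_int (int m) *\<^sub>R (?x - (?x' + real j *\<^sub>R c)) + real_of_int (int j) *\<^sub>R (real m *\<^sub>R c) = real m *\<^sub>R (?x - ?x')"
        by (simp add: algebra_simps)
      finally have mL: "real m *\<^sub>R (?x - ?x') \<in> L" .
      have "dist z z' < 2 * \<tau>" using z dist_triangle[of z z' "complex_of_plane y"] by (simp add: dist_commute)
      then have "norm (?x - ?x') < 2 * \<tau>" by (simp flip: dist_norm)
      then have "norm (real m *\<^sub>R (?x - ?x')) < s" unfolding norm_scaleR using m by (simp add: \<tau>_def field_simps)
      then have "real m *\<^sub>R (?x - ?x') = 0" using s(2)[OF mL] by linarith
      then have "?x = ?x'" using m by simp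
      then show "z = z'" by (metis complex_of_plane_inverse(1))
    qed
    then have "D y = 1" using plane_degree_inj[OF D_plane_degree _ t] by blast
    then show False using y by simp
  qed
  have fixR: "v = 0" if "R v = v" for v
    using finite_order_fixed_vector[OF R m Rm _ that] Rne by blast
  \<comment> \<open>Since 1 is not an eigenvalue of \<open>R\<close>, the equation x0 - R x0 = c for
    a fixed point of the generator can be solved.\<close>
  have "inj (\<lambda>v. v - R v)"
  proof (rule injI)
    fix v w assume "v - R v = w - R w"
    then have "R (v - w) = v - w" by (simp add: linear_diff[OF R(1)] algebra_simps)
    then show "v = w" using fixR by fastforce
  qed
  moreover have lin1: "linear (\<lambda>v. v - R v)" by (intro linear_compose_sub R(1) linear_ident)
  ultimately have "surj (\<lambda>v. v - R v)" by (intro linear_inj_imp_surj)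
  then obtain x0 where "x0 - R x0 = c" by (metis surjD)
  then have k0: "?k (x0 + v) = x0 + R v" for v by (auto simp: linear_add[OF R(1)] algebra_simps)
  have kj: "(?k ^^ j) (x0 + v) = x0 + (R ^^ j) v" for j v
    by (induction j) (use k0 in auto)
  have P0: "Pr (x0 + x) = Pr (x0 + y) \<longleftrightarrow> (\<exists>j. x - (R ^^ j) y \<in> L)" for x y
    unfolding Priff kj by simp
  have contR: "continuous_on UNIV R" by (rule linear_continuous_on) (use R in \<open>simp add: linear_conv_bounded_linear\<close>)
  obtain W where W: "open W" "x0 \<in> W" "\<And>q. q \<in> W \<Longrightarrow> q \<noteq> x0 \<Longrightarrow> card {q' \<in> W. Pr q' = Pr q} = D x0"
    by (rule D_fiber) blast
  \<comment> \<open>A vector so small that \<open>v\<close>, \<open>R v\<close> and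
    \<open>R (R v)\<close> all stay in the neighbourhood of \<open>x0\<close> gives three members of
    one fibre. As the degree at \<open>x0\<close> turns out to be 2, this forces
    \<open>R (R v) = v\<close>.\<close>
  define S where "S = (\<lambda>v. x0 + v) -` W \<inter> (\<lambda>v. x0 + R v) -` W \<inter> (\<lambda>v. x0 + R (R v)) -` W"
  have contRR: "continuous_on UNIV (\<lambda>v. R (R v))" using continuous_on_compose2[OF contR contR] by simp
  have "open S" unfolding S_def
    by (intro open_Int open_vimage[OF W(1)] continuous_intros contR contRR)
  moreover have "0 \<in> S" using W(2) linear_0[OF R(1)] by (simp add: S_def)
  ultimately have "S \<noteq> {0}" using not_open_singleton by metis
  then obtain v where v: "v \<in> S" "v \<noteq> 0" using \<open>0 \<in> S\<close> by blast
  have Rv: "R v \<noteq> v" using fixR v by blast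
  have "R v \<noteq> 0"
  proof
    assume "R v = 0"
    then have "(R ^^ j) v = 0" if "j > 0" for j using that
    proof (induction j)
      case (Suc j) then show ?case using linear_0[OF R(1)] by (cases j) auto
    qed simp
    then show False using Rm[of v] m v by simp
  qed
  then have RRv: "R (R v) \<noteq> R v" using fixR by blast
  let ?F = "{q' \<in> W. Pr q' = Pr (x0 + v)}"
  have cF: "card ?F = D x0" using W(3)[of "x0 + v"] v by (simp add: S_def)
  have finF: "finite ?F" using cF D_pos[of x0] by (intro card_ge_0_finite) simp
  have "Pr (x0 + R v) = Pr (x0 + v)" unfolding P0 by (rule exI[of _ 1]) (simp add: rank2_lattice_closed(1)[OF L])
  moreover have "Pr (x0 + R (R v)) = Pr (x0 + v)" unfolding P0
    by (rule exI[of _ 2]) (simp add: rank2_lattice_closed(1)[OF L] numeral_2_eq_2)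
  ultimately have sub: "{x0 + v, x0 + R v, x0 + R (R v)} \<subseteq> ?F" using v by (simp add: S_def)
  have "card {x0 + v, x0 + R v} \<le> card ?F" using sub finF by (intro card_mono) auto
  then have "D x0 \<ge> 2" using Rv cF by simp
  then have Dx0: "D x0 = 2" by (rule D2)
  have RR: "R (R v) = v"
  proof (rule ccontr)
    assume "R (R v) \<noteq> v"
    then have "card {x0 + v, x0 + R v, x0 + R (R v)} = 3" using Rv RRv by auto
    then show False using card_mono[OF finF sub] cF Dx0 by simp
  qed
  have lin2: "linear (R ^^ 2)" by (rule funpow_linear[OF R(1)])
  \<comment> \<open>The square of \<open>R\<close> has finite order and fixes the nonzero
    \<open>v\<close>, so it is the identity; then \<open>R w + w\<close> is fixed by
    \<open>R\<close>, hence 0.\<close>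
  have RRw: "R (R w) = w" for w
  proof -
    have "(R ^^ 2) w = w"
    proof (rule finite_order_fixed_vector[OF lin2 _ m _ v(2)])
      have "matrix (R ^^ 2) = matrix R ** matrix R"
        using matrix_compose[OF R(1) R(1)] by (simp add: numeral_2_eq_2 o_def)
      then show "det (matrix (R ^^ 2)) > 0" using R(2) by (simp add: det_mul)
      show "((R ^^ 2) ^^ m) y = y" for y
        using Rm by (simp add: funpow_mult mult_2 funpow_add)
      show "(R ^^ 2) v = v" using RR by (simp add: numeral_2_eq_2)
    qed
    then show ?thesis by (simp add: numeral_2_eq_2)
  qed
  have Rneg: "R w = - w" for w
  proof -
    have "R (R w + w) = R w + w" by (simp add: linear_add[OF R(1)] RRw)
    then have "R w + w = 0" by (rule fixR)
    then show ?thesis by (simp add: eq_neg_iff_add_eq_0)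
  qed
  have Rj: "(R ^^ j) w = w \<or> (R ^^ j) w = - w" for j w
    by (induction j) (auto simp: Rneg)
  have fin: "Pr (x0 + x) = Pr (x0 + y) \<longleftrightarrow> x - y \<in> L \<or> x + y \<in> L" for x y
  proof
    assume "Pr (x0 + x) = Pr (x0 + y)"
    then obtain j where "x - (R ^^ j) y \<in> L" unfolding P0 by blast
    then show "x - y \<in> L \<or> x + y \<in> L" using Rj[of j y] by auto
  next
    assume "x - y \<in> L \<or> x + y \<in> L"
    then have "x - (R ^^ 0) y \<in> L \<or> x - (R ^^ 1) y \<in> L" using Rneg[of y] by simp
    then show "Pr (x0 + x) = Pr (x0 + y)" unfolding P0 by blast
  qed
  \<comment> \<open>The half-turn about \<open>x0 + (1 / 2) *\<^sub>R l\<close> preserves the fibres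
    of \<open>Pr\<close>, so nearby fibres have at least two members there and the centre is a
    branch point.\<close>
  have half: "Pr (x0 + (1 / 2) *\<^sub>R l) \<in> post X \<A> f" if l: "l \<in> L" for l
  proof (rule branched_in_post)
    let ?x = "x0 + (1 / 2) *\<^sub>R l"
    obtain W where W: "open W" "?x \<in> W" "\<And>q. q \<in> W \<Longrightarrow> q \<noteq> ?x \<Longrightarrow> card {q' \<in> W. Pr q' = Pr q} = D ?x"
      by (rule D_fiber) blast
    define S where "S = (\<lambda>v. ?x + v) -` W \<inter> (\<lambda>v. ?x - v) -` W"
    have "open S" unfolding S_def by (intro open_Int open_vimage[OF W(1)] continuous_intros)
    moreover have "0 \<in> S" using W(2) by (simp add: S_def)
    ultimately have "S \<noteq> {0}" using not_open_singleton by metis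
    then obtain v where v: "v \<in> S" "v \<noteq> 0" using \<open>0 \<in> S\<close> by blast
    let ?F = "{q' \<in> W. Pr q' = Pr (?x + v)}"
    have cF: "card ?F = D ?x" using W(3)[of "?x + v"] v by (simp add: S_def)
    have finF: "finite ?F" using cF D_pos[of ?x] by (intro card_ge_0_finite) simp
    have "(1 / 2) *\<^sub>R l - v + ((1 / 2) *\<^sub>R l + v) = l"
      by (simp add: scaleR_add_left[symmetric])
    then have "Pr (x0 + ((1 / 2) *\<^sub>R l - v)) = Pr (x0 + ((1 / 2) *\<^sub>R l + v))" unfolding fin using l by simp
    then have "{?x + v, ?x - v} \<subseteq> ?F" using v by (simp add: S_def algebra_simps)
    then have "card {?x + v, ?x - v} \<le> card ?F" using finF by (intro card_mono) auto
    moreover have "?x + v \<noteq> ?x - v" using v(2) by (simp add: eq_neg_iff_add_eq_0 flip: scaleR_2)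
    ultimately show "D ?x \<ge> 2" using cF by simp
  qed
  obtain u w where uw: "cross2 u w \<noteq> 0" and Leq: "L = {of_int m *\<^sub>R u + of_int n *\<^sub>R w | m n. True}"
    by (rule rank2_latticeE[OF L])
  have inL: "of_int i *\<^sub>R u + of_int j *\<^sub>R w \<in> L" for i j unfolding Leq by blast
  have parity: "even i \<and> even j" if ijL: "(of_int i / 2) *\<^sub>R u + (of_int j / 2) *\<^sub>R w \<in> L" for i j :: int
  proof -
    obtain a b where ab: "(of_int i / 2) *\<^sub>R u + (of_int j / 2) *\<^sub>R w = of_int a *\<^sub>R u + of_int b *\<^sub>R w"
      using ijL unfolding Leq by blast
    have "of_int i / 2 * cross2 u w = of_int a * cross2 u w" "of_int j / 2 * cross2 u w = of_int b * cross2 u w"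
      using arg_cong[OF ab, of "\<lambda>x. cross2 x w"] arg_cong[OF ab, of "cross2 u"] by (simp_all add: cross2_linear)
    then have "real_of_int i = real_of_int (2 * a)" "real_of_int j = real_of_int (2 * b)" using uw by simp_all
    then have "i = 2 * a" "j = 2 * b" by (simp_all only: of_int_eq_iff)
    then show ?thesis by simp
  qed
  \<comment> \<open>Coordinates of representatives of the four cosets of \<open>L\<close> in the
    half-lattice. Their images are distinct, and there are only four postcritical points, so all of
    these are accounted for.\<close>
  define H :: "(int \<times> int) set" where "H = {0, 1} \<times> {0, 1}"
  define q where "q = (\<lambda>(i, j). Pr (x0 + (1 / 2) *\<^sub>R (of_int i *\<^sub>R u + of_int j *\<^sub>R w)))"
  have "inj_on q H"
  proof (rule inj_onI)
    fix a b assume ab: "a \<in> H" "b \<in> H" "q a = q b"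
    obtain i j i' j' where a: "a = (i, j)" and b: "b = (i', j')" by (metis surj_pair)
    have "(of_int (i - i') / 2) *\<^sub>R u + (of_int (j - j') / 2) *\<^sub>R w \<in> L \<or> (of_int (i + i') / 2) *\<^sub>R u + (of_int (j + j') / 2) *\<^sub>R w \<in> L"
      using ab(3) unfolding q_def a b by (simp add: fin algebra_simps add_divide_distrib diff_divide_distrib)
    then have "even (i - i') \<and> even (j - j') \<or> even (i + i') \<and> even (j + j')" using parity by blast
    then show "a = b" using ab(1,2) unfolding a b H_def by auto
  qed
  then have cq: "card (q ` H) = 4" by (simp add: card_image H_def)
  have "q a \<in> post X \<A> f" for a by (cases a) (simp only: q_def prod.case half[OF inL])
  then have "q ` H \<subseteq> post X \<A> f" by blast
  moreover have "finite (post X \<A> f)" using card4 by (intro card_ge_0_finite) simp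
  ultimately have "q ` H = post X \<A> f" using cq card4 by (intro card_subset_eq) auto
  moreover have "q a \<in> (\<lambda>l. Pr (x0 + (1 / 2) *\<^sub>R l)) ` L" for a
  proof (cases a)
    case (Pair i j)
    show ?thesis unfolding Pair q_def prod.case by (rule imageI[OF inL])
  qed
  moreover have "(\<lambda>l. Pr (x0 + (1 / 2) *\<^sub>R l)) ` L \<subseteq> post X \<A> f" using half by blast
  ultimately have eq: "post X \<A> f = (\<lambda>l. Pr (x0 + (1 / 2) *\<^sub>R l)) ` L"
    by (metis (no_types, lifting) image_subsetI subset_antisym)
  show ?thesis by (rule that[OF fin eq card4])
qed

end

subsection \<open>Periodic barriers in the plane\<close>

text \<open>Clamping to a box makes Fashoda's theorem applicable: at a meeting point of the clamped paths no
  coordinate has been clamped.\<close>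

lemma periodic_barrier_aux:
  fixes p :: "real \<Rightarrow> real^2"
  assumes \<tau>: "cross2 \<tau>1 \<tau>2 \<noteq> 0" and p: "path p"
    and \<sigma>: "path_component S y (y + \<tau>2)" and Sb: "\<And>x. x \<in> S \<Longrightarrow> norm (x - y) \<le> M"
    and E: "M * norm \<tau>2 \<le> E * \<bar>cross2 \<tau>1 \<tau>2\<bar>"
    and disj: "\<And>x i j. x \<in> S \<Longrightarrow> x + of_int i *\<^sub>R \<tau>1 + of_int j *\<^sub>R \<tau>2 \<notin> path_image p"
  shows "cross2 (pathfinish p) \<tau>2 / cross2 \<tau>1 \<tau>2 - cross2 (pathstart p) \<tau>2 / cross2 \<tau>1 \<tau>2 \<le> 2 * E + 2"
proof (rule ccontr)
  \<comment> \<open>Coordinates with respect to \<open>\<tau>1\<close> and \<open>\<tau>2\<close>.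
    The path \<open>p\<close> is to be blocked in the direction of \<open>s1\<close> by translates
    of \<open>S\<close> stacked in the direction of \<open>s2\<close>.\<close>
  define s1 s2 where "s1 = (\<lambda>x. cross2 x \<tau>2 / cross2 \<tau>1 \<tau>2)" and "s2 = (\<lambda>x. cross2 \<tau>1 x / cross2 \<tau>1 \<tau>2)"
  have lin: "s1 (x + z) = s1 x + s1 z" "s2 (x + z) = s2 x + s2 z" "s1 (c *\<^sub>R x) = c * s1 x" "s2 (c *\<^sub>R x) = c * s2 x"
    "s1 (x - z) = s1 x - s1 z" "s2 (x - z) = s2 x - s2 z" for x z c
    by (auto simp: s1_def s2_def cross2_linear add_divide_distrib diff_divide_distrib)
  have base: "s1 \<tau>1 = 1" "s1 \<tau>2 = 0" "s2 \<tau>1 = 0" "s2 \<tau>2 = 1" using \<tau> by (auto simp: s1_def s2_def cross2_linear)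
  have s_inj: "x = z" if "s1 x = s1 z" "s2 x = s2 z" for x z
  proof -
    have "cross2 \<tau>1 \<tau>2 *\<^sub>R x = cross2 \<tau>1 \<tau>2 *\<^sub>R z"
      using that \<tau> unfolding cross2_expand[of \<tau>1 \<tau>2] by (simp add: s1_def s2_def)
    then show ?thesis using \<tau> by simp
  qed
  have conts: "continuous_on T s1" "continuous_on T s2" for T
    unfolding s1_def s2_def cross2_def by (intro continuous_intros; use \<tau> in \<open>simp add: cross2_def\<close>)+
  define a b where "a = s1 (pathstart p)" and "b = s1 (pathfinish p)"
  assume "\<not> cross2 (pathfinish p) \<tau>2 / cross2 \<tau>1 \<tau>2 - cross2 (pathstart p) \<tau>2 / cross2 \<tau>1 \<tau>2 \<le> 2 * E + 2"
  then have ab: "b - a > 2 * E + 2" by (simp add: a_def b_def s1_def)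
  \<comment> \<open>A whole number of translations by \<open>\<tau>1\<close> puts the barrier, which
    extends at most \<open>E\<close> to either side in \<open>s1\<close>, strictly between the end
    values \<open>a\<close> and \<open>b\<close>. Rounding costs up to one unit; the bound
    \<open>2 * E + 2\<close> leaves room for it.\<close>
  define i where "i = \<lfloor>a + E - s1 y\<rfloor> + 1"
  have i: "a + E < s1 y + i" "s1 y + i \<le> a + E + 1" unfolding i_def by linarith+
  have i2: "s1 y + i < b - E" using i ab by linarith
  have Sb1: "\<bar>s1 x - s1 y\<bar> \<le> E" if "x \<in> S" for x
  proof -
    have "\<bar>cross2 (x - y) \<tau>2\<bar> \<le> norm (x - y) * norm \<tau>2" by (rule abs_cross2_le)
    also have "\<dots> \<le> M * norm \<tau>2" using Sb[OF that] by (intro mult_right_mono) auto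
    also have "\<dots> \<le> E * \<bar>cross2 \<tau>1 \<tau>2\<bar>" by (rule E)
    finally have "\<bar>cross2 (x - y) \<tau>2\<bar> / \<bar>cross2 \<tau>1 \<tau>2\<bar> \<le> E" using \<tau> by (simp add: field_simps)
    then have "\<bar>s1 (x - y)\<bar> \<le> E" by (simp add: s1_def abs_divide)
    then show ?thesis by (simp add: lin)
  qed
  have "y \<in> S" using \<sigma> path_component_mem(1) by blast
  then have E0: "E \<ge> 0" using Sb1[of y] by simp
  have "compact (s2 ` path_image p)"
    using p by (intro compact_continuous_image conts compact_path_image)
  then obtain Y where Y: "\<And>x. x \<in> path_image p \<Longrightarrow> \<bar>s2 x\<bar> \<le> Y"
    using compact_imp_bounded bounded_iff by (metis image_eqI real_norm_def)
  have "pathstart p \<in> path_image p" by (rule pathstart_in_path_image)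
  then have Y0: "Y \<ge> 0" using Y by force
  \<comment> \<open>Enough translations by \<open>\<tau>2\<close> to pass beyond the path in both
    directions, with a margin of 1.\<close>
  define N where "N = nat \<lceil>Y + 1 + \<bar>s2 y\<bar>\<rceil>"
  have N: "real N \<ge> Y + 1 + \<bar>s2 y\<bar>" unfolding N_def by (rule real_nat_ceiling_ge)
  define T where "T = (\<Union>j::int. (\<lambda>x. x + (of_int i *\<^sub>R \<tau>1 + of_int j *\<^sub>R \<tau>2)) ` S)"
  define y0 where "y0 = y + of_int i *\<^sub>R \<tau>1"
  have step: "path_component T (y0 + of_int j *\<^sub>R \<tau>2) (y0 + of_int (j + 1) *\<^sub>R \<tau>2)" for j
  proof -
    let ?t = "\<lambda>x. x + (of_int i *\<^sub>R \<tau>1 + of_int j *\<^sub>R \<tau>2)"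
    obtain g where g: "path g" "path_image g \<subseteq> S" "pathstart g = y" "pathfinish g = y + \<tau>2"
      using \<sigma> unfolding path_component_def by blast
    have "path (?t \<circ> g)" using g(1) by (intro path_continuous_image continuous_intros)
    moreover have "path_image (?t \<circ> g) \<subseteq> T" using g(2) unfolding path_image_compose T_def by blast
    moreover have "pathstart (?t \<circ> g) = y0 + of_int j *\<^sub>R \<tau>2" "pathfinish (?t \<circ> g) = y0 + of_int (j + 1) *\<^sub>R \<tau>2"
      using g(3,4) by (auto simp: pathstart_compose pathfinish_compose y0_def algebra_simps)
    ultimately show ?thesis unfolding path_component_def by blast
  qed
  have up: "path_component T (y0 + of_int k *\<^sub>R \<tau>2) (y0 + of_int (k + int n) *\<^sub>R \<tau>2)" for k n
  proof (induction n)
    case 0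
    have "y0 + of_int k *\<^sub>R \<tau>2 \<in> T" using step path_component_mem(1) by blast
    then show ?case by (simp add: path_component_refl)
  next
    case (Suc n)
    show ?case using path_component_trans[OF Suc step[of "k + int n"]] by (simp add: add_ac)
  qed
  obtain v where v: "path v" "path_image v \<subseteq> T" "pathstart v = y0 + of_int (- int N) *\<^sub>R \<tau>2"
    "pathfinish v = y0 + of_int (int N) *\<^sub>R \<tau>2"
    using up[of "- int N" "2 * N"] unfolding path_component_def by auto
  have vT: "a < s1 x" "s1 x < b" if "x \<in> path_image v" for x
  proof -
    obtain j x' where x': "x' \<in> S" "x = x' + (of_int i *\<^sub>R \<tau>1 + of_int j *\<^sub>R \<tau>2)"
      using \<open>x \<in> path_image v\<close> v(2) unfolding T_def by blast
    have "s1 x = s1 x' + i" using x'(2) by (simp add: lin base)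
    then show "a < s1 x" "s1 x < b" using Sb1[OF x'(1)] i i2 by linarith+
  qed
  have y0s: "s2 y0 = s2 y" by (simp add: y0_def lin base)
  define Y' where "Y' = Y + 1"
  define cl where "cl = (\<lambda>l u t::real. max l (min u t))"
  define \<phi> where "\<phi> = (\<lambda>x. (\<chi> k. if k = 1 then cl a b (s1 x) else cl (- Y') Y' (s2 x)) :: real^2)"
  have phi: "\<phi> x $ 1 = cl a b (s1 x)" "\<phi> x $ 2 = cl (- Y') Y' (s2 x)" for x by (simp_all add: \<phi>_def)
  have cphi: "continuous_on U \<phi>" for U
  proof -
    have "continuous_on U (\<lambda>x. if k = 1 then cl a b (s1 x) else cl (- Y') Y' (s2 x))" for k :: 2
      by (cases "k = 1") (auto simp: cl_def intro!: continuous_intros conts)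
    then show ?thesis unfolding \<phi>_def by (intro continuous_on_vec_lambda) 
  qed
  define lo hi :: "real^2" where "lo = vector [a, - Y']" and "hi = vector [b, Y']"
  have lohi: "lo $ 1 = a" "lo $ 2 = - Y'" "hi $ 1 = b" "hi $ 2 = Y'" by (simp_all add: lo_def hi_def)
  have abl: "a \<le> b" using ab E0 by linarith
  have box: "\<phi> x \<in> cbox (lo) (hi)" for x
    using abl Y0 by (auto simp: mem_box_cart forall_2 phi cl_def Y'_def lohi)
  obtain z where "z \<in> path_image (\<phi> \<circ> p)" "z \<in> path_image (\<phi> \<circ> v)"
  proof (rule fashoda[of "\<phi> \<circ> p" "\<phi> \<circ> v" "lo" "hi"])
    show "path (\<phi> \<circ> p)" "path (\<phi> \<circ> v)" using p v(1) by (auto intro!: path_continuous_image cphi)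
    show "path_image (\<phi> \<circ> p) \<subseteq> cbox (lo) (hi)"
      "path_image (\<phi> \<circ> v) \<subseteq> cbox (lo) (hi)"
      using box by (auto simp: path_image_compose)
    show "pathstart (\<phi> \<circ> p) $ 1 = lo $ 1" "pathfinish (\<phi> \<circ> p) $ 1 = hi $ 1"
      using abl by (auto simp: pathstart_compose pathfinish_compose phi cl_def lohi simp flip: a_def b_def)
    have "s2 (pathstart v) \<le> - Y'" "s2 (pathfinish v) \<ge> Y'"
      using N unfolding v(3,4) by (auto simp: lin base y0s Y'_def)
    then show "pathstart (\<phi> \<circ> v) $ 2 = lo $ 2" "pathfinish (\<phi> \<circ> v) $ 2 = hi $ 2"
      using Y0 by (auto simp: pathstart_compose pathfinish_compose phi cl_def Y'_def lohi)
  qed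
  then obtain x x' where x: "x \<in> path_image p" "x' \<in> path_image v" and eq: "\<phi> x = \<phi> x'"
    unfolding path_image_compose by (metis imageE)
  have "cl a b (s1 x) = cl a b (s1 x')" "cl (- Y') Y' (s2 x) = cl (- Y') Y' (s2 x')"
    using eq phi by metis+
  \<comment> \<open>On the barrier \<open>s1\<close> lies strictly between \<open>a\<close> and
    \<open>b\<close>, and on the path \<open>s2\<close> lies strictly between \<open>- Y'\<close>
    and \<open>Y'\<close>, so equal clamped values mean equal coordinates.\<close>
  then have "s1 x = s1 x'" "s2 x = s2 x'"
    using vT[OF x(2)] Y[OF x(1)] unfolding cl_def Y'_def by (auto simp: max_def min_def split: if_splits)
  then have "x = x'" by (rule s_inj)
  moreover obtain j x'' where x'': "x'' \<in> S" "x' = x'' + (of_int i *\<^sub>R \<tau>1 + of_int j *\<^sub>R \<tau>2)"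
    using x(2) v(2) unfolding T_def by blast
  ultimately show False using disj[OF x''(1), of i j] x(1) by (simp add: add.assoc)
qed

text \<open>The reversed path is blocked by the same barrier, which makes the bound
  two-sided.\<close>

lemma periodic_barrier:
  fixes p :: "real \<Rightarrow> real^2"
  assumes \<tau>: "cross2 \<tau>1 \<tau>2 \<noteq> 0" and p: "path p"
    and \<sigma>: "path_component S y (y + \<tau>2)" and Sb: "\<And>x. x \<in> S \<Longrightarrow> norm (x - y) \<le> M"
    and E: "M * norm \<tau>2 \<le> E * \<bar>cross2 \<tau>1 \<tau>2\<bar>"
    and disj: "\<And>x i j. x \<in> S \<Longrightarrow> x + of_int i *\<^sub>R \<tau>1 + of_int j *\<^sub>R \<tau>2 \<notin> path_image p"
  shows "\<bar>cross2 (pathfinish p - pathstart p) \<tau>2 / cross2 \<tau>1 \<tau>2\<bar> \<le> 2 * E + 2"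
proof -
  note 1 = periodic_barrier_aux[OF \<tau> p \<sigma> Sb E disj]
  have "\<And>x i j. x \<in> S \<Longrightarrow> x + of_int i *\<^sub>R \<tau>1 + of_int j *\<^sub>R \<tau>2 \<notin> path_image (reversepath p)"
    using disj by simp
  note 2 = periodic_barrier_aux[OF \<tau> _ \<sigma> Sb E this]
  show ?thesis using 1 2 p by (auto simp: abs_if cross2_linear diff_divide_distrib)
qed

subsection \<open>Pillows\<close>

text \<open>\<open>P\<close> presents \<open>X\<close> as the quotient of the plane by the group
  generated by the translations in \<open>L\<close> and x \<mapsto> -x, which acts by
  isometries.\<close>

locale pillow =
  fixes X :: "'a topology" and L :: "(real^2) set" and P :: "real^2 \<Rightarrow> 'a"
  assumes hausX: "Hausdorff_space X" and L: "rank2_lattice L"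
    and contP: "continuous_map euclidean X P" and openP: "open_map euclidean X P" and rangeP: "range P = topspace X"
    and P_eq_iff: "P x = P y \<longleftrightarrow> x - y \<in> L \<or> x + y \<in> L"
begin

lemma P_in [simp]: "P x \<in> topspace X"
  using rangeP by blast

lemma open_image_P: "open S \<Longrightarrow> openin X (P ` S)"
  using openP unfolding open_map_def by simp

lemma open_vimage_P: "openin X S \<Longrightarrow> open (P -` S)"
  using openin_continuous_map_preimage[OF contP] by (simp add: vimage_def)

lemma closed_vimage_P: "closedin X S \<Longrightarrow> closed (P -` S)"
  using closedin_continuous_map_preimage[OF contP] by (simp add: vimage_def)

lemma connected_image_P: "connected S \<Longrightarrow> connectedin X (P ` S)"
  using connectedin_continuous_map_image[OF contP] by simp

lemma compact_image_P: "compact S \<Longrightarrow> compactin X (P ` S)"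
  using image_compactin[OF _ contP] by simp

section \<open>Deck transformations and components of preimages\<close>

lemma P_add: "l \<in> L \<Longrightarrow> P (x + l) = P x" and P_reflect: "l \<in> L \<Longrightarrow> P (l - x) = P x"
  using P_eq_iff by auto

lemma P_eqE:
  assumes "P x = P x'"
  obtains l e where "l \<in> L" "e = 1 \<or> e = -1" "x' = l + e *\<^sub>R x"
proof -
  have "x - x' \<in> L \<or> x + x' \<in> L" using assms P_eq_iff by blast
  then show ?thesis
  proof
    assume "x - x' \<in> L"
    then have "- (x - x') \<in> L" by (rule rank2_lattice_closed(4)[OF L])
    then show ?thesis by (rule that[of _ 1]) auto
  next
    assume "x + x' \<in> L"
    then show ?thesis by (rule that[of _ "-1"]) auto
  qed
qed

lemma P_deck: "l \<in> L \<Longrightarrow> e = 1 \<or> e = -1 \<Longrightarrow> P (l + e *\<^sub>R x) = P x"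
  using P_add[of l x] P_reflect[of l x] by (auto simp: add.commute)

text \<open>The deck transformation taking \<open>x\<close> to \<open>x'\<close> maps the component
  of \<open>x\<close> into that of \<open>x'\<close>.\<close>

lemma component_image_subset:
  assumes U: "U \<in> components (P -` S)" "U' \<in> components (P -` S)" and x: "x \<in> U" "x' \<in> U'" "P x = P x'"
  shows "P ` U \<subseteq> P ` U'"
proof -
  obtain l e where le: "l \<in> L" "e = 1 \<or> e = -1" "x' = l + e *\<^sub>R x" by (rule P_eqE[OF x(3)])
  let ?g = "\<lambda>x. l + e *\<^sub>R x"
  have "connected (?g ` U)"
    using in_components_connected[OF U(1)] by (intro connected_continuous_image continuous_intros)
  moreover have "?g ` U \<subseteq> P -` S" using in_components_subset[OF U(1)] P_deck[OF le(1,2)] by auto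
  moreover have "U' \<inter> ?g ` U \<noteq> {}" using x le(3) by blast
  ultimately have sub: "?g ` U \<subseteq> U'" using components_maximal[OF U(2)] by blast
  have "P ` U = P ` ?g ` U" using P_deck[OF le(1,2)] by (simp add: image_image)
  then show ?thesis using sub by blast
qed

lemma component_open:
  assumes "openin X S" "U \<in> components (P -` S)"
  shows "open U"
  using open_components[OF open_vimage_P[OF assms(1)] assms(2)] .

text \<open>The images of components are open and pairwise equal or disjoint, so they partition
  \<open>S\<close> into open sets and a connected set stays in one of them. This takes the place of
  exact path lifting, which is delicate at branch points.\<close>

lemma connected_subset_component_image:
  assumes S: "openin X S" and U: "U \<in> components (P -` S)" and D: "connectedin X D" "D \<subseteq> S" "D \<inter> P ` U \<noteq> {}"
  shows "D \<subseteq> P ` U"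
proof (rule ccontr)
  assume nsub: "\<not> D \<subseteq> P ` U"
  define E where "E = (\<Union>U' \<in> {U' \<in> components (P -` S). P ` U' \<inter> P ` U = {}}. P ` U')"
  have "openin X (P ` U)" by (rule open_image_P[OF component_open[OF S U]])
  moreover have "openin X E" unfolding E_def
    by (rule openin_Union) (use open_image_P component_open[OF S] in auto)
  moreover have "P ` U \<inter> E \<inter> D = {}" unfolding E_def by blast
  moreover have cov: "D \<subseteq> P ` U \<union> E"
  proof
    fix q assume q: "q \<in> D"
    then obtain x where x: "q = P x" using D(1) rangeP connectedin_subset_topspace by (metis imageE subsetD)
    then have "x \<in> P -` S" using q D(2) by auto
    then obtain U' where U': "U' \<in> components (P -` S)" "x \<in> U'" by (metis UnionE Union_components)
    show "q \<in> P ` U \<union> E"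
    proof (cases "P ` U' \<inter> P ` U = {}")
      case True
      then show ?thesis using U' x unfolding E_def by blast
    next
      case False
      then obtain a a' where "a \<in> U'" "a' \<in> U" "P a = P a'" by fastforce
      then have "P ` U' \<subseteq> P ` U" by (rule component_image_subset[OF U'(1) U])
      then show ?thesis using U' x by blast
    qed
  qed
  moreover have "E \<inter> D \<noteq> {}" using nsub cov by blast
  ultimately show False using D(1,3) unfolding connectedin by (metis Int_commute)
qed

text \<open>The fibre through \<open>x\<close> is uniformly separated, so the discs of radius \<eta>
  around its points are disjoint, and together they are the preimage of the image of one of them. A
  component lies in a single disc, and \<eta> is at most 1.\<close>

lemma small_components:
  obtains N where "openin X N" "P x \<in> N"
    "\<And>S U y z. openin X S \<Longrightarrow> S \<subseteq> N \<Longrightarrow> U \<in> components (P -` S) \<Longrightarrow> y \<in> U \<Longrightarrow> z \<in> U \<Longrightarrow> dist y z \<le> 2"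
proof -
  obtain s where s: "s > 0" "\<And>l. l \<in> L \<Longrightarrow> l \<noteq> 0 \<Longrightarrow> s \<le> norm l" by (rule rank2_lattice_discrete[OF L]) blast
  \<comment> \<open>Points of the fibre differ by a lattice vector or, up to sign, by some 2x + l.
    Two different such vectors shorter than s / 2 would differ by too short a lattice vector, so a
    short nonzero one is the only one and hence minimal.\<close>
  obtain s' where s': "s' > 0" "\<And>l. l \<in> L \<Longrightarrow> 2 *\<^sub>R x + l \<noteq> 0 \<Longrightarrow> s' \<le> norm (2 *\<^sub>R x + l)"
  proof (cases "\<exists>l\<in>L. 2 *\<^sub>R x + l \<noteq> 0 \<and> norm (2 *\<^sub>R x + l) < s / 2")
    case True
    then obtain l0 where l0: "l0 \<in> L" "2 *\<^sub>R x + l0 \<noteq> 0" "norm (2 *\<^sub>R x + l0) < s / 2" by blast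
    show ?thesis
    proof (rule that[of "norm (2 *\<^sub>R x + l0)"])
      fix l assume l: "l \<in> L" "2 *\<^sub>R x + l \<noteq> 0"
      show "norm (2 *\<^sub>R x + l0) \<le> norm (2 *\<^sub>R x + l)"
      proof (rule ccontr)
        assume nle: "\<not> norm (2 *\<^sub>R x + l0) \<le> norm (2 *\<^sub>R x + l)"
        then have "norm (l - l0) < s"
          using l0(3) norm_triangle_ineq4[of "2 *\<^sub>R x + l" "2 *\<^sub>R x + l0"] by simp
        then have "l = l0" using s(2)[OF rank2_lattice_closed(3)[OF L l(1) l0(1)]] by fastforce
        then show False using nle by simp
      qed
    qed (use l0 in simp)
  next
    case False
    then show ?thesis using that[of "s / 2"] s(1) by force
  qed
  define F where "F = {z. P z = P x}"
  define \<eta> where "\<eta> = min 1 (min s s' / 2)"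
  have eta: "\<eta> > 0" "\<eta> \<le> 1" "2 * \<eta> \<le> s" "2 * \<eta> \<le> s'" using s(1) s'(1) by (auto simp: \<eta>_def)
  have sep: "ball z \<eta> \<inter> ball z' \<eta> = {}" if z: "z \<in> F" "z' \<in> F" "z \<noteq> z'" for z z'
  proof -
    have "2 * \<eta> \<le> norm (z - z')"
    proof -
      have z1: "z - x \<in> L \<or> z + x \<in> L" "z' - x \<in> L \<or> z' + x \<in> L" using z P_eq_iff by (auto simp: F_def)
      consider "z - z' \<in> L" | "z - z' - 2 *\<^sub>R x \<in> L" | "z' - z - 2 *\<^sub>R x \<in> L"
        using z1 rank2_lattice_closed(3)[OF L, of "z - x" "z' - x"] rank2_lattice_closed(3)[OF L, of "z - x" "z' + x"]
          rank2_lattice_closed(3)[OF L, of "z' - x" "z + x"] rank2_lattice_closed(3)[OF L, of "z + x" "z' + x"]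
        by (auto simp: algebra_simps scaleR_2)
      then show ?thesis
      proof cases
        case 1 then show ?thesis using s(2)[of "z - z'"] z(3) eta by auto
      next
        case 2 then show ?thesis using s'(2)[of "z - z' - 2 *\<^sub>R x"] z(3) eta by auto
      next
        case 3 then show ?thesis using s'(2)[of "z' - z - 2 *\<^sub>R x"] z(3) eta by (auto simp: norm_minus_commute)
      qed
    qed
    then have "dist z z' \<ge> 2 * \<eta>" by (simp add: dist_norm)
    then show ?thesis by (intro disjoint_ballI) simp
  qed
  show ?thesis
  proof (rule that[of "P ` ball x \<eta>"])
    show "openin X (P ` ball x \<eta>)" by (intro open_image_P) simp
    show "P x \<in> P ` ball x \<eta>" using eta by simp
    fix S U y z assume S: "openin X S" "S \<subseteq> P ` ball x \<eta>" and U: "U \<in> components (P -` S)" and yz: "y \<in> U" "z \<in> U"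
    have cover: "\<exists>c\<in>F. a \<in> ball c \<eta>" if "a \<in> U" for a
    proof -
      have "P a \<in> P ` ball x \<eta>" using in_components_subset[OF U] S(2) that by auto
      then obtain w where w: "w \<in> ball x \<eta>" "P w = P a" by auto
      obtain l e where le: "l \<in> L" "e = 1 \<or> e = -1" "a = l + e *\<^sub>R w" by (rule P_eqE[OF w(2)])
      have "l + e *\<^sub>R x \<in> F" using P_deck[OF le(1,2)] by (simp add: F_def)
      moreover have "a \<in> ball (l + e *\<^sub>R x) \<eta>" using w(1) le(2,3) by (auto simp: dist_norm norm_minus_commute)
      ultimately show ?thesis by blast
    qed
    obtain c where c: "c \<in> F" "y \<in> ball c \<eta>" using cover[OF yz(1)] by blast
    have "U \<subseteq> ball c \<eta>"
    proof (rule ccontr)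
      assume ns: "\<not> U \<subseteq> ball c \<eta>"
      define T where "T = (\<Union>c'\<in>F - {c}. ball c' \<eta>)"
      have "open T" "open (ball c \<eta>)" by (auto simp: T_def)
      moreover have "U \<subseteq> ball c \<eta> \<union> T" unfolding T_def using cover by blast
      moreover have "ball c \<eta> \<inter> T \<inter> U = {}" unfolding T_def using sep[OF c(1)] by blast
      moreover have "ball c \<eta> \<inter> U \<noteq> {}" using c(2) yz(1) by blast
      moreover have "T \<inter> U \<noteq> {}" using ns \<open>U \<subseteq> ball c \<eta> \<union> T\<close> by blast
      ultimately show False using in_components_connected[OF U] unfolding connected_def by blast
    qed
    then have "dist c y < \<eta>" "dist c z < \<eta>" using yz by auto
    then show "dist y z \<le> 2" using dist_triangle3[of y z c] eta by linarith
  qed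
qed

text \<open>Paths are lifted only approximately, into the preimage of an arbitrarily small neighbourhood \<open>N\<close>
  of the path. The number of small pieces, and hence the bound on the lift, does not depend on \<open>N\<close>.\<close>

lemma approximate_path_lifting:
  assumes g: "pathin X g"
  obtains M where "M > 0" "\<And>N y t. openin X N \<Longrightarrow> g ` {0..1} \<subseteq> N \<Longrightarrow> P y = g 0 \<Longrightarrow> t \<in> {0..1} \<Longrightarrow>
      \<exists>z. P z = g t \<and> path_component (P -` N \<inter> cball y M) y z"
proof -
  have contg: "continuous_map (top_of_set {0..1}) X g" using g by (simp add: pathin_def)
  \<comment> \<open>Neighbourhoods over which lifts move by at most 2, uniformly in the open subset
    \<open>S\<close>; this uniformity frees the final bound from \<open>N\<close>.\<close>
  define small where "small = (\<lambda>B. \<forall>S U y z. openin X S \<longrightarrow> S \<subseteq> B \<longrightarrow> U \<in> components (P -` S) \<longrightarrow> y \<in> U \<longrightarrow> z \<in> U \<longrightarrow> dist y z \<le> 2)"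
  define C where "C = {T. open T \<and> (\<exists>B. openin X B \<and> small B \<and> g ` ({0..1} \<inter> T) \<subseteq> B)}"
  have cov: "{0..1} \<subseteq> \<Union>C"
  proof
    fix t :: real assume t: "t \<in> {0..1}"
    then have "g t \<in> topspace X" using continuous_map_image_subset_topspace[OF contg] by auto
    then obtain x where x: "P x = g t" using rangeP by (metis imageE)
    obtain B where B: "openin X B" "P x \<in> B"
      "\<And>S U y z. openin X S \<Longrightarrow> S \<subseteq> B \<Longrightarrow> U \<in> components (P -` S) \<Longrightarrow> y \<in> U \<Longrightarrow> z \<in> U \<Longrightarrow> dist y z \<le> 2"
      by (rule small_components[of x]) blast
    have "openin (top_of_set {0..1}) {t \<in> {0..1}. g t \<in> B}"
      using openin_continuous_map_preimage[OF contg B(1)] by simp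
    then obtain T where T: "open T" "{t \<in> {0..1}. g t \<in> B} = {0..1} \<inter> T" unfolding openin_open by blast
    have "small B" unfolding small_def using B(3) by blast
    moreover have "g ` ({0..1} \<inter> T) \<subseteq> B" using T(2) by blast
    ultimately have "T \<in> C" using T(1) B(1) unfolding C_def by blast
    moreover have "t \<in> T" using T(2) t x B(2) by auto
    ultimately show "t \<in> \<Union>C" by blast
  qed
  have opC: "\<And>T. T \<in> C \<Longrightarrow> open T" by (simp add: C_def)
  have "\<exists>e>0. \<forall>x\<in>{0..1}. \<exists>T\<in>C. ball x e \<subseteq> T"
    by (rule Heine_Borel_lemma[OF compact_Icc cov opC]) auto
  then obtain e where e: "e > 0" "\<forall>x\<in>{0..1}. \<exists>T\<in>C. ball x e \<subseteq> T" by blast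
  \<comment> \<open>\<open>e\<close> is a Lebesgue number of the cover. It cuts the path into n
    pieces, each of which moves the lift by at most 2, whence the bound
    \<open>2 * real n\<close>.\<close>
  obtain n0 where n0: "1 / real (Suc n0) < e" by (rule nat_approx_posE[OF e(1)])
  define n where "n = Suc n0"
  have n: "n > 0" "1 / real n < e" using n0 by (simp_all only: n_def zero_less_Suc)
  have claim: "\<exists>z. P z = g t \<and> path_component (P -` N \<inter> cball y (2 * real j)) y z"
    if N: "openin X N" "g ` {0..1} \<subseteq> N" and y: "P y = g 0" and t: "0 \<le> t" "t \<le> real j / real n" "j \<le> n" for N y t j
    using t
  proof (induction j arbitrary: t)
    case 0
    then have t0: "t = 0" by simp
    have "y \<in> P -` N \<inter> cball y (2 * real 0)" using N(2) y by auto
    from path_component_refl[OF this] show ?case unfolding t0 using y by (intro exI[of _ y] conjI)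
  next
    case (Suc j)
    show ?case
    proof (cases "t \<le> real j / real n")
      case True
      then obtain z where z: "P z = g t" "path_component (P -` N \<inter> cball y (2 * real j)) y z"
        using Suc.IH[of t] Suc.prems by auto
      have "P -` N \<inter> cball y (2 * real j) \<subseteq> P -` N \<inter> cball y (2 * real (Suc j))" by auto
      then show ?thesis using z path_component_of_subset by blast
    next
      case False
      define t0 where "t0 = real j / real n"
      have t0: "0 \<le> t0" "t0 < t" "t \<le> t0 + 1 / real n" "t0 \<le> 1" "t \<le> 1"
      proof -
        show "0 \<le> t0" "t0 < t" using False by (auto simp: t0_def)
        show "t \<le> t0 + 1 / real n" using Suc.prems(2) by (simp add: t0_def add_divide_distrib)
        have "real (Suc j) / real n \<le> 1" using Suc.prems(3) n(1) by (simp del: of_nat_Suc)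
        then show "t \<le> 1" using Suc.prems(2) by linarith
        then show "t0 \<le> 1" using \<open>t0 < t\<close> by simp
      qed
      obtain z0 where z0: "P z0 = g t0" "path_component (P -` N \<inter> cball y (2 * real j)) y z0"
        using Suc.IH[of t0] Suc.prems t0 by (auto simp: t0_def)
      obtain T where T: "T \<in> C" "ball t0 e \<subseteq> T" using e(2) t0 by (metis atLeastAtMost_iff)
      obtain B where B: "openin X B" "small B" "g ` ({0..1} \<inter> T) \<subseteq> B" using T(1) unfolding C_def by blast
      have sub: "{t0..t} \<subseteq> {0..1} \<inter> T"
      proof
        fix r assume r: "r \<in> {t0..t}"
        then have "dist t0 r < e" using t0 n(2) by (simp add: dist_real_def)
        then show "r \<in> {0..1} \<inter> T" using T(2) r t0 by auto
      qed
      \<comment> \<open>Intersecting with \<open>N\<close> keeps the lift in the prescribed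
        neighbourhood, intersecting with \<open>B\<close> keeps it short.\<close>
      define S where "S = N \<inter> B"
      have S: "openin X S" unfolding S_def using N(1) B(1) by (rule openin_Int)
      have gS: "g ` {t0..t} \<subseteq> S" using sub N(2) B(3) unfolding S_def by blast
      have "z0 \<in> P -` S" using gS t0 z0(1) by auto
      then obtain U where U: "U \<in> components (P -` S)" "z0 \<in> U" by (metis UnionE Union_components)
      have "connectedin (top_of_set {0..1}) {t0..t}" using t0 by (auto simp: connectedin_subtopology)
      then have "connectedin X (g ` {t0..t})" by (rule connectedin_continuous_map_image[OF contg])
      moreover have "g ` {t0..t} \<inter> P ` U \<noteq> {}"  
      proof -
        have "g t0 \<in> g ` {t0..t}" using t0 by simp
        moreover have "g t0 \<in> P ` U" using U(2) z0(1) by (metis imageI)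
        ultimately show ?thesis by blast
      qed
      ultimately have "g ` {t0..t} \<subseteq> P ` U" using connected_subset_component_image[OF S U(1)] gS by blast
      then have "g t \<in> P ` U" using t0 by auto
      then obtain z where z: "z \<in> U" "P z = g t" by auto
      have "path_connected U"
        using component_open[OF S U(1)] in_components_connected[OF U(1)] connected_open_path_connected by blast
      then have "path_component U z0 z" using U(2) z(1) by (simp add: path_connected_component)
      moreover have "U \<subseteq> P -` N \<inter> cball y (2 * real (Suc j))"
      proof
        fix a assume a: "a \<in> U"
        have "S \<subseteq> B" by (simp add: S_def)
        then have "dist z0 a \<le> 2" using B(2) S U a unfolding small_def by blast
        moreover have "dist y z0 \<le> 2 * real j" using path_component_mem(2)[OF z0(2)] by simp
        ultimately have "dist y a \<le> 2 * real (Suc j)" using dist_triangle[of y a z0] by simp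
        moreover have "P a \<in> N" using in_components_subset[OF U(1)] a by (auto simp: S_def)
        ultimately show "a \<in> P -` N \<inter> cball y (2 * real (Suc j))" by simp
      qed
      ultimately have 1: "path_component (P -` N \<inter> cball y (2 * real (Suc j))) z0 z"
        using path_component_of_subset by blast
      have "P -` N \<inter> cball y (2 * real j) \<subseteq> P -` N \<inter> cball y (2 * real (Suc j))" by auto
      then have "path_component (P -` N \<inter> cball y (2 * real (Suc j))) y z0"
        using z0(2) path_component_of_subset by blast
      then show ?thesis using 1 z(2) path_component_trans by blast
    qed
  qed
  show ?thesis
  proof (rule that[of "2 * real n"])
    show "2 * real n > 0" using n by simp
    fix N y and t :: real assume "openin X N" "g ` {0..1} \<subseteq> N" "P y = g 0" "t \<in> {0..1}"
    then show "\<exists>z. P z = g t \<and> path_component (P -` N \<inter> cball y (2 * real n)) y z"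
      using claim[of N y t n] n(1) by simp
  qed
qed

lemma path_component_affine_image:
  assumes "path_component S x y"
  shows "path_component ((\<lambda>x. l + e *\<^sub>R x) ` S) (l + e *\<^sub>R x) (l + e *\<^sub>R (y::real^2))"
proof -
  obtain g where g: "path g" "path_image g \<subseteq> S" "pathstart g = x" "pathfinish g = y"
    using assms unfolding path_component_def by blast
  have "path ((\<lambda>x. l + e *\<^sub>R x) \<circ> g)" using g(1) by (intro path_continuous_image continuous_intros)
  then show ?thesis unfolding path_component_def
    using g by (intro exI[of _ "(\<lambda>x. l + e *\<^sub>R x) \<circ> g"]) (auto simp: path_image_compose pathstart_compose pathfinish_compose)
qed

lemma half_lattice_if_P_eq:
  assumes "l \<in> L" "P q = P ((1 / 2) *\<^sub>R l)"
  shows "2 *\<^sub>R q \<in> L"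
proof -
  have "q - (1 / 2) *\<^sub>R l \<in> L \<or> q + (1 / 2) *\<^sub>R l \<in> L" using assms(2) P_eq_iff by blast
  then have "real_of_int 2 *\<^sub>R (q - (1 / 2) *\<^sub>R l) + l \<in> L \<or> real_of_int 2 *\<^sub>R (q + (1 / 2) *\<^sub>R l) - l \<in> L"
    using rank2_lattice_closed(2,3,5)[OF L] assms(1) by blast
  then show ?thesis by (simp add: algebra_simps)
qed

text \<open>As \<open>2 *\<^sub>R q \<in> L\<close>, the half-turn about \<open>q\<close> is a deck
  transformation. A path from \<open>y\<close> to \<open>q\<close> followed by its rotated reverse
  leads to the mirror image of \<open>y\<close>; the rotated half stays within 2M + M of
  \<open>y\<close>.\<close>

lemma half_lattice_reflect:
  assumes "2 *\<^sub>R q \<in> L" "path_component (P -` N \<inter> cball y M) y q"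
  shows "path_component (P -` N \<inter> cball y (3 * M)) y (y + 2 *\<^sub>R (q - y))"
proof -
  have M: "norm (q - y) \<le> M" using path_component_mem(2)[OF assms(2)] by (simp add: dist_norm norm_minus_commute)
  from order_trans[OF norm_ge_zero this] have M0: "M \<ge> 0" .
  have 1: "path_component (P -` N \<inter> cball y (3 * M)) y q"
    by (rule path_component_of_subset[OF _ assms(2)]) (use M0 in auto)
  have "path_component ((\<lambda>x. 2 *\<^sub>R q + (- 1) *\<^sub>R x) ` (P -` N \<inter> cball y M)) (2 *\<^sub>R q + (- 1) *\<^sub>R q) (2 *\<^sub>R q + (- 1) *\<^sub>R y)"
    using path_component_affine_image[OF path_component_sym[OF assms(2)]] .
  moreover have "(\<lambda>x. 2 *\<^sub>R q + (- 1) *\<^sub>R x) ` (P -` N \<inter> cball y M) \<subseteq> P -` N \<inter> cball y (3 * M)"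
  proof (intro image_subsetI)
    fix x assume x: "x \<in> P -` N \<inter> cball y M"
    have "P (2 *\<^sub>R q + (- 1) *\<^sub>R x) \<in> N" using P_deck[OF assms(1), of "-1" x] x by auto
    moreover have "norm ((2 *\<^sub>R q + (- 1) *\<^sub>R x) - y) \<le> 3 * M"
    proof -
      have eq: "(2 *\<^sub>R q + (- 1) *\<^sub>R x) - y = 2 *\<^sub>R (q - y) + (y - x)" by (simp add: algebra_simps scaleR_2)
      have "norm (2 *\<^sub>R (q - y)) = 2 * norm (q - y)" by (simp only: norm_scaleR)
      then have "norm ((2 *\<^sub>R q + (- 1) *\<^sub>R x) - y) \<le> 2 * norm (q - y) + norm (y - x)"
        using norm_triangle_ineq[of "2 *\<^sub>R (q - y)" "y - x"] unfolding eq by linarith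
      then show ?thesis using M x by (simp add: dist_norm)
    qed
    ultimately show "2 *\<^sub>R q + (- 1) *\<^sub>R x \<in> P -` N \<inter> cball y (3 * M)"
      by (simp add: dist_norm norm_minus_commute)
  qed
  ultimately have "path_component (P -` N \<inter> cball y (3 * M)) (2 *\<^sub>R q + (- 1) *\<^sub>R q) (2 *\<^sub>R q + (- 1) *\<^sub>R y)"
    by (rule path_component_of_subset[rotated])
  moreover have "2 *\<^sub>R q + (- 1) *\<^sub>R q = q" "2 *\<^sub>R q + (- 1) *\<^sub>R y = y + 2 *\<^sub>R (q - y)" by (simp_all add: algebra_simps scaleR_2)
  ultimately have "path_component (P -` N \<inter> cball y (3 * M)) q (y + 2 *\<^sub>R (q - y))" by (simp only:)
  then show ?thesis by (rule path_component_trans[OF 1])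
qed

text \<open>Half-turns about the lifts of three corners generate two independent translations, so the lifts of
  the path contain a doubly periodic grid. The cross product of the translations is an odd multiple of
  the covolume because the three corners are distinct.\<close>

lemma complement_of_corner_path_bounded:
  assumes g: "pathin X g" and t: "t1 \<in> {0..1}" "t2 \<in> {0..1}"
    and l: "l0 \<in> L" "l1 \<in> L" "l2 \<in> L"
    and gl: "g 0 = P ((1 / 2) *\<^sub>R l0)" "g t1 = P ((1 / 2) *\<^sub>R l1)" "g t2 = P ((1 / 2) *\<^sub>R l2)"
    and ne: "g 0 \<noteq> g t1" "g 0 \<noteq> g t2" "g t1 \<noteq> g t2"
  obtains R where "\<And>p. path p \<Longrightarrow> P ` path_image p \<inter> g ` {0..1} = {} \<Longrightarrow> dist (pathstart p) (pathfinish p) \<le> R"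
proof -
  obtain M where M: "M > 0" "\<And>N y t. openin X N \<Longrightarrow> g ` {0..1} \<subseteq> N \<Longrightarrow> P y = g 0 \<Longrightarrow> t \<in> {0..1} \<Longrightarrow>
      \<exists>z. P z = g t \<and> path_component (P -` N \<inter> cball y M) y z"
    by (rule approximate_path_lifting[OF g]) blast
  obtain u w where uw: "cross2 u w \<noteq> 0" and Leq: "L = {of_int m *\<^sub>R u + of_int n *\<^sub>R w | m n. True}"
    by (rule rank2_latticeE[OF L])
  define \<Delta> where "\<Delta> = \<bar>cross2 u w\<bar>"
  have D: "\<Delta> > 0" using uw by (simp add: \<Delta>_def)
  define y where "y = (1 / 2) *\<^sub>R l0"
  \<comment> \<open>The displacement bound that the barriers require: they have radius 3M, the
    translations have length at most 2M, and the determinant is at least \<Delta>.\<close>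
  define E where "E = 3 * M * (2 * M) / \<Delta>"
  have E0: "E \<ge> 0" using M(1) D by (simp add: E_def)
  define R where "R = 2 * ((2 * E + 2) * (2 * M))"
  have evenL: "v \<in> L" if ev: "2 *\<^sub>R v = of_int m *\<^sub>R u + of_int n *\<^sub>R w" "even m" "even n" for v m n
  proof -
    obtain m' n' where "m = 2 * m'" "n = 2 * n'" using ev(2,3) by (elim evenE)
    then have "2 *\<^sub>R v = 2 *\<^sub>R (of_int m' *\<^sub>R u + of_int n' *\<^sub>R w)" using ev(1) by (simp add: algebra_simps)
    then have "v = of_int m' *\<^sub>R u + of_int n' *\<^sub>R w" by simp
    then show ?thesis unfolding Leq by blast
  qed
  show ?thesis
  proof (rule that[of R])
    fix p :: "real \<Rightarrow> real^2" assume p: "path p" and dis: "P ` path_image p \<inter> g ` {0..1} = {}"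
    \<comment> \<open>The corner path lies in the complement of the image of \<open>p\<close>. With
      this complement as the neighbourhood, the lifted barriers and all their translates avoid
      \<open>p\<close>.\<close>
    define N where "N = topspace X - P ` path_image p"
    have "closedin X (P ` path_image p)"
      using compactin_imp_closedin[OF hausX compact_image_P[OF compact_path_image[OF p]]] .
    then have N: "openin X N" unfolding N_def by (rule openin_diff[OF openin_topspace])
    have gN: "g ` {0..1} \<subseteq> N"
      using dis g continuous_map_image_subset_topspace[of "top_of_set {0..1}" X g] unfolding N_def pathin_def by fastforce
    have y: "P y = g 0" using gl(1) by (simp add: y_def)
    obtain q1 where q1: "P q1 = g t1" "path_component (P -` N \<inter> cball y M) y q1" using M(2)[OF N gN y t(1)] by blast
    obtain q2 where q2: "P q2 = g t2" "path_component (P -` N \<inter> cball y M) y q2" using M(2)[OF N gN y t(2)] by blast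
    have hy: "2 *\<^sub>R y \<in> L" using l(1) by (simp add: y_def)
    have h1: "2 *\<^sub>R q1 \<in> L" by (rule half_lattice_if_P_eq[OF l(2)]) (simp add: q1(1) gl)
    have h2: "2 *\<^sub>R q2 \<in> L" by (rule half_lattice_if_P_eq[OF l(3)]) (simp add: q2(1) gl)
    define \<tau>1 \<tau>2 where "\<tau>1 = 2 *\<^sub>R (q1 - y)" and "\<tau>2 = 2 *\<^sub>R (q2 - y)"
    have tL: "\<tau>1 \<in> L" "\<tau>2 \<in> L"
      unfolding \<tau>1_def \<tau>2_def scaleR_diff_right using rank2_lattice_closed(3)[OF L] hy h1 h2 by blast+
    obtain m1 n1 where mn1: "\<tau>1 = of_int m1 *\<^sub>R u + of_int n1 *\<^sub>R w" using tL(1) unfolding Leq by blast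
    obtain m2 n2 where mn2: "\<tau>2 = of_int m2 *\<^sub>R u + of_int n2 *\<^sub>R w" using tL(2) unfolding Leq by blast
    have notL: "q1 - y \<notin> L" "q2 - y \<notin> L" "q1 - q2 \<notin> L"
      using ne y q1(1) q2(1) P_eq_iff[of q1 y] P_eq_iff[of q2 y] P_eq_iff[of q1 q2] by auto
    have o1: "\<not> (even m1 \<and> even n1)" using evenL[of "q1 - y" m1 n1] notL(1) mn1 by (auto simp: \<tau>1_def)
    have o2: "\<not> (even m2 \<and> even n2)" using evenL[of "q2 - y" m2 n2] notL(2) mn2 by (auto simp: \<tau>2_def)
    have o3: "\<not> (even (m1 - m2) \<and> even (n1 - n2))"
    proof -
      have "2 *\<^sub>R (q1 - q2) = \<tau>1 - \<tau>2" by (simp add: \<tau>1_def \<tau>2_def algebra_simps)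
      also have "\<dots> = of_int (m1 - m2) *\<^sub>R u + of_int (n1 - n2) *\<^sub>R w" by (simp add: mn1 mn2 algebra_simps)
      finally show ?thesis using evenL notL(3) by blast
    qed
    \<comment> \<open>Modulo 2 the two coordinate vectors are nonzero and distinct, hence linearly
      independent over the field with two elements.\<close>
    have "odd (m1 * n2 - n1 * m2)" using o1 o2 o3 by auto
    then have "m1 * n2 - n1 * m2 \<noteq> 0" by (metis even_zero)
    then have "1 \<le> \<bar>real_of_int (m1 * n2 - n1 * m2)\<bar>" by linarith
    moreover have cr: "cross2 \<tau>1 \<tau>2 = of_int (m1 * n2 - n1 * m2) * cross2 u w"
      unfolding mn1 mn2 by (simp add: cross2_def algebra_simps)
    ultimately have crD: "\<Delta> \<le> \<bar>cross2 \<tau>1 \<tau>2\<bar>" unfolding \<Delta>_def cr abs_mult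
      using mult_right_mono[of 1 "\<bar>real_of_int (m1 * n2 - n1 * m2)\<bar>" "\<bar>cross2 u w\<bar>"] by simp
    moreover have "cross2 \<tau>2 \<tau>1 = - cross2 \<tau>1 \<tau>2" by (simp add: cross2_def)
    ultimately have cr0: "cross2 \<tau>1 \<tau>2 \<noteq> 0" "cross2 \<tau>2 \<tau>1 \<noteq> 0" "\<bar>cross2 \<tau>2 \<tau>1\<bar> = \<bar>cross2 \<tau>1 \<tau>2\<bar>"
      using D by auto
    have tM: "norm \<tau>1 \<le> 2 * M" "norm \<tau>2 \<le> 2 * M"
      using path_component_mem(2)[OF q1(2)] path_component_mem(2)[OF q2(2)]
      by (auto simp: \<tau>1_def \<tau>2_def dist_norm norm_minus_commute)
    let ?S = "P -` N \<inter> cball y (3 * M)"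
    have s1: "path_component ?S y (y + \<tau>1)" unfolding \<tau>1_def by (rule half_lattice_reflect[OF h1 q1(2)])
    have s2: "path_component ?S y (y + \<tau>2)" unfolding \<tau>2_def by (rule half_lattice_reflect[OF h2 q2(2)])
    have Sb: "norm (x - y) \<le> 3 * M" if "x \<in> ?S" for x using that by (simp add: dist_norm norm_minus_commute)
    have EE: "3 * M * norm \<tau> \<le> E * \<bar>cross2 \<tau>1 \<tau>2\<bar>" if "norm \<tau> \<le> 2 * M" for \<tau> :: "real^2"
    proof -
      have "3 * M * norm \<tau> \<le> 3 * M * (2 * M)" using that M(1) by (intro mult_left_mono) auto
      also have "\<dots> = E * \<Delta>" using D by (simp add: E_def)
      also have "\<dots> \<le> E * \<bar>cross2 \<tau>1 \<tau>2\<bar>" using crD E0 by (intro mult_left_mono)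
      finally show ?thesis .
    qed
    have dj: "x + of_int i *\<^sub>R \<tau> + of_int j *\<^sub>R \<tau>' \<notin> path_image p" if "x \<in> ?S" "\<tau> \<in> L" "\<tau>' \<in> L" for x i j \<tau> \<tau>'
    proof
      assume "x + of_int i *\<^sub>R \<tau> + of_int j *\<^sub>R \<tau>' \<in> path_image p"
      moreover have "P (x + of_int i *\<^sub>R \<tau> + of_int j *\<^sub>R \<tau>') = P x"
        using P_add rank2_lattice_closed(5)[OF L] that(2,3) by metis
      ultimately have "P x \<in> P ` path_image p" by (metis imageI)
      then show False using that(1) by (simp add: N_def)
    qed
    \<comment> \<open>Each translation serves once as the direction of the barrier; together the two
      bounds control both coordinates of the displacement.\<close>
    let ?d = "pathfinish p - pathstart p"
    have b1: "\<bar>cross2 ?d \<tau>2 / cross2 \<tau>1 \<tau>2\<bar> \<le> 2 * E + 2"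
      by (rule periodic_barrier[OF cr0(1) p s2 Sb EE[OF tM(2)] dj[OF _ tL]])
    have b2: "\<bar>cross2 ?d \<tau>1 / cross2 \<tau>2 \<tau>1\<bar> \<le> 2 * E + 2"
      by (rule periodic_barrier[OF cr0(2) p s1 Sb _ dj[OF _ tL(2,1)]]) (use EE[OF tM(1)] cr0(3) in auto)
    have "cross2 \<tau>1 \<tau>2 *\<^sub>R ?d = cross2 ?d \<tau>2 *\<^sub>R \<tau>1 + cross2 \<tau>1 ?d *\<^sub>R \<tau>2" by (rule cross2_expand)
    then have "(1 / cross2 \<tau>1 \<tau>2) *\<^sub>R (cross2 \<tau>1 \<tau>2 *\<^sub>R ?d) = (1 / cross2 \<tau>1 \<tau>2) *\<^sub>R (cross2 ?d \<tau>2 *\<^sub>R \<tau>1 + cross2 \<tau>1 ?d *\<^sub>R \<tau>2)"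
      by (rule arg_cong)
    then have d: "?d = (cross2 ?d \<tau>2 / cross2 \<tau>1 \<tau>2) *\<^sub>R \<tau>1 + (cross2 \<tau>1 ?d / cross2 \<tau>1 \<tau>2) *\<^sub>R \<tau>2"
      using cr0(1) by (simp add: scaleR_add_right)
    have b2': "\<bar>cross2 \<tau>1 ?d / cross2 \<tau>1 \<tau>2\<bar> \<le> 2 * E + 2"
    proof -
      have "cross2 \<tau>1 ?d = - cross2 ?d \<tau>1" "cross2 \<tau>2 \<tau>1 = - cross2 \<tau>1 \<tau>2" by (simp_all add: cross2_def)
      then have "cross2 \<tau>1 ?d / cross2 \<tau>1 \<tau>2 = cross2 ?d \<tau>1 / cross2 \<tau>2 \<tau>1" by simp
      then show ?thesis using b2 by simp
    qed
    have "norm ?d \<le> \<bar>cross2 ?d \<tau>2 / cross2 \<tau>1 \<tau>2\<bar> * norm \<tau>1 + \<bar>cross2 \<tau>1 ?d / cross2 \<tau>1 \<tau>2\<bar> * norm \<tau>2"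
      by (subst d) (metis norm_scaleR norm_triangle_ineq)
    also have "\<dots> \<le> (2 * E + 2) * (2 * M) + (2 * E + 2) * (2 * M)"
      using b1 b2' tM E0 by (intro add_mono mult_mono) auto
    finally show "dist (pathstart p) (pathfinish p) \<le> R" by (simp add: R_def dist_norm norm_minus_commute mult_ac)
  qed
qed

end

subsection \<open>Jordan curves on the sphere\<close>

lemma top_of_set_homeomorphic_space: "top_of_set S homeomorphic_space top_of_set T \<longleftrightarrow> S homeomorphic T"
proof
  assume "top_of_set S homeomorphic_space top_of_set T"
  then obtain f g where "homeomorphic_maps (top_of_set S) (top_of_set T) f g" unfolding homeomorphic_space_def by blast
  then have "homeomorphism S T f g"
    unfolding homeomorphic_maps_def homeomorphism_def by (auto simp: image_iff Pi_iff) metis+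
  then show "S homeomorphic T" unfolding homeomorphic_def by blast
next
  assume "S homeomorphic T"
  then obtain f g where "homeomorphism S T f g" unfolding homeomorphic_def by blast
  then have "homeomorphic_maps (top_of_set S) (top_of_set T) f g"
    unfolding homeomorphic_maps_def homeomorphism_def by auto
  then show "top_of_set S homeomorphic_space top_of_set T" unfolding homeomorphic_space_def by blast
qed

lemma punctured_sphere_plane:
  assumes X: "X homeomorphic_space top_of_set (sphere (0 :: real^3) 1)" and q: "q \<in> topspace X"
  shows "subtopology X (topspace X - {q}) homeomorphic_space (euclidean :: complex topology)"
proof -
  let ?S = "sphere (0 :: real^3) 1"
  obtain \<phi> where \<phi>: "homeomorphic_map X (top_of_set ?S) \<phi>" using X by (auto simp: homeomorphic_space)
  have sur: "\<phi> ` topspace X = ?S" using homeomorphic_imp_surjective_map[OF \<phi>] by simp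
  have inj: "inj_on \<phi> (topspace X)" by (rule homeomorphic_imp_injective_map[OF \<phi>])
  have "\<phi> ` (topspace X \<inter> (topspace X - {q})) = topspace (top_of_set ?S) \<inter> (?S - {\<phi> q})"
    using sur inj q by (auto simp: inj_on_def)
  from homeomorphic_map_subtopologies[OF \<phi> this]
  have "homeomorphic_map (subtopology X (topspace X - {q})) (subtopology (top_of_set ?S) (?S - {\<phi> q})) \<phi>" .
  then have "subtopology X (topspace X - {q}) homeomorphic_space top_of_set (?S - {\<phi> q})"
    unfolding homeomorphic_space subtopology_subtopology by (auto simp: Int_absorb1)
  moreover have "(?S - {\<phi> q}) homeomorphic (UNIV :: complex set)"
  proof (rule homeomorphic_punctured_sphere_affine)
    show "\<phi> q \<in> ?S" using sur q by blast
  qed (auto simp: aff_dim_UNIV)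
  then have "top_of_set (?S - {\<phi> q}) homeomorphic_space (euclidean :: complex topology)"
    using top_of_set_homeomorphic_space[of "?S - {\<phi> q}" "UNIV :: complex set"] by simp
  ultimately show ?thesis by (rule homeomorphic_space_trans)
qed

text \<open>The 2-sphere is simply connected and the circle is not.\<close>

lemma jordan_curve_ne_topspace:
  assumes X: "X homeomorphic_space top_of_set (sphere (0 :: real^3) 1)" and C: "jordan_curve X C"
  shows "C \<noteq> topspace X"
proof
  assume "C = topspace X"
  then have "X homeomorphic_space top_of_set (sphere (0 :: complex) 1)" using C by (simp add: jordan_curve_def)
  then have "top_of_set (sphere (0 :: real^3) 1) homeomorphic_space top_of_set (sphere (0 :: complex) 1)"
    using X homeomorphic_space_sym homeomorphic_space_trans by blast
  then have "sphere (0 :: real^3) 1 homeomorphic sphere (0 :: complex) 1" by (simp only: top_of_set_homeomorphic_space)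
  then have "simply_connected (sphere (0 :: real^3) 1) \<longleftrightarrow> simply_connected (sphere (0 :: complex) 1)"
    by (rule homeomorphic_simply_connected_eq)
  then show False by (simp add: simply_connected_sphere_eq)
qed

lemma jordan_curveE:
  assumes "jordan_curve X C"
  obtains H where "homeomorphic_map (top_of_set (sphere (0 :: complex) 1)) (subtopology X C) H"
    "continuous_map (top_of_set (sphere (0 :: complex) 1)) X H" "H ` sphere 0 1 = C" "inj_on H (sphere 0 1)"
proof -
  obtain H where H: "homeomorphic_map (top_of_set (sphere (0 :: complex) 1)) (subtopology X C) H"
    using assms homeomorphic_space_sym unfolding jordan_curve_def homeomorphic_space by blast
  have "C \<subseteq> topspace X" using assms by (simp add: jordan_curve_def)
  then have "H ` sphere 0 1 = C" using homeomorphic_imp_surjective_map[OF H] by (simp add: Int_absorb1)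
  moreover have "inj_on H (sphere 0 1)" using homeomorphic_imp_injective_map[OF H] by simp
  moreover have "continuous_map (top_of_set (sphere (0 :: complex) 1)) X H"
    using homeomorphic_imp_continuous_map[OF H] by (simp add: continuous_map_in_subtopology)
  ultimately show ?thesis using that H by blast
qed

lemma finite_connected_components_of:
  assumes "topspace Y \<subseteq> \<Union>F" "finite F" "\<And>D. D \<in> F \<Longrightarrow> connectedin Y D"
  shows "finite (connected_components_of Y)"
proof -
  have "connected_components_of Y \<subseteq> (\<lambda>D. connected_component_of_set Y (SOME x. x \<in> D)) ` F"
  proof
    fix K assume K: "K \<in> connected_components_of Y"
    then obtain x where x: "x \<in> topspace Y" "K = connected_component_of_set Y x"
      unfolding connected_components_of_def by blast
    then have xK: "x \<in> K" by (simp add: connected_component_of_refl)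
    obtain D where D: "D \<in> F" "x \<in> D" using assms(1) x by blast
    have "D \<subseteq> K" by (rule connected_components_of_maximal[OF K assms(3)[OF D(1)]]) (use D(2) xK in \<open>auto simp: disjnt_def\<close>)
    moreover have "(SOME x. x \<in> D) \<in> D" using D(2) by (rule someI)
    ultimately have "connected_component_of Y x (SOME x. x \<in> D)" using x(2) by auto
    then have "connected_component_of_set Y x = connected_component_of_set Y (SOME x. x \<in> D)"
      by (simp add: connected_component_of_equiv) 
    then show "K \<in> (\<lambda>D. connected_component_of_set Y (SOME x. x \<in> D)) ` F" using x(2) D(1) by blast
  qed
  then show ?thesis using assms(2) finite_surj by blast
qed

text \<open>Removing a point off the curve turns the sphere into the plane, where the Jordan curve
  theorem applies. The inside, the outside and the removed point are three connected sets covering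
  the complement; the curve is the frontier of the inside, hence in the closure.\<close>

lemma jordan_curve_complement:
  assumes X: "X homeomorphic_space top_of_set (sphere (0 :: real^3) 1)" and C: "jordan_curve X C"
  shows "finite (connected_components_of (subtopology X (topspace X - C)))" "C \<subseteq> X closure_of (topspace X - C)"
proof -
  have CX: "C \<subseteq> topspace X" using C by (simp add: jordan_curve_def)
  then obtain q where q: "q \<in> topspace X" "q \<notin> C" using jordan_curve_ne_topspace[OF X C] by blast
  let ?Y = "subtopology X (topspace X - {q})"
  obtain \<phi> \<psi> where hm: "homeomorphic_maps ?Y (euclidean :: complex topology) \<phi> \<psi>"
    using punctured_sphere_plane[OF X q(1)] unfolding homeomorphic_space_def by blast
  have tY: "topspace ?Y = topspace X - {q}" by auto
  have cphi: "continuous_map ?Y (euclidean :: complex topology) \<phi>" and cpsi: "continuous_map euclidean ?Y \<psi>"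
    and pp: "\<And>x. x \<in> topspace X \<Longrightarrow> x \<noteq> q \<Longrightarrow> \<psi> (\<phi> x) = x" and pp': "\<And>z. \<phi> (\<psi> z) = z"
    using hm unfolding homeomorphic_maps_def tY by auto
  have cpsiX: "continuous_map euclidean X \<psi>" using cpsi by (simp add: continuous_map_in_subtopology)
  have "\<psi> z \<in> topspace X - {q}" for z
    using continuous_map_image_subset_topspace[OF cpsi] unfolding tY by auto
  then have psi_in: "\<psi> z \<in> topspace X" "\<psi> z \<noteq> q" for z by blast+
  obtain H where H: "continuous_map (top_of_set (sphere (0 :: complex) 1)) X H" "H ` sphere 0 1 = C" "inj_on H (sphere 0 1)"
    using jordan_curveE[OF C] by blast
  have "continuous_map (top_of_set (sphere (0 :: complex) 1)) ?Y H"
    using H(1,2) q(2) CX by (auto simp: continuous_map_in_subtopology)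
  then have "continuous_map (top_of_set (sphere (0 :: complex) 1)) euclidean (\<phi> \<circ> H)"
    by (rule continuous_map_compose[OF _ cphi])
  then have cont: "continuous_on (sphere 0 1) (\<phi> \<circ> H)" by simp
  have inj: "inj_on (\<phi> \<circ> H) (sphere 0 1)"
  proof (rule comp_inj_on[OF H(3)])
    show "inj_on \<phi> (H ` sphere 0 1)" unfolding H(2) using pp CX q(2) by (metis inj_onI subsetD)
  qed
  define c where "c = (\<phi> \<circ> H) \<circ> circlepath 0 1"
  have pc: "path_image (circlepath (0::complex) 1) = sphere 0 1" by simp
  have sc: "simple_path c"
    unfolding c_def
  proof (rule simple_path_continuous_image)
    show "simple_path (circlepath (0::complex) 1)" by (simp add: simple_path_circlepath)
    show "continuous_on (path_image (circlepath 0 1)) (\<phi> \<circ> H)" "inj_on (\<phi> \<circ> H) (path_image (circlepath 0 1))"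
      unfolding pc by fact+
  qed
  have loop: "pathfinish c = pathstart c" by (simp add: c_def pathfinish_compose pathstart_compose)
  have pic: "path_image c = \<phi> ` C" unfolding c_def path_image_compose pc H(2)[symmetric] by (simp add: image_comp)
  let ?I = "inside (path_image c)" and ?O = "outside (path_image c)"
  have J: "connected ?I" "connected ?O" "?I \<union> ?O = - path_image c" "frontier ?I = path_image c"
    using Jordan_inside_outside[OF sc loop] by auto
  have psiC: "\<psi> z \<in> C \<longleftrightarrow> z \<in> path_image c" for z
    unfolding pic using pp' pp CX q(2) by (metis (no_types, lifting) image_iff subsetD)
  have conn: "connectedin (subtopology X (topspace X - C)) (\<psi> ` S)" if "connected S" "S \<inter> path_image c = {}" for S
  proof -
    have "connectedin X (\<psi> ` S)" using connectedin_continuous_map_image[OF cpsiX] that(1) by simp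
    moreover have "\<psi> ` S \<subseteq> topspace X - C" using psi_in psiC that(2) by blast
    ultimately show ?thesis by (simp add: connectedin_subtopology)
  qed
  have "topspace X - C \<subseteq> \<Union>{{q}, \<psi> ` ?I, \<psi> ` ?O}"
  proof
    fix x assume x: "x \<in> topspace X - C"
    show "x \<in> \<Union>{{q}, \<psi> ` ?I, \<psi> ` ?O}"
    proof (cases "x = q")
      case False
      then have e: "x = \<psi> (\<phi> x)" using pp x by auto
      then have "\<phi> x \<notin> path_image c" using psiC[of "\<phi> x"] x by auto
      then have "\<phi> x \<in> ?I \<union> ?O" using J(3) by blast
      then show ?thesis using e by blast
    qed simp
  qed
  moreover have "connectedin (subtopology X (topspace X - C)) D" if "D \<in> {{q}, \<psi> ` ?I, \<psi> ` ?O}" for D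
    using that conn[OF J(1)] conn[OF J(2)] q by (auto simp: inside_no_overlap outside_no_overlap connectedin_sing)
  ultimately show "finite (connected_components_of (subtopology X (topspace X - C)))"
    by (intro finite_connected_components_of[where F = "{{q}, \<psi> ` ?I, \<psi> ` ?O}"]) auto
  show "C \<subseteq> X closure_of (topspace X - C)"
  proof
    fix p assume p: "p \<in> C"
    then have "\<phi> p \<in> path_image c" unfolding pic by blast
    then have "\<phi> p \<in> frontier ?I" using J(4) by blast
    then have "\<phi> p \<in> euclidean closure_of ?I" by (simp add: frontier_def)
    then have "\<psi> (\<phi> p) \<in> X closure_of (\<psi> ` ?I)"
      using continuous_map_image_closure_subset[OF cpsiX, of ?I] by blast
    moreover have "\<psi> ` ?I \<subseteq> topspace X - C"
      using psi_in psiC inside_no_overlap[of "path_image c"] by blast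
    moreover have "\<psi> (\<phi> p) = p" using pp p CX q(2) by blast
    ultimately show "p \<in> X closure_of (topspace X - C)" using closure_of_mono by (metis subsetD)
  qed
qed

text \<open>Off one point the sphere is a plane, and a homeomorphism of the plane moves the finite
  set onto points of the unit circle; the curve is the preimage of this circle.\<close>

lemma jordan_curve_through:
  assumes X: "X homeomorphic_space top_of_set (sphere (0 :: real^3) 1)" and F: "finite F" "F \<subseteq> topspace X"
  obtains C where "jordan_curve X C" "F \<subseteq> C"
proof -
  have "infinite (topspace X)"
  proof -
    have "infinite (sphere (0 :: real^3) 1)"
    proof
      assume "finite (sphere (0 :: real^3) 1)"
      moreover have "connected (sphere (0 :: real^3) 1)" by (rule connected_sphere) simp
      ultimately obtain a where "sphere (0 :: real^3) 1 \<subseteq> {a}"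
        by (metis connected_finite_iff_sing empty_subsetI subset_refl)
      then have "axis 1 1 = a" "axis 2 1 = a" by (auto simp: subset_iff)
      then have "(axis 1 1 :: real^3) = axis 2 1" by simp
      then show False by (simp add: axis_eq_axis)
    qed
    moreover obtain \<phi> where "homeomorphic_map X (top_of_set (sphere (0 :: real^3) 1)) \<phi>" using X by (auto simp: homeomorphic_space)
    then have "\<phi> ` topspace X = sphere 0 1" by (metis homeomorphic_imp_surjective_map topspace_euclidean_subtopology)
    ultimately show ?thesis by (metis finite_imageI)
  qed
  then obtain q where q: "q \<in> topspace X" "q \<notin> F" using F(1) by (metis finite_subset subsetI)
  let ?Y = "subtopology X (topspace X - {q})"
  obtain \<phi> \<psi> where hm: "homeomorphic_maps ?Y (euclidean :: complex topology) \<phi> \<psi>"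
    using punctured_sphere_plane[OF X q(1)] unfolding homeomorphic_space_def by blast
  have tY: "topspace ?Y = topspace X - {q}" by auto
  have pp: "\<And>x. x \<in> topspace X \<Longrightarrow> x \<noteq> q \<Longrightarrow> \<psi> (\<phi> x) = x"
    using hm unfolding homeomorphic_maps_def tY by auto
  have infc: "infinite (sphere (0::complex) 1)"
  proof
    assume "finite (sphere (0::complex) 1)"
    moreover have "connected (sphere (0 :: complex) 1)" by (rule connected_sphere) simp
    ultimately obtain a where "sphere (0 :: complex) 1 \<subseteq> {a}"
      by (metis connected_finite_iff_sing empty_subsetI subset_refl)
    then have "1 = a" "- 1 = a" by (auto simp: subset_iff)
    then show False by simp
  qed
  have finK: "finite (\<phi> ` F)" using F(1) by simp
  obtain B where B: "B \<subseteq> sphere (0::complex) 1" "finite B" "card B = card (\<phi> ` F)"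
    using infinite_arbitrarily_large[OF infc] by metis
  obtain y where y: "bij_betw y (\<phi> ` F) B" using finite_same_card_bij[OF finK B(2)] B(3) by metis
  obtain h k where hk: "homeomorphism (UNIV :: complex set) UNIV h k" "\<And>i. i \<in> \<phi> ` F \<Longrightarrow> h i = y i"
  proof (rule homeomorphism_moving_points_exists[of "UNIV :: complex set" UNIV "\<phi> ` F" "\<lambda>i. i" y])
    show "pairwise (\<lambda>i j. i \<noteq> j \<and> y i \<noteq> y j) (\<phi> ` F)"
      using y by (auto simp: pairwise_def bij_betw_def inj_on_def)
  qed (use finK in auto)
  define m where "m = \<psi> \<circ> k"
  have cm: "continuous_map euclidean X m"
    unfolding m_def using hm hk(1)
    by (intro continuous_map_compose[of euclidean euclidean k X \<psi>])
      (auto simp: homeomorphism_def homeomorphic_maps_def continuous_map_in_subtopology)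
  have im: "inj m"
  proof (rule injI)
    fix a b assume "m a = m b"
    then have "k a = k b" using hm unfolding m_def homeomorphic_maps_def by (metis UNIV_I comp_apply topspace_euclidean)
    then show "a = b" using hk(1) unfolding homeomorphism_def by (metis UNIV_I)
  qed
  define C where "C = m ` sphere 0 1"
  have FC: "F \<subseteq> C"
  proof
    fix p assume p: "p \<in> F"
    have "y (\<phi> p) \<in> B" using bij_betwE[OF y] p by blast
    then have "h (\<phi> p) \<in> sphere 0 1" using hk(2)[of "\<phi> p"] B(1) p by (metis imageI subsetD)
    moreover have "m (h (\<phi> p)) = p"
      using hk(1) pp[of p] p F(2) q(2) unfolding m_def homeomorphism_def by auto
    ultimately show "p \<in> C" unfolding C_def by (metis imageI)
  qed
  have CX: "C \<subseteq> topspace X" using continuous_map_image_subset_topspace[OF cm] by (auto simp: C_def)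
  have hausX: "Hausdorff_space X"
    using homeomorphic_Hausdorff_space[OF X] by (simp add: Hausdorff_space_subtopology)
  have "homeomorphic_map (top_of_set (sphere (0::complex) 1)) (subtopology X C) m"
  proof (rule continuous_imp_homeomorphic_map)
    show "continuous_map (top_of_set (sphere 0 1)) (subtopology X C) m"
      using continuous_map_from_subtopology[OF cm, of "sphere 0 1"] by (auto simp: continuous_map_in_subtopology C_def)
    show "compact_space (top_of_set (sphere (0::complex) 1))" by (simp add: compact_space_subtopology)
    show "Hausdorff_space (subtopology X C)" using hausX by (rule Hausdorff_space_subtopology)
    show "m ` topspace (top_of_set (sphere 0 1)) = topspace (subtopology X C)" using CX by (auto simp: C_def)
    show "inj_on m (topspace (top_of_set (sphere 0 1)))" using im by (auto intro: inj_on_subset)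
  qed
  then have "jordan_curve X C"
    unfolding jordan_curve_def using CX homeomorphic_map_imp_homeomorphic_space homeomorphic_space_sym by blast
  then show ?thesis using that FC by blast
qed

text \<open>Each piece is open and, as the complement of the union of the others, closed.\<close>

lemma connected_components_of_partition:
  assumes op: "\<And>U. U \<in> F \<Longrightarrow> openin Y U" and conn: "\<And>U. U \<in> F \<Longrightarrow> connectedin Y U" and ne: "{} \<notin> F"
    and dj: "\<And>U V. U \<in> F \<Longrightarrow> V \<in> F \<Longrightarrow> U \<noteq> V \<Longrightarrow> U \<inter> V = {}" and cov: "\<Union>F = topspace Y"
  shows "connected_components_of Y = F"
proof -
  have clopen: "closedin Y U" if U: "U \<in> F" for U
  proof -
    have "topspace Y - U = \<Union>(F - {U})"
    proof (intro subset_antisym subsetI)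
      fix p assume p: "p \<in> topspace Y - U"
      then obtain V where "V \<in> F" "p \<in> V" unfolding cov[symmetric] by blast
      then show "p \<in> \<Union>(F - {U})" using p by blast
    next
      fix p assume "p \<in> \<Union>(F - {U})"
      then obtain V where V: "V \<in> F" "V \<noteq> U" "p \<in> V" by blast
      have "p \<in> topspace Y" unfolding cov[symmetric] using V by blast
      then show "p \<in> topspace Y - U" using dj[OF V(1) U V(2)] V(3) by blast
    qed
    then have "openin Y (topspace Y - U)" using op by auto
    then show ?thesis using op[OF U] openin_subset by (auto simp: closedin_def)
  qed
  have key: "K = U" if K: "K \<in> connected_components_of Y" and U: "U \<in> F" "K \<inter> U \<noteq> {}" for K U
  proof
    have "K \<subseteq> U \<or> disjnt K U"
      using connectedin_clopen_cases[OF connectedin_connected_components_of[OF K] clopen[OF U(1)] op[OF U(1)]] .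
    then show "K \<subseteq> U" using U(2) by (auto simp: disjnt_def)
    show "U \<subseteq> K"
      by (rule connected_components_of_maximal[OF K conn[OF U(1)]]) (use U(2) in \<open>auto simp: disjnt_def\<close>)
  qed
  show ?thesis
  proof (intro subset_antisym subsetI)
    fix K assume K: "K \<in> connected_components_of Y"
    then obtain x where "x \<in> K" using nonempty_connected_components_of by blast
    moreover have "K \<subseteq> topspace Y" using K by (rule connected_components_of_subset)
    ultimately obtain U where "U \<in> F" "x \<in> U" unfolding cov[symmetric] by blast
    then show "K \<in> F" using key[OF K, of U] \<open>x \<in> K\<close> by blast
  next
    fix U assume U: "U \<in> F"
    then have "U \<noteq> {}" using ne by metis
    then obtain x where x: "x \<in> U" by blast
    then have "x \<in> topspace Y" unfolding cov[symmetric] using U by blast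
    then obtain K where "K \<in> connected_components_of Y" "x \<in> K"
      by (metis UnionE Union_connected_components_of)
    then show "U \<in> connected_components_of Y" using key[of K U] U x by blast
  qed
qed

text \<open>Only the end parameters share a value, so the injectivity clause keeps one parameter in
  the open interval.\<close>

lemma jordan_curve_parametrization:
  assumes C: "jordan_curve X C" and a: "a \<in> C"
  obtains g where "pathin X g" "g ` {0..1} = C" "g 0 = a" "g 1 = a"
    "\<And>s t. s \<in> {0..1} \<Longrightarrow> t \<in> {0<..<1} \<Longrightarrow> g s = g t \<Longrightarrow> s = t"
proof -
  obtain H where H: "continuous_map (top_of_set (sphere (0 :: complex) 1)) X H" "H ` sphere 0 1 = C" "inj_on H (sphere 0 1)"
    using jordan_curveE[OF C] by blast
  obtain w where w: "w \<in> sphere 0 1" "H w = a" using H(2) a by blast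
  have w1: "cmod w = 1" using w by simp
  define e where "e = (\<lambda>t::real. w * exp (2 * of_real pi * \<i> * of_real t))"
  have e1: "e t \<in> sphere 0 1" for t using w1 by (simp add: e_def norm_mult norm_exp_eq_Re)
  have sur: "\<exists>t\<in>{0..1}. e t = z" if "z \<in> sphere 0 1" for z
  proof -
    have "cmod (z / w) = 1" using that w1 by (simp add: norm_divide)
    then have "z / w \<in> path_image (circlepath 0 1)" by simp
    then obtain t where "t \<in> {0..1}" "z / w = exp (2 * of_real pi * \<i> * of_real t)"
      unfolding path_image_def by (auto simp: circlepath)
    moreover have "w \<noteq> 0" using w1 by auto
    ultimately show ?thesis by (intro bexI[of _ t]) (auto simp: e_def field_simps)
  qed
  have einj: "s = t" if "s \<in> {0..1}" "t \<in> {0<..<1}" "e s = e t" for s t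
  proof -
    have "w \<noteq> 0" using w1 by auto
    then have "circlepath 0 1 s = circlepath 0 1 t" using that(3) by (simp add: e_def circlepath)
    moreover have "simple_path (circlepath (0::complex) 1)" by (simp add: simple_path_circlepath)
    moreover have "s \<in> {0..1}" "t \<in> {0..1}" using that(1,2) by auto
    ultimately have "s = t \<or> s = 0 \<and> t = 1 \<or> s = 1 \<and> t = 0"
      unfolding simple_path_def loop_free_def by blast
    then show ?thesis using that(2) by auto
  qed
  have ce: "continuous_map (top_of_set {0..1}) (top_of_set (sphere (0::complex) 1)) e"
    using e1 by (auto simp: e_def intro!: continuous_intros)
  show ?thesis
  proof (rule that[of "H \<circ> e"])
    show "pathin X (H \<circ> e)" unfolding pathin_def by (rule continuous_map_compose[OF ce H(1)])
    have "e ` {0..1} = sphere 0 1" using e1 sur by blast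
    moreover have "(H \<circ> e) ` {0..1} = H ` e ` {0..1}" by (rule image_comp[symmetric])
    ultimately show "(H \<circ> e) ` {0..1} = C" using H(2) by simp
    show "(H \<circ> e) 0 = a" using w by (simp add: e_def)
    have "exp (2 * of_real pi * \<i>) = (1::complex)" using exp_two_pi_i by (simp add: mult_ac)
    then show "(H \<circ> e) 1 = a" using w by (simp add: e_def)
    show "s = t" if "s \<in> {0..1}" "t \<in> {0<..<1}" "(H \<circ> e) s = (H \<circ> e) t" for s t
      using that einj inj_onD[OF H(3)] e1 by (metis comp_apply)
  qed
qed

text \<open>Of the four edges, the two avoiding \<open>a\<close> form an arc through the other three
  corners, and each of them is disjoint from one of the two edges that end at \<open>a\<close>. Thus
  a set containing \<open>a\<close> and a point of this arc joins opposite sides.\<close>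

lemma jordan_curve_corners:
  assumes C: "jordan_curve X C" and hausX: "Hausdorff_space X" and F: "F \<subseteq> C" "card F = 4"
  defines "ZE \<equiv> (\<lambda>e. X closure_of e) ` connected_components_of (subtopology X (C - F))"
  obtains a g s where "a \<in> F" "pathin X g" "g ` {0..1} \<subseteq> C" "s \<in> {0..1}" "g 0 \<in> F" "g s \<in> F" "g 1 \<in> F"
    "g 0 \<noteq> g s" "g 0 \<noteq> g 1" "g s \<noteq> g 1"
    "\<forall>x\<in>g ` {0..1}. \<exists>e\<in>ZE. \<exists>e'\<in>ZE. e \<inter> e' = {} \<and> a \<in> e \<and> x \<in> e'" "finite ZE" "\<forall>e\<in>ZE. closedin X e"
proof -
  obtain a where a: "a \<in> F" using F(2) by (metis card.empty ex_in_conv zero_neq_numeral)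
  have aC: "a \<in> C" using a F(1) by blast
  obtain g where g: "pathin X g" "g ` {0..1} = C" "g 0 = a" "g 1 = a"
    and ginj: "\<And>s t. s \<in> {0..1} \<Longrightarrow> t \<in> {0<..<1} \<Longrightarrow> g s = g t \<Longrightarrow> s = t"
    by (rule jordan_curve_parametrization[OF C aC]) blast
  have contg: "continuous_map (top_of_set {0..1}) X g" using g(1) by (simp add: pathin_def)
  define T where "T = {t \<in> {0<..<1}. g t \<in> F}"
  have injT: "inj_on g T" by (rule inj_onI, rule ginj) (auto simp: T_def)
  have "g ` T = F - {a}"
  proof (intro subset_antisym subsetI)
    fix x assume "x \<in> g ` T"
    then obtain t where t: "t \<in> {0<..<1}" "x = g t" "x \<in> F" by (auto simp: T_def)
    then show "x \<in> F - {a}" using ginj[of 0 t] g(3) by auto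
  next
    fix x assume x: "x \<in> F - {a}"
    then obtain t where t: "t \<in> {0..1}" "x = g t" using F(1) g(2) by blast
    then have "t \<in> {0<..<1}" using x g(3,4) by (cases "t = 0 \<or> t = 1") auto
    then show "x \<in> g ` T" using t x by (auto simp: T_def)
  qed
  then have "card T = card (F - {a})" using card_image[OF injT] by simp
  also have "\<dots> = 3" using a F(2) by simp
  finally have cT: "card T = 3" .
  then have finT: "finite T" using card.infinite by fastforce
  obtain x y z where xyz: "T = {x, y, z}" "x \<noteq> y" "x \<noteq> z" "y \<noteq> z" using cT by (auto simp: card_3_iff)
  obtain t1 t2 t3 where t: "T = {t1, t2, t3}" "t1 < t2" "t2 < t3"
  proof -
    have "x < y \<and> y < z \<or> x < z \<and> z < y \<or> y < x \<and> x < z \<or> y < z \<and> z < x \<or> z < x \<and> x < y \<or> z < y \<and> y < x"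
      using xyz(2-4) by linarith
    then show ?thesis using that xyz(1) by (elim disjE) (auto simp: insert_commute)
  qed
  have t01: "0 < t1" "t3 < 1" using t(1) by (auto simp: T_def)
  have FF: "F = {a, g t1, g t2, g t3}" using \<open>g ` T = F - {a}\<close> a t(1) by auto
  \<comment> \<open>Parameter intervals of the four open edges; both 0 and 1 are parameters of
    \<open>a\<close>.\<close>
  define I where "I = {(0, t1), (t1, t2), (t2, t3), (t3, 1)}"
  have Iprop: "0 \<le> fst i" "fst i < snd i" "snd i \<le> 1" if "i \<in> I" for i using that t t01 by (auto simp: I_def)
  let ?E = "\<lambda>i::real \<times> real. g ` {fst i<..<snd i}"
  let ?Y = "subtopology X (C - F)"
  have CX: "C \<subseteq> topspace X" using C by (simp add: jordan_curve_def)
  have tY: "topspace ?Y = C - F" using CX by auto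
  have closed_im: "closedin X (g ` S)" if "S \<subseteq> {0..1}" "compact S" for S
  proof -
    have "compactin (top_of_set {0..1}) S" using that by (simp add: compactin_subtopology)
    then have "compactin X (g ` S)" by (rule image_compactin[OF _ contg])
    then show ?thesis by (rule compactin_imp_closedin[OF hausX])
  qed
  have noF: "g r \<notin> F" if "r \<in> {0<..<1}" "r \<notin> {t1, t2, t3}" for r
    using that t(1) by (auto simp: T_def)
  have sub01: "{fst i<..<snd i} \<subseteq> {0<..<1} - {t1, t2, t3}" if "i \<in> I" for i
    using that t t01 by (auto simp: I_def)
  have EY: "?E i \<subseteq> C - F" if "i \<in> I" for i
  proof
    fix p assume "p \<in> ?E i"
    then obtain r where r: "r \<in> {fst i<..<snd i}" "p = g r" by blast
    then have "r \<in> {0<..<1} - {t1, t2, t3}" using sub01[OF that] by blast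
    then show "p \<in> C - F" using noF[of r] r(2) g(2) by auto
  qed
  have cases: "\<exists>i\<in>I. r \<in> {fst i<..<snd i}" if "r \<in> {0<..<1}" "r \<notin> {t1, t2, t3}" for r
    using that t t01 unfolding I_def by (auto; linarith)
  have cover: "(\<Union>i\<in>I. ?E i) = C - F"
  proof (intro subset_antisym)
    show "C - F \<subseteq> (\<Union>i\<in>I. ?E i)"
    proof
      fix p assume p: "p \<in> C - F"
      then obtain r where r: "r \<in> {0..1}" "p = g r" using g(2) by blast
      have "r \<noteq> 0" "r \<noteq> 1" "r \<notin> {t1, t2, t3}" using p r(2) FF g(3,4) by auto
      then obtain i where "i \<in> I" "r \<in> {fst i<..<snd i}" using cases[of r] r(1) by auto
      then show "p \<in> (\<Union>i\<in>I. ?E i)" using r(2) by blast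
    qed
  qed (use EY in blast)
  have disj: "?E i \<inter> ?E j = {}" if "i \<in> I" "j \<in> I" "i \<noteq> j" for i j
  proof -
    have d: "{fst i<..<snd i} \<inter> {fst j<..<snd j} = {}" using that t t01 by (auto simp: I_def)
    show ?thesis
    proof (rule ccontr)
      assume "?E i \<inter> ?E j \<noteq> {}"
      then obtain p where p: "p \<in> ?E i" "p \<in> ?E j" by blast
      obtain r where r1: "r \<in> {fst i<..<snd i}" "p = g r" using p(1) by blast
      obtain r' where r2: "r' \<in> {fst j<..<snd j}" "p = g r'" using p(2) by blast
      note r = r1(1) r2(1) r1(2)[unfolded r2(2), symmetric]
      then have "r = r'" using sub01[OF that(1)] sub01[OF that(2)] by (intro ginj) auto
      then show False using d r by auto
    qed
  qed
  have E_open: "openin ?Y (?E i)" if i: "i \<in> I" for i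
  proof -
    let ?R = "{0..fst i} \<union> {snd i..1}"
    have "closedin X (g ` ?R)" using Iprop[OF i] by (intro closed_im) auto
    then have "openin ?Y ((C - F) \<inter> (topspace X - g ` ?R))"
      by (intro openin_subtopology_Int2 openin_diff) auto
    moreover have "(C - F) \<inter> (topspace X - g ` ?R) = ?E i"
    proof (intro subset_antisym subsetI)
      fix p assume p: "p \<in> (C - F) \<inter> (topspace X - g ` ?R)"
      then obtain r where r: "r \<in> {0..1}" "p = g r" using g(2) by blast
      then have "r \<notin> ?R" using p by blast
      then show "p \<in> ?E i" using r by auto
    next
      fix p assume p: "p \<in> ?E i"
      then obtain r where r: "r \<in> {fst i<..<snd i}" "p = g r" by blast
      have "p \<notin> g ` ?R"
      proof
        assume "p \<in> g ` ?R"
        then obtain r' where "r' \<in> ?R" "p = g r'" by blast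
        then have "g r' = g r" using r(2) by simp
        have "r \<in> {0<..<1}" using sub01[OF i] r by blast
        moreover have "r' \<in> {0..1}" using \<open>r' \<in> ?R\<close> Iprop[OF i] by auto
        ultimately have "r' = r" using \<open>g r' = g r\<close> by (intro ginj)
        then show False using \<open>r' \<in> ?R\<close> r by auto
      qed
      then show "p \<in> (C - F) \<inter> (topspace X - g ` ?R)" using EY[OF i] p CX by blast
    qed
    ultimately show ?thesis by simp
  qed
  have E_conn: "connectedin ?Y (?E i)" if i: "i \<in> I" for i
  proof -
    have "connectedin (top_of_set {0..1}) {fst i<..<snd i}"
      using Iprop[OF i] by (auto simp: connectedin_subtopology)
    then have "connectedin X (?E i)" by (rule connectedin_continuous_map_image[OF contg])
    then show ?thesis using EY[OF i] by (simp add: connectedin_subtopology)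
  qed
  have comps: "connected_components_of ?Y = ?E ` I"
  proof (rule connected_components_of_partition)
    have "?E i \<noteq> {}" if "i \<in> I" for i using Iprop(2)[OF that] by simp
    then show "{} \<notin> ?E ` I" by blast
    show "\<Union>(?E ` I) = topspace ?Y" unfolding tY by (rule cover)
    fix U V assume "U \<in> ?E ` I" "V \<in> ?E ` I" "U \<noteq> V"
    then show "U \<inter> V = {}" using disj by blast
  qed (use E_open E_conn in auto)
  have clos: "X closure_of (?E i) = g ` {fst i..snd i}" if i: "i \<in> I" for i
  proof (rule subset_antisym)
    show "X closure_of (?E i) \<subseteq> g ` {fst i..snd i}"
    proof (rule closure_of_minimal)
      show "closedin X (g ` {fst i..snd i})" using Iprop[OF i] by (intro closed_im) auto
    qed auto
    have "{fst i..snd i} \<subseteq> top_of_set {0..1} closure_of {fst i<..<snd i}"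
    proof -
      have "top_of_set {0..1} closure_of {fst i<..<snd i} = {0..1} \<inter> closure ({0..1} \<inter> {fst i<..<snd i})"
        by (simp add: closure_of_subtopology)
      moreover have "{0..1} \<inter> {fst i<..<snd i} = {fst i<..<snd i}" using Iprop[OF i] by auto
      ultimately show ?thesis using Iprop[OF i] by auto
    qed
    then have "g ` {fst i..snd i} \<subseteq> g ` (top_of_set {0..1} closure_of {fst i<..<snd i})" by (rule image_mono)
    also have "\<dots> \<subseteq> X closure_of (?E i)" by (rule continuous_map_image_closure_subset[OF contg])
    finally show "g ` {fst i..snd i} \<subseteq> X closure_of (?E i)" .
  qed
  have ZE: "ZE = (\<lambda>i. g ` {fst i..snd i}) ` I"
    unfolding ZE_def comps image_image using clos by (intro image_cong) auto
  have eZ: "g ` {0..t1} \<in> ZE" "g ` {t1..t2} \<in> ZE" "g ` {t2..t3} \<in> ZE" "g ` {t3..1} \<in> ZE"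
    unfolding ZE I_def by auto
  have dj: "g ` S \<inter> g ` S' = {}" if "S \<subseteq> {0..1}" "S' \<subseteq> {0<..<1}" "S \<inter> S' = {}" for S S'
  proof (rule ccontr)
    assume "g ` S \<inter> g ` S' \<noteq> {}"
    then obtain r r' where r: "r \<in> S" "r' \<in> S'" "g r = g r'" by auto
    then have "r = r'" using that by (intro ginj) auto
    then show False using r that(3) by blast
  qed
  \<comment> \<open>The arc from \<open>g t1\<close> to \<open>g t3\<close>, reparametrised over the
    unit interval.\<close>
  define h where "h = (\<lambda>s. g (t1 + s * (t3 - t1)))"
  define s where "s = (t2 - t1) / (t3 - t1)"
  have s01: "s \<in> {0..1}" using t by (auto simp: s_def divide_simps)
  have h: "h 0 = g t1" "h s = g t2" "h 1 = g t3" using t by (auto simp: h_def s_def)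
  have aff: "t1 + r * (t3 - t1) \<in> {t1..t3}" if "r \<in> {0..1}" for r
  proof -
    have "r * (t3 - t1) \<le> 1 * (t3 - t1)" using that t by (intro mult_right_mono) auto
    moreover have "0 \<le> r * (t3 - t1)" using that t by (intro mult_nonneg_nonneg) auto
    ultimately show ?thesis by auto
  qed
  have him: "h ` {0..1} \<subseteq> g ` {t1..t2} \<union> g ` {t2..t3}"
  proof (intro image_subsetI)
    fix r assume "r \<in> {0..1::real}"
    then have "t1 + r * (t3 - t1) \<in> {t1..t2} \<union> {t2..t3}" using aff[of r] by auto
    then show "h r \<in> g ` {t1..t2} \<union> g ` {t2..t3}" unfolding h_def by blast
  qed
  show ?thesis
  proof (rule that[of a h s])
    show "pathin X h" unfolding pathin_def h_def
    proof (rule continuous_map_compose[of _ "top_of_set {0..1}" "\<lambda>s. t1 + s * (t3 - t1)" X g, unfolded o_def])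
      show "continuous_map (top_of_set {0..1}) (top_of_set {0..1}) (\<lambda>s. t1 + s * (t3 - t1))"
        using aff t t01 by (force intro!: continuous_intros)
    qed (rule contg)
    show "h ` {0..1} \<subseteq> C"
    proof -
      have "g ` {t1..t2} \<union> g ` {t2..t3} \<subseteq> g ` {0..1}" using t t01 by (intro Un_least image_mono) auto
      then show ?thesis using him g(2) by blast
    qed
    show "h 0 \<in> F" "h s \<in> F" "h 1 \<in> F" unfolding h FF by auto
    show "h 0 \<noteq> h s" "h 0 \<noteq> h 1" "h s \<noteq> h 1"
      unfolding h using ginj[of t1 t2] ginj[of t1 t3] ginj[of t2 t3] t t01 by auto
    show "finite ZE" unfolding ZE I_def by simp
    show "\<forall>e\<in>ZE. closedin X e" unfolding ZE_def by simp
    show "\<forall>x\<in>h ` {0..1}. \<exists>e\<in>ZE. \<exists>e'\<in>ZE. e \<inter> e' = {} \<and> a \<in> e \<and> x \<in> e'"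
    proof
      fix x assume "x \<in> h ` {0..1}"
      then consider "x \<in> g ` {t1..t2}" | "x \<in> g ` {t2..t3}" using him by blast
      then show "\<exists>e\<in>ZE. \<exists>e'\<in>ZE. e \<inter> e' = {} \<and> a \<in> e \<and> x \<in> e'"
      proof cases
        case 1
        have "g ` {t3..1} \<inter> g ` {t1..t2} = {}" using t t01 by (intro dj) auto
        moreover have "a \<in> g ` {t3..1}" using g(4) t01 by (intro image_eqI[of _ _ 1]) auto
        ultimately show ?thesis using eZ 1 by blast
      next
        case 2
        have "g ` {0..t1} \<inter> g ` {t2..t3} = {}" using t t01 by (intro dj) auto
        moreover have "a \<in> g ` {0..t1}" using g(3) t01 by (intro image_eqI[of _ _ 0]) auto
        ultimately show ?thesis using eZ 2 by blast
      qed
    qed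
  qed (use a s01 in auto)
qed

subsection \<open>Growth of tile chains\<close>

text \<open>The constants and linear factors on both sides have n-th roots tending to 1, so a
  squeeze leaves \<open>lam\<close>.\<close>

lemma root_tendsto_growth_rate:
  fixes D :: "nat \<Rightarrow> real"
  assumes a: "a > 0" and B: "B > 0" and lam: "lam > 0"
    and low: "\<And>n. a * lam ^ n \<le> D n * (real n + 1)" and up: "\<And>n. D n \<le> B * (real n + 1) * lam ^ n"
  shows "(\<lambda>n. root n (D n)) \<longlonglongrightarrow> lam"
proof -
  have r1: "(\<lambda>n. root n (real n + 1)) \<longlonglongrightarrow> 1"
  proof (rule tendsto_sandwich)
    show "(\<lambda>n. root n (real n)) \<longlonglongrightarrow> 1" by (rule LIMSEQ_root)
    show "(\<lambda>n. root n 2 * root n (real n)) \<longlonglongrightarrow> 1"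
      using tendsto_mult[OF LIMSEQ_root_const[of 2] LIMSEQ_root] by simp
    show "eventually (\<lambda>n. root n (real n) \<le> root n (real n + 1)) sequentially"
      using eventually_gt_at_top[of 0] by eventually_elim simp
    show "eventually (\<lambda>n. root n (real n + 1) \<le> root n 2 * root n (real n)) sequentially"
      using eventually_gt_at_top[of 0]
    proof eventually_elim
      case (elim n)
      have "root n (real n + 1) \<le> root n (2 * real n)" using elim by simp
      then show ?case by (simp add: real_root_mult)
    qed
  qed
  have pw: "root n (lam ^ n) = lam" if "n > 0" for n using that lam by (simp add: real_root_power_cancel)
  show ?thesis
  proof (rule tendsto_sandwich)
    show "(\<lambda>n. root n a * lam / root n (real n + 1)) \<longlonglongrightarrow> lam"
      using tendsto_divide[OF tendsto_mult[OF LIMSEQ_root_const[OF a] tendsto_const[of lam]] r1] by simp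
    show "(\<lambda>n. root n B * root n (real n + 1) * lam) \<longlonglongrightarrow> lam"
      using tendsto_mult[OF tendsto_mult[OF LIMSEQ_root_const[OF B] r1] tendsto_const[of lam]] by simp
    show "eventually (\<lambda>n. root n a * lam / root n (real n + 1) \<le> root n (D n)) sequentially"
      using eventually_gt_at_top[of 0]
    proof eventually_elim
      case (elim n)
      have "root n (a * lam ^ n) \<le> root n (D n * (real n + 1))" using elim low by simp
      then have "root n a * lam \<le> root n (D n) * root n (real n + 1)" using pw[OF elim] by (simp add: real_root_mult)
      moreover have "root n (real n + 1) > 0" using elim by simp
      ultimately show ?case by (simp add: divide_le_eq)
    qed
    show "eventually (\<lambda>n. root n (D n) \<le> root n B * root n (real n + 1) * lam) sequentially"
      using eventually_gt_at_top[of 0]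
    proof eventually_elim
      case (elim n)
      have "root n (D n) \<le> root n (B * (real n + 1) * lam ^ n)" using elim up by simp
      then show ?case using pw[OF elim] by (simp add: real_root_mult)
    qed
  qed
qed

text \<open>Subtracting one member of the coset carries the others to lattice vectors of norm at
  most 2r, whose number is independent of \<open>x\<close> and \<open>w\<close>.\<close>

lemma lattice_coset_count:
  assumes L: "rank2_lattice L"
  obtains N where "\<And>x w. finite {z \<in> cball x r. z - w \<in> L}" "\<And>x w. card {z \<in> cball x r. z - w \<in> L} \<le> N"
proof -
  obtain u v where uv: "cross2 u v \<noteq> 0" and Leq: "L = {of_int m *\<^sub>R u + of_int n *\<^sub>R v | m n. True}"
    by (rule rank2_latticeE[OF L])
  have fin: "finite (L \<inter> cball 0 (2 * r))"
  proof -
    define k where "k = \<lceil>2 * \<bar>r\<bar> * (norm u + norm v) / \<bar>cross2 u v\<bar>\<rceil>"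
    have "L \<inter> cball 0 (2 * r) \<subseteq> (\<lambda>(m, n). of_int m *\<^sub>R u + of_int n *\<^sub>R v) ` ({-k..k} \<times> {-k..k})"
    proof
      fix l assume l: "l \<in> L \<inter> cball 0 (2 * r)"
      then obtain m n where mn: "l = of_int m *\<^sub>R u + of_int n *\<^sub>R v" unfolding Leq by blast
      have nl: "norm l \<le> 2 * \<bar>r\<bar>" using l by auto
      have bd: "\<bar>i\<bar> \<le> k" if "\<bar>of_int i * cross2 u v\<bar> \<le> norm l * (norm u + norm v)" for i
      proof -
        have "\<bar>of_int i\<bar> * \<bar>cross2 u v\<bar> \<le> 2 * \<bar>r\<bar> * (norm u + norm v)"
          using that order_trans[OF _ mult_right_mono[OF nl, of "norm u + norm v"]] by (simp add: abs_mult)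
        then have "real_of_int \<bar>i\<bar> \<le> 2 * \<bar>r\<bar> * (norm u + norm v) / \<bar>cross2 u v\<bar>"
          using uv by (simp add: pos_le_divide_eq)
        then show ?thesis unfolding k_def by linarith
      qed
      have "\<bar>cross2 l v\<bar> \<le> norm l * (norm u + norm v)"
        using abs_cross2_le[of l v] mult_left_mono[of "norm v" "norm u + norm v" "norm l"] by simp
      then have "\<bar>m\<bar> \<le> k" by (intro bd) (simp add: mn cross2_linear)
      moreover have "\<bar>cross2 u l\<bar> \<le> norm l * (norm u + norm v)"
        using abs_cross2_le[of u l] mult_left_mono[of "norm u" "norm u + norm v" "norm l"] by (simp add: mult.commute)
      then have "\<bar>n\<bar> \<le> k" by (intro bd) (simp add: mn cross2_linear)
      ultimately have "(m, n) \<in> {-k..k} \<times> {-k..k}" by auto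
      then show "l \<in> (\<lambda>(m, n). of_int m *\<^sub>R u + of_int n *\<^sub>R v) ` ({-k..k} \<times> {-k..k})"
        using mn by (intro image_eqI[of _ _ "(m, n)"]) auto
    qed
    then show ?thesis by (rule finite_subset) simp
  qed
  have "finite {z \<in> cball x r. z - w \<in> L} \<and> card {z \<in> cball x r. z - w \<in> L} \<le> card (L \<inter> cball 0 (2 * r))" for x w
  proof (cases "{z \<in> cball x r. z - w \<in> L} = {}")
    case True
    then show ?thesis by (simp only: finite.emptyI card.empty) simp
  next
    case False
    then obtain z0 where z0: "z0 \<in> cball x r" "z0 - w \<in> L" by blast
    have inj: "inj_on (\<lambda>z. z - z0) {z \<in> cball x r. z - w \<in> L}" by (rule inj_onI) simp
    have sub: "(\<lambda>z. z - z0) ` {z \<in> cball x r. z - w \<in> L} \<subseteq> L \<inter> cball 0 (2 * r)"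
    proof (rule image_subsetI)
      fix z assume "z \<in> {z \<in> cball x r. z - w \<in> L}"
      then have z: "dist x z \<le> r" "z - w \<in> L" by auto
      have "z - z0 \<in> L" using rank2_lattice_closed(3)[OF L z(2) z0(2)] by simp
      moreover have "norm (z - z0) \<le> 2 * r" using dist_triangle3[of z z0 x] z(1) z0(1) by (simp add: dist_norm)
      ultimately show "z - z0 \<in> L \<inter> cball 0 (2 * r)" by simp
    qed
    show ?thesis using finite_imageD[OF finite_subset[OF sub fin] inj] card_inj_on_le[OF inj sub fin] by simp
  qed
  then show ?thesis using that by blast
qed

lemma segment_cover:
  fixes x y :: "'b::real_normed_vector"
  obtains S where "finite S" "real (card S) \<le> dist x y + 3" "closed_segment x y \<subseteq> (\<Union>z\<in>S. cball z 1)"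
proof -
  \<comment> \<open>The number of intervals is positive even when \<open>x = y\<close>, and their
    length is at most 1. It is at most \<open>dist x y + 2\<close>, and there is one more node than
    intervals, whence the added 3.\<close>
  define m where "m = nat \<lceil>dist x y\<rceil> + 1"
  have m: "real m \<ge> dist x y" "real m \<le> dist x y + 2" "m > 0" unfolding m_def by (auto; linarith)+
  define S where "S = (\<lambda>i. x + (real i / real m) *\<^sub>R (y - x)) ` {0..m}"
  show ?thesis
  proof (rule that[of S])
    show "finite S" by (simp add: S_def)
    have "card S \<le> m + 1" unfolding S_def using card_image_le[of "{0..m}"] by simp
    then show "real (card S) \<le> dist x y + 3" using m(2) by linarith
    show "closed_segment x y \<subseteq> (\<Union>z\<in>S. cball z 1)"
    proof
      fix z assume "z \<in> closed_segment x y"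
      then obtain t where t: "0 \<le> t" "t \<le> 1" "z = (1 - t) *\<^sub>R x + t *\<^sub>R y" unfolding closed_segment_def by blast
      define i where "i = nat \<lfloor>t * real m\<rfloor>"
      have i: "real i \<le> t * real m" "t * real m \<le> real i + 1" using t(1) unfolding i_def by (auto; linarith)+
      have "t * real m \<le> real m" using mult_right_mono[of t 1 "real m"] t by simp
      then have im: "i \<le> m" using i(1) by linarith
      have "z - (x + (real i / real m) *\<^sub>R (y - x)) = (t - real i / real m) *\<^sub>R (y - x)"
        unfolding t(3) by (simp add: algebra_simps)
      then have "norm (z - (x + (real i / real m) *\<^sub>R (y - x))) = \<bar>t - real i / real m\<bar> * dist x y"
        by (simp add: dist_norm norm_minus_commute)
      also have "\<dots> \<le> (1 / real m) * real m"
      proof (rule mult_mono)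
        have eq: "t - real i / real m = (t * real m - real i) / real m" using m(3) by (simp add: diff_divide_distrib)
        have "\<bar>t * real m - real i\<bar> \<le> 1" using i by linarith
        then show "\<bar>t - real i / real m\<bar> \<le> 1 / real m" unfolding eq abs_divide by (simp add: divide_right_mono)
      qed (use m in auto)
      also have "\<dots> = 1" using m(3) by simp
      finally have "dist (x + (real i / real m) *\<^sub>R (y - x)) z \<le> 1" by (simp add: dist_norm norm_minus_commute)
      then show "z \<in> (\<Union>z\<in>S. cball z 1)" unfolding S_def using im by auto
    qed
  qed
qed

lemma finite_uniform_lower_bound:
  assumes "finite S" "\<And>p. p \<in> S \<Longrightarrow> \<exists>d>0::real. \<forall>x. Q p x \<longrightarrow> d \<le> F p x"
  obtains d where "d > 0" "\<And>p x. p \<in> S \<Longrightarrow> Q p x \<Longrightarrow> d \<le> F p x"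
proof -
  have "\<forall>p. \<exists>d. p \<in> S \<longrightarrow> d > 0 \<and> (\<forall>x. Q p x \<longrightarrow> d \<le> F p x)" using assms(2) by blast
  then obtain d where d: "\<And>p. p \<in> S \<Longrightarrow> d p > 0" "\<And>p x. p \<in> S \<Longrightarrow> Q p x \<Longrightarrow> d p \<le> F p x" by metis
  show ?thesis
  \<comment> \<open>The entry 1 keeps the minimum defined and positive when \<open>S\<close> is
    empty.\<close>
  proof (rule that[of "Min (insert 1 (d ` S))"])
    show "Min (insert 1 (d ` S)) > 0" using assms(1) d(1) by auto
    fix p x assume p: "p \<in> S" "Q p x"
    have "Min (insert 1 (d ` S)) \<le> d p" using assms(1) p by (intro Min_le) auto
    then show "Min (insert 1 (d ` S)) \<le> F p x" using d(2)[OF p] by linarith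
  qed
qed

section \<open>Expanding maps of a pillow, their tiles and chains of tiles\<close>

locale pillow_map = pillow +
  fixes \<A> :: "'a chart set" and f :: "'a \<Rightarrow> 'a" and A :: "real^2 \<Rightarrow> real^2" and b :: "real^2"
  assumes sphereX: "X homeomorphic_space top_of_set (sphere (0 :: real^3) 1)"
    and linA: "linear A" and detA: "det (matrix A) > 0" and expanding: "\<forall>k\<in>eigenvalues A. cmod k > 1"
    and f_P: "f (P x) = P (A x + b)"
    and post_eq: "post X \<A> f = (\<lambda>l. P ((1 / 2) *\<^sub>R l)) ` L" and card_post: "card (post X \<A> f) = 4"
begin

abbreviation "hmap \<equiv> (\<lambda>x. A x + b)"

lemma f_funpow_P: "(f ^^ n) (P x) = P ((hmap ^^ n) x)"
  by (induction n) (auto simp: f_P)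

lemma continuous_hmap: "continuous_on S (hmap ^^ n)"
proof (induction n)
  case (Suc n)
  have "continuous_on UNIV A" by (rule linear_continuous_on) (use linA in \<open>simp add: linear_conv_bounded_linear\<close>)
  from continuous_on_compose2[OF this Suc] show ?case by (auto intro!: continuous_intros)
qed (simp add: continuous_on_id)

lemma quotient_P: "quotient_map euclidean X P"
  using continuous_open_imp_quotient_map[OF contP openP] rangeP by simp

text \<open>Deck transformations are isometries preserving the preimage of \<open>e\<close>, so the
  distance to it descends to a function on the sphere.\<close>

lemma infdist_vimage_P:
  assumes "P x = P y"
  shows "infdist x (P -` e) = infdist y (P -` e)"
proof -
  obtain l \<epsilon> where le: "l \<in> L" "\<epsilon> = 1 \<or> \<epsilon> = -1" "y = l + \<epsilon> *\<^sub>R x" by (rule P_eqE[OF assms])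
  let ?g = "\<lambda>x. l + \<epsilon> *\<^sub>R x"
  have img: "?g ` (P -` e) = P -` e"
  proof (intro subset_antisym subsetI)
    fix z assume z: "z \<in> P -` e"
    have "z = ?g (\<epsilon> *\<^sub>R (z - l))" using le(2) by auto
    moreover have "P (\<epsilon> *\<^sub>R (z - l)) = P z" using P_deck[OF le(1,2), of "\<epsilon> *\<^sub>R (z - l)"] calculation by simp
    ultimately show "z \<in> ?g ` (P -` e)" using z by (metis imageI vimage_eq)
  qed (use P_deck[OF le(1,2)] in auto)
  have "dist (?g x) (?g a) = dist x a" for a using le(2) by (auto simp: dist_norm norm_minus_commute)
  then have "infdist (?g x) (?g ` (P -` e)) = infdist x (P -` e)"
    unfolding infdist_def by (simp add: image_image)
  then show ?thesis unfolding img le(3) by simp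
qed

text \<open>By invariance under \<open>L\<close> it is enough to bound the distance on a compact
  part of the preimage of \<open>e'\<close>, where it attains a positive minimum.\<close>

lemma disjoint_closed_separated:
  assumes e: "closedin X e" "e \<noteq> {}" "closedin X e'" "e \<inter> e' = {}"
  shows "\<exists>\<delta>>0. \<forall>x. P x \<in> e' \<longrightarrow> \<delta> \<le> infdist x (P -` e)"
proof -
  obtain \<rho> where r: "\<rho> > 0" "\<And>x. \<exists>l\<in>L. norm (x - l) \<le> \<rho>" by (rule rank2_lattice_cobounded[OF L]) blast
  have ne: "P -` e \<noteq> {}" using e(1,2) rangeP closedin_subset by (metis disjoint_iff image_iff inf.orderE vimage_eq ex_in_conv)
  have pos: "infdist x (P -` e) > 0" if "P x \<in> e'" for x
  proof -
    have "x \<notin> P -` e" using that e(4) by auto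
    then have "infdist x (P -` e) \<noteq> 0" using in_closed_iff_infdist_zero[OF closed_vimage_P[OF e(1)] ne] by blast
    then show ?thesis using infdist_nonneg[of x "P -` e"] by linarith
  qed
  define Q where "Q = P -` e' \<inter> cball 0 \<rho>"
  have cQ: "compact Q" unfolding Q_def using closed_vimage_P[OF e(3)] by (intro closed_Int_compact) auto
  have red: "\<exists>z\<in>Q. infdist z (P -` e) = infdist x (P -` e)" if x: "P x \<in> e'" for x
  proof -
    obtain l where l: "l \<in> L" "norm (x - l) \<le> \<rho>" using r(2) by blast
    have "P (x - l) = P x" using P_add[OF l(1), of "x - l"] by simp
    then show ?thesis using l(2) x infdist_vimage_P[of "x - l" x] by (intro bexI[of _ "x - l"]) (auto simp: Q_def)
  qed
  show ?thesis
  proof (cases "Q = {}")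
    case True
    then show ?thesis using red by (intro exI[of _ 1]) auto
  next
    case False
    have "\<exists>z\<in>Q. \<forall>x\<in>Q. infdist z (P -` e) \<le> infdist x (P -` e)"
      by (intro continuous_attains_inf cQ False continuous_intros)
    then obtain z where z: "z \<in> Q" "\<And>x. x \<in> Q \<Longrightarrow> infdist z (P -` e) \<le> infdist x (P -` e)" by blast
    show ?thesis
    proof (intro exI conjI allI impI)
      show "infdist z (P -` e) > 0" using pos z(1) by (auto simp: Q_def)
      fix x assume "P x \<in> e'"
      then obtain z' where "z' \<in> Q" "infdist z' (P -` e) = infdist x (P -` e)" using red by blast
      then show "infdist z (P -` e) \<le> infdist x (P -` e)" using z(2)[of z'] by simp
    qed
  qed
qed

text \<open>Images of components upstairs are open, connected and pairwise equal or
  disjoint.\<close>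

lemma connected_components_of_image:
  assumes S: "openin X S"
  shows "connected_components_of (subtopology X S) = (\<lambda>U. P ` U) ` components (P -` S)"
proof (rule connected_components_of_partition)
  have sub: "P ` U \<subseteq> S" if "U \<in> components (P -` S)" for U using in_components_subset[OF that] by blast
  have SX: "S \<subseteq> topspace X" using S by (rule openin_subset)
  show "openin (subtopology X S) V" if V: "V \<in> (\<lambda>U. P ` U) ` components (P -` S)" for V
  proof -
    obtain U where U: "U \<in> components (P -` S)" "V = P ` U" using V by blast
    show ?thesis unfolding U(2) openin_open_subtopology[OF S]
      using open_image_P[OF component_open[OF S U(1)]] sub[OF U(1)] by (rule conjI)
  qed
  show "connectedin (subtopology X S) V" if V: "V \<in> (\<lambda>U. P ` U) ` components (P -` S)" for V
  proof -
    obtain U where U: "U \<in> components (P -` S)" "V = P ` U" using V by blast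
    show ?thesis unfolding U(2) connectedin_subtopology
      using connected_image_P[OF in_components_connected[OF U(1)]] sub[OF U(1)] by (rule conjI)
  qed
  show "{} \<notin> (\<lambda>U. P ` U) ` components (P -` S)" using in_components_nonempty by fastforce
  show "V \<inter> W = {}" if VW: "V \<in> (\<lambda>U. P ` U) ` components (P -` S)" "W \<in> (\<lambda>U. P ` U) ` components (P -` S)" "V \<noteq> W" for V W
  proof (rule ccontr)
    assume ne: "V \<inter> W \<noteq> {}"
    obtain U U' where U: "U \<in> components (P -` S)" "V = P ` U" "U' \<in> components (P -` S)" "W = P ` U'" using VW by blast
    obtain x x' where x: "x \<in> U" "x' \<in> U'" "P x = P x'" using ne U by auto
    have "V \<subseteq> W" "W \<subseteq> V"
      unfolding U using component_image_subset[OF U(1,3) x] component_image_subset[OF U(3,1) x(2,1) x(3)[symmetric]] .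
    then show False using VW(3) by blast
  qed
  show "\<Union>((\<lambda>U. P ` U) ` components (P -` S)) = topspace (subtopology X S)"
  proof (intro subset_antisym subsetI)
    fix p assume "p \<in> topspace (subtopology X S)"
    then have p: "p \<in> S" "p \<in> range P" using rangeP by auto
    then obtain x where x: "p = P x" "x \<in> P -` S" by auto
    then obtain U where "U \<in> components (P -` S)" "x \<in> U" by (metis UnionE Union_components)
    then show "p \<in> \<Union>((\<lambda>U. P ` U) ` components (P -` S))" using x by blast
  next
    fix p assume "p \<in> \<Union>((\<lambda>U. P ` U) ` components (P -` S))"
    then show "p \<in> topspace (subtopology X S)" using sub SX by auto
  qed
qed

text \<open>\<open>K\<close> stands for a subset of the curve, in the application the arc through
  three corners; \<open>R\<close> bounds the displacement along paths whose image misses it. Both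
  are shared by all levels n.\<close>

context
  fixes C K R
  assumes C: "jordan_curve X C" and KC: "K \<subseteq> C"
    and RK: "\<And>p. path p \<Longrightarrow> P ` path_image p \<inter> K = {} \<Longrightarrow> dist (pathstart p) (pathfinish p) \<le> R"
begin

lemma path_outside_curve_bounded: "path p \<Longrightarrow> P ` path_image p \<inter> C = {} \<Longrightarrow> dist (pathstart p) (pathfinish p) \<le> R"
  using RK KC by blast

definition "Y n = {x \<in> topspace X. (f ^^ n) x \<notin> C}"

lemma closedin_C: "closedin X C"
proof -
  obtain H where "continuous_map (top_of_set (sphere (0 :: complex) 1)) X H" "H ` sphere 0 1 = C"
    using jordan_curveE[OF C] by blast
  moreover have "compactin (top_of_set (sphere (0::complex) 1)) (sphere 0 1)" by (simp add: compactin_subtopology)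
  ultimately have "compactin X C" using image_compactin by blast
  then show ?thesis by (rule compactin_imp_closedin[OF hausX])
qed

lemma vimage_Y: "P -` Y n = (hmap ^^ n) -` (- P -` C)"
  by (auto simp: Y_def f_funpow_P)

lemma openin_Y: "openin X (Y n)"
proof -
  have "open (P -` Y n)" unfolding vimage_Y
    using closed_vimage_P[OF closedin_C] continuous_hmap[of UNIV n] by (intro open_vimage) auto
  then have "openin X (P ` (P -` Y n))" by (rule open_image_P)
  moreover have "P ` (P -` Y n) = Y n" using rangeP by (auto simp: Y_def image_iff)
  ultimately show ?thesis by simp
qed

lemma tiles_eq: "tiles X f C n = (\<lambda>U. X closure_of (P ` U)) ` components (P -` Y n)"
  unfolding tiles_def Y_def[symmetric] connected_components_of_image[OF openin_Y] image_image ..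

text \<open>\<open>hmap ^^ n\<close> carries a path in the component to a path missing the preimage
  of the curve itself, so its end points are at most \<open>R\<close> apart, whatever n is.\<close>

lemma component_hmap_dist:
  assumes U: "U \<in> components (P -` Y n)" and x: "x \<in> U" "y \<in> U"
  shows "dist ((hmap ^^ n) x) ((hmap ^^ n) y) \<le> R"
proof -
  have "path_connected U"
    using component_open[OF openin_Y U] in_components_connected[OF U] connected_open_path_connected by blast
  then obtain p where p: "path p" "path_image p \<subseteq> U" "pathstart p = x" "pathfinish p = y"
    using x unfolding path_connected_def by blast
  let ?q = "(hmap ^^ n) \<circ> p"
  have "path ?q" using p(1) by (intro path_continuous_image continuous_hmap)
  moreover have "P ` path_image ?q \<inter> C = {}"
    using p(2) in_components_subset[OF U] unfolding vimage_Y path_image_compose by blast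
  ultimately show ?thesis using path_outside_curve_bounded[of ?q] p(3,4) by (simp add: pathstart_compose pathfinish_compose)
qed

text \<open>A disc missing the preimage of the complement would have an open image inside the curve,
  but the curve has empty interior.\<close>

lemma closure_components: "x \<in> closure (P -` Y 0)"
proof (rule ccontr)
  assume "x \<notin> closure (P -` Y 0)"
  then obtain e where e: "e > 0" "ball x e \<inter> P -` Y 0 = {}"
    by (metis closure_approachable disjoint_iff dist_commute mem_ball)
  have Y0: "Y 0 = topspace X - C" by (auto simp: Y_def)
  have "P ` ball x e \<inter> (topspace X - C) = {}" using e(2) Y0 by auto
  moreover have "openin X (P ` ball x e)" by (intro open_image_P) simp
  moreover have "P x \<in> P ` ball x e" using e(1) by simp
  ultimately have "P x \<notin> X closure_of (topspace X - C)" unfolding in_closure_of by blast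
  moreover have "P x \<in> C"
  proof (rule ccontr)
    assume "P x \<notin> C"
    then have "P x \<in> topspace X - C" by simp
    then show False using \<open>P ` ball x e \<inter> _ = {}\<close> \<open>P x \<in> P ` ball x e\<close> by blast
  qed
  ultimately show False using jordan_curve_complement(2)[OF sphereX C] by blast
qed

text \<open>Every component upstairs lies over one of finitely many components downstairs, so it
  contains a lift of the point chosen there; these lifts form two cosets of \<open>L\<close>. As
  components have bounded diameter, those near \<open>x\<close> have such a lift in a fixed disc,
  which holds boundedly many.\<close>

lemma finitely_many_components_near:
  obtains N where "\<forall>x. finite {U \<in> components (P -` Y 0). closure U \<inter> cball x 1 \<noteq> {}}"
    "\<forall>x. card {U \<in> components (P -` Y 0). closure U \<inter> cball x 1 \<noteq> {}} \<le> N"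
proof -
  have Y0: "Y 0 = topspace X - C" by (auto simp: Y_def)
  define VV where "VV = (\<lambda>U. P ` U) ` components (P -` Y 0)"
  have finV: "finite VV"
    using jordan_curve_complement(1)[OF sphereX C] unfolding Y0[symmetric] connected_components_of_image[OF openin_Y] VV_def .
  have "\<forall>V\<in>VV. \<exists>w. P w \<in> V" unfolding VV_def using in_components_nonempty by fastforce
  then obtain w where w: "\<And>V. V \<in> VV \<Longrightarrow> P (w V) \<in> V" by metis
  obtain N where N: "\<And>x w. finite {z \<in> cball x (R + 2). z - w \<in> L}" "\<And>x w. card {z \<in> cball x (R + 2). z - w \<in> L} \<le> N"
    by (rule lattice_coset_count[OF L]) blast
  \<comment> \<open>Radius \<open>R + 2\<close>: 1 for the disc, 1 for passing from the closure to
    the component, \<open>R\<close> across the component.\<close>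
  define Z where "Z = (\<lambda>x. \<Union>V\<in>VV. {z \<in> cball x (R + 2). z - w V \<in> L} \<union> {z \<in> cball x (R + 2). z - (- w V) \<in> L})"
  have finZ: "finite (Z x)" for x unfolding Z_def using finV N(1) by (intro finite_UN_I finite_UnI)
  have cardZ: "card (Z x) \<le> card VV * (2 * N)" for x
  proof -
    have "card (Z x) \<le> (\<Sum>V\<in>VV. card ({z \<in> cball x (R + 2). z - w V \<in> L} \<union> {z \<in> cball x (R + 2). z - (- w V) \<in> L}))"
      unfolding Z_def by (rule card_UN_le[OF finV])
    also have "\<dots> \<le> (\<Sum>V\<in>VV. 2 * N)"
    proof (rule sum_mono)
      fix V
      show "card ({z \<in> cball x (R + 2). z - w V \<in> L} \<union> {z \<in> cball x (R + 2). z - (- w V) \<in> L}) \<le> 2 * N"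
        using card_Un_le[of "{z \<in> cball x (R + 2). z - w V \<in> L}" "{z \<in> cball x (R + 2). z - (- w V) \<in> L}"]
          N(2)[of x "w V"] N(2)[of x "- w V"] by linarith
    qed
    finally show ?thesis by simp
  qed
  have pick: "\<exists>z. z \<in> U \<and> z \<in> Z x" if U: "U \<in> components (P -` Y 0)" "closure U \<inter> cball x 1 \<noteq> {}" for U x
  proof -
    have V: "P ` U \<in> VV" using U(1) by (auto simp: VV_def)
    obtain z where z: "z \<in> U" "P (w (P ` U)) = P z" using w[OF V] by auto
    obtain y where y: "y \<in> closure U" "dist x y \<le> 1" using U(2) by auto
    obtain u where u: "u \<in> U" "dist u y < 1" using y(1) unfolding closure_approachable by (metis zero_less_one)
    have "dist u z \<le> R" using component_hmap_dist[OF U(1) u(1) z(1)] by simp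
    then have "dist x z \<le> R + 2" using dist_triangle[of x z y] dist_triangle[of y z u] y(2) u(2) by (simp add: dist_commute)
    moreover have "z - w (P ` U) \<in> L \<or> z - (- w (P ` U)) \<in> L"
      using z(2) P_eq_iff[of z "w (P ` U)"] by simp
    ultimately have "z \<in> Z x" unfolding Z_def using V by auto
    then show ?thesis using z(1) by blast
  qed
  have main: "finite {U \<in> components (P -` Y 0). closure U \<inter> cball x 1 \<noteq> {}} \<and>
      card {U \<in> components (P -` Y 0). closure U \<inter> cball x 1 \<noteq> {}} \<le> card (Z x)" for x
  proof -
    let ?S = "{U \<in> components (P -` Y 0). closure U \<inter> cball x 1 \<noteq> {}}"
    have "\<forall>U\<in>?S. \<exists>z. z \<in> U \<and> z \<in> Z x" using pick by blast
    from bchoice[OF this] obtain z where z: "\<forall>U\<in>?S. z U \<in> U \<and> z U \<in> Z x" by (elim exE)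
    have inj: "inj_on z ?S"
    proof (rule inj_onI)
      fix U U' assume UU: "U \<in> ?S" "U' \<in> ?S" "z U = z U'"
      have "z U \<in> U" "z U' \<in> U'" using bspec[OF z UU(1)] bspec[OF z UU(2)] by blast+
      then have "U \<inter> U' \<noteq> {}" using UU(3) by auto
      then show "U = U'" using UU(1,2) components_nonoverlap[of U "P -` Y 0" U'] by blast
    qed
    have "z ` ?S \<subseteq> Z x" using z by blast
    then show ?thesis using finite_imageD[OF finite_subset[OF _ finZ[of x]] inj] card_inj_on_le[OF inj _ finZ[of x]] by blast
  qed
  show ?thesis
    by (rule that[of "card VV * (2 * N)"]) (use main cardZ order_trans in blast)+
qed

text \<open>Near \<open>x\<close> there are only finitely many components, so the closure of their
  union is the union of their closures; by density it contains \<open>x\<close>.\<close>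

lemma point_in_component_closure:
  obtains U where "U \<in> components (P -` Y 0)" "x \<in> closure U"
proof -
  have N: "finite {U \<in> components (P -` Y 0). closure U \<inter> cball x 1 \<noteq> {}}"
    by (rule finitely_many_components_near) blast
  let ?S = "{U \<in> components (P -` Y 0). closure U \<inter> cball x 1 \<noteq> {}}"
  have "x \<in> closure (\<Union>?S)"
    unfolding closure_approachable
  proof (intro allI impI)
    fix e :: real assume "e > 0"
    then obtain y where y: "y \<in> P -` Y 0" "dist y x < min e 1"
      using closure_components[of x] unfolding closure_approachable by (metis min_less_iff_conj zero_less_one)
    then obtain U where U: "U \<in> components (P -` Y 0)" "y \<in> U" by (metis UnionE Union_components)
    have "y \<in> closure U \<inter> cball x 1" using closure_subset[of U] U(2) y(2) by (auto simp: dist_commute)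
    then have "U \<in> ?S" using U(1) by blast
    then show "\<exists>y\<in>\<Union>?S. dist y x < e" using U(2) y(2) by auto
  qed
  moreover have "closure (\<Union>?S) \<subseteq> (\<Union>U\<in>?S. closure U)"
  proof (rule closure_minimal)
    show "\<Union>?S \<subseteq> (\<Union>U\<in>?S. closure U)" using closure_subset by blast
    show "closed (\<Union>U\<in>?S. closure U)" using N by (intro closed_UN) auto
  qed
  ultimately show ?thesis using that by blast
qed

text \<open>The distance to the lift of one edge descends to the sphere, is 0 somewhere on the chain
  and at least \<delta> elsewhere on it, and by connectedness takes all values between. On a single
  tile it varies by at most 2\<epsilon>.\<close>

lemma tile_chain_lower_bound:
  assumes T: "\<T> \<subseteq> tiles X f C n" "finite \<T>" "connectedin X (\<Union>\<T>)" "joins_opposite_sides X \<A> f C (\<Union>\<T>)"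
    and delta: "\<delta> > 0" "\<And>e e' x. e \<in> zero_edges X \<A> f C \<Longrightarrow> e' \<in> zero_edges X \<A> f C \<Longrightarrow> e \<inter> e' = {} \<Longrightarrow> e \<noteq> {} \<Longrightarrow>
      P x \<in> e' \<Longrightarrow> \<delta> \<le> infdist x (P -` e)"
    and eps: "\<And>U x y. U \<in> components (P -` Y n) \<Longrightarrow> x \<in> U \<Longrightarrow> y \<in> U \<Longrightarrow> dist x y \<le> \<epsilon>"
  shows "\<delta> \<le> 2 * real (card \<T>) * \<epsilon>"
proof -
  obtain e e' where e: "e \<in> zero_edges X \<A> f C" "e' \<in> zero_edges X \<A> f C" "e \<inter> e' = {}"
    "\<Union>\<T> \<inter> e \<noteq> {}" "\<Union>\<T> \<inter> e' \<noteq> {}"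
    using T(4) card_post unfolding joins_opposite_sides_def by auto
  define \<psi> where "\<psi> = (\<lambda>q. infdist (SOME x. P x = q) (P -` e))"
  have psi: "\<psi> (P x) = infdist x (P -` e)" for x
    unfolding \<psi>_def by (rule infdist_vimage_P) (rule someI[of _ x], rule refl)
  have "\<psi> \<circ> P = (\<lambda>x. infdist x (P -` e))" by (simp add: fun_eq_iff psi)
  moreover have "continuous_map euclidean euclideanreal (\<lambda>x. infdist x (P -` e))"
    by (auto intro!: continuous_intros)
  ultimately have cpsi: "continuous_map X euclideanreal \<psi>"
    using continuous_compose_quotient_map_eq[OF quotient_P, of euclideanreal \<psi>] by simp
  have "connectedin euclideanreal (\<psi> ` \<Union>\<T>)" by (rule connectedin_continuous_map_image[OF cpsi T(3)])
  then have conn: "connected (\<psi> ` \<Union>\<T>)" by simp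
  have TX: "\<Union>\<T> \<subseteq> topspace X" using T(3) connectedin_subset_topspace by blast
  obtain q0 where q0: "q0 \<in> \<Union>\<T>" "q0 \<in> e" using e(4) by blast
  then have "q0 \<in> range P" using TX rangeP by blast
  then obtain x0 where "q0 = P x0" by blast
  then have x0: "P x0 \<in> \<Union>\<T>" "P x0 \<in> e" using q0 by blast+
  obtain q1 where q1: "q1 \<in> \<Union>\<T>" "q1 \<in> e'" using e(5) by blast
  then have "q1 \<in> range P" using TX rangeP by blast
  then obtain x1 where "q1 = P x1" by blast
  then have x1: "P x1 \<in> \<Union>\<T>" "P x1 \<in> e'" using q1 by blast+
  have p0: "\<psi> (P x0) = 0" unfolding psi using x0(2) by simp
  have "e \<noteq> {}" using x0 by blast
  then have p1: "\<psi> (P x1) \<ge> \<delta>" unfolding psi using delta(2)[OF e(1,2,3)] x1(2) by blast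
  have "{\<psi> (P x0)..\<psi> (P x1)} \<subseteq> \<psi> ` \<Union>\<T>"
    by (rule connected_contains_Icc[OF conn]) (use x0 x1 in blast)+
  then have Icc: "{0..\<delta>} \<subseteq> \<psi> ` \<Union>\<T>" using p0 p1 by auto
  define k where "k = card \<T>"
  have "\<T> \<noteq> {}" using x0 by auto
  then have k: "k > 0" using T(2) by (simp add: k_def card_gt_0_iff)
  have small: "\<bar>\<psi> p - \<psi> p'\<bar> \<le> 2 * \<epsilon>" if t: "t \<in> \<T>" "p \<in> t" "p' \<in> t" for t p p'
  proof -
    obtain U where U: "U \<in> components (P -` Y n)" "t = X closure_of (P ` U)" using t(1) T(1) tiles_eq by blast
    obtain z where z: "z \<in> U" using in_components_nonempty[OF U(1)] by blast
    have "\<psi> ` P ` U \<subseteq> cball (\<psi> (P z)) \<epsilon>"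
    proof (intro image_subsetI)
      fix q assume "q \<in> P ` U"
      then obtain x where x: "x \<in> U" "q = P x" by blast
      have "\<bar>infdist z (P -` e) - infdist x (P -` e)\<bar> \<le> dist z x" by (rule infdist_triangle_abs)
      also have "\<dots> \<le> \<epsilon>" using eps[OF U(1) z x(1)] .
      finally show "\<psi> q \<in> cball (\<psi> (P z)) \<epsilon>" unfolding x(2) psi by (simp add: dist_real_def)
    qed
    then have "closure (\<psi> ` P ` U) \<subseteq> cball (\<psi> (P z)) \<epsilon>" by (rule closure_minimal) simp
    moreover have "\<psi> ` t \<subseteq> closure (\<psi> ` P ` U)"
      using continuous_map_image_closure_subset[OF cpsi, of "P ` U"] unfolding U(2) by simp
    ultimately have "\<psi> p \<in> cball (\<psi> (P z)) \<epsilon>" "\<psi> p' \<in> cball (\<psi> (P z)) \<epsilon>" using t(2,3) by blast+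
    then have "\<bar>\<psi> (P z) - \<psi> p\<bar> \<le> \<epsilon>" "\<bar>\<psi> (P z) - \<psi> p'\<bar> \<le> \<epsilon>" by (simp_all add: dist_real_def)
    then show ?thesis by linarith
  qed
  \<comment> \<open>k + 1 equally spaced values occur on k tiles, so two of them, at least
    \<delta>/k apart, occur on the same tile.\<close>
  have "\<forall>i\<in>{0..k}. \<exists>tp. fst tp \<in> \<T> \<and> snd tp \<in> fst tp \<and> \<psi> (snd tp) = real i * \<delta> / real k"
  proof
    fix i assume i: "i \<in> {0..k}"
    have "real i * \<delta> \<le> real k * \<delta>" using i delta(1) by (intro mult_right_mono) auto
    then have "real i * \<delta> / real k \<in> {0..\<delta>}" using delta(1) k by (simp add: pos_divide_le_eq mult.commute)
    then obtain p where "p \<in> \<Union>\<T>" "\<psi> p = real i * \<delta> / real k" using Icc by (metis imageE subsetD)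
    then obtain t where "t \<in> \<T>" "p \<in> t" by blast
    then show "\<exists>tp. fst tp \<in> \<T> \<and> snd tp \<in> fst tp \<and> \<psi> (snd tp) = real i * \<delta> / real k"
      using \<open>\<psi> p = _\<close> by (intro exI[of _ "(t, p)"]) simp
  qed
  from bchoice[OF this] obtain F where F: "\<forall>i\<in>{0..k}. fst (F i) \<in> \<T> \<and> snd (F i) \<in> fst (F i) \<and> \<psi> (snd (F i)) = real i * \<delta> / real k"
    by (elim exE)
  have "card ((\<lambda>i. fst (F i)) ` {0..k}) \<le> k" unfolding k_def by (rule card_mono[OF T(2)]) (use F k_def in auto)
  then have "\<not> inj_on (\<lambda>i. fst (F i)) {0..k}" by (intro pigeonhole) simp
  then obtain i j where ij: "i \<in> {0..k}" "j \<in> {0..k}" "i \<noteq> j" "fst (F i) = fst (F j)" unfolding inj_on_def by blast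
  have "\<bar>\<psi> (snd (F i)) - \<psi> (snd (F j))\<bar> \<le> 2 * \<epsilon>"
    using small[of "fst (F i)" "snd (F i)" "snd (F j)"] F ij by metis
  moreover have "\<psi> (snd (F i)) - \<psi> (snd (F j)) = (real i - real j) * (\<delta> / real k)"
    using F ij(1,2) by (simp add: diff_divide_distrib left_diff_distrib)
  moreover have "\<bar>(real i - real j) * (\<delta> / real k)\<bar> \<ge> 1 * (\<delta> / real k)"
    unfolding abs_mult using ij(3) delta(1) by (intro mult_mono) auto
  ultimately have "\<delta> / real k \<le> 2 * \<epsilon>" by linarith
  then have "\<delta> \<le> 2 * \<epsilon> * real k" using k by (simp add: pos_divide_le_eq)
  then show ?thesis by (simp add: k_def mult_ac)
qed

text \<open>The affine map \<open>hmap ^^ n\<close> takes the segment to one of length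
  \<open>norm ((A ^^ n) w)\<close>, covered by a comparable number of unit discs. The level-0
  components whose closures meet it are pulled back to level n; each resulting tile meets the image
  of the original segment, which ties the chain together.\<close>

lemma segment_tile_chain:
  assumes Ai: "linear Ai" "\<And>x. A (Ai x) = x" "\<And>x. Ai (A x) = x"
    and N: "\<And>x. finite {U \<in> components (P -` Y 0). closure U \<inter> cball x 1 \<noteq> {}}"
      "\<And>x. card {U \<in> components (P -` Y 0). closure U \<inter> cball x 1 \<noteq> {}} \<le> N"
    and e: "e \<in> zero_edges X \<A> f C" "e' \<in> zero_edges X \<A> f C" "e \<inter> e' = {}" "P c1 \<in> e" "P (c1 + w) \<in> e'"
  obtains \<T> where "\<T> \<subseteq> tiles X f C n" "finite \<T>" "real (card \<T>) \<le> (norm ((A ^^ n) w) + 3) * real N"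
    "connectedin X (\<Union>\<T>)" "joins_opposite_sides X \<A> f C (\<Union>\<T>)"
proof -
  let ?h = "hmap ^^ n"
  have linAn: "linear (A ^^ n)" and linAin: "linear (Ai ^^ n)" using funpow_linear linA Ai(1) by blast+
  have hA: "?h x = (A ^^ n) x + ?h 0" for x
    using affine_funpow_diff[OF linA, of n b x 0] by (simp add: algebra_simps)
  have AAi: "(A ^^ n) ((Ai ^^ n) x) = x" "(Ai ^^ n) ((A ^^ n) x) = x" for x
  proof -
    show "(A ^^ n) ((Ai ^^ n) x) = x"
    proof (induction n arbitrary: x)
      case (Suc n)
      have "(A ^^ Suc n) ((Ai ^^ Suc n) x) = A ((A ^^ n) ((Ai ^^ n) (Ai x)))" by (simp only: funpow.simps(2) o_apply) (simp only: funpow_swap1)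
      then show ?case using Suc Ai by simp
    qed simp
    show "(Ai ^^ n) ((A ^^ n) x) = x"
    proof (induction n arbitrary: x)
      case (Suc n)
      have "(Ai ^^ Suc n) ((A ^^ Suc n) x) = Ai ((Ai ^^ n) ((A ^^ n) (A x)))" by (simp only: funpow.simps(2) o_apply) (simp only: funpow_swap1)
      then show ?case using Suc Ai by simp
    qed simp
  qed
  define k where "k = (\<lambda>y. (Ai ^^ n) (y - ?h 0))"
  have kh: "k (?h x) = x" and hk: "?h (k x) = x" for x
  proof -
    show "k (?h x) = x" unfolding k_def by (subst hA) (simp add: AAi)
    show "?h (k x) = x" by (subst hA) (simp add: k_def AAi)
  qed
  have ck: "continuous_on S k" for S
    unfolding k_def
    by (intro continuous_on_compose2[OF linear_continuous_on[of "Ai ^^ n" UNIV]] continuous_intros)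
      (use linAin in \<open>auto simp: linear_conv_bounded_linear\<close>)
  define y1 y2 where "y1 = ?h c1" and "y2 = ?h (c1 + w)"
  have y2: "y2 - y1 = (A ^^ n) w" unfolding y1_def y2_def using affine_funpow_diff[OF linA, of n b "c1 + w" c1] by simp
  let ?seg = "closed_segment c1 (c1 + w)"
  have hseg: "?h z \<in> closed_segment y1 y2 \<longleftrightarrow> z \<in> ?seg" for z
  proof -
    have aff: "?h ((1 - t) *\<^sub>R c1 + t *\<^sub>R (c1 + w)) = (1 - t) *\<^sub>R y1 + t *\<^sub>R y2" for t
      unfolding y1_def y2_def hA[of "(1 - t) *\<^sub>R c1 + t *\<^sub>R (c1 + w)"] hA[of c1] hA[of "c1 + w"]
      by (simp add: linear_add[OF linAn] linear_scale[OF linAn] algebra_simps)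
    show ?thesis
    proof
      assume "?h z \<in> closed_segment y1 y2"
      then obtain t where t: "0 \<le> t" "t \<le> 1" "?h z = (1 - t) *\<^sub>R y1 + t *\<^sub>R y2" unfolding closed_segment_def by blast
      then have "k (?h z) = k (?h ((1 - t) *\<^sub>R c1 + t *\<^sub>R (c1 + w)))" unfolding aff by simp
      then have "z = (1 - t) *\<^sub>R c1 + t *\<^sub>R (c1 + w)" unfolding kh .
      then show "z \<in> ?seg" using t(1,2) unfolding closed_segment_def by blast
    next
      assume "z \<in> ?seg"
      then obtain t where "0 \<le> t" "t \<le> 1" "z = (1 - t) *\<^sub>R c1 + t *\<^sub>R (c1 + w)" unfolding closed_segment_def by blast
      then show "?h z \<in> closed_segment y1 y2" using aff[of t] unfolding closed_segment_def by blast
    qed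
  qed
  obtain S where S: "finite S" "real (card S) \<le> dist y1 y2 + 3" "closed_segment y1 y2 \<subseteq> (\<Union>z\<in>S. cball z 1)"
    by (rule segment_cover)
  define UU where "UU = (\<Union>s\<in>S. {U \<in> components (P -` Y 0). closure U \<inter> cball s 1 \<noteq> {}})"
  have finUU: "finite UU" unfolding UU_def using S(1) N(1) by (intro finite_UN_I)
  have cardUU: "card UU \<le> card S * N"
  proof -
    have "card UU \<le> (\<Sum>s\<in>S. card {U \<in> components (P -` Y 0). closure U \<inter> cball s 1 \<noteq> {}})"
      unfolding UU_def by (rule card_UN_le[OF S(1)])
    also have "\<dots> \<le> (\<Sum>s\<in>S. N)" by (intro sum_mono N(2))
    finally show ?thesis by simp
  qed
  \<comment> \<open>Only components whose closure meets the segment itself are kept, so that every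
    tile is attached to its image; the larger \<open>UU\<close> serves for counting.\<close>
  define VV where "VV = {U \<in> UU. closure U \<inter> closed_segment y1 y2 \<noteq> {}}"
  have VU: "VV \<subseteq> UU" and VC: "\<And>U. U \<in> VV \<Longrightarrow> U \<in> components (P -` Y 0)" by (auto simp: VV_def UU_def)
  have "\<forall>U\<in>VV. \<exists>U'. U' \<in> components (P -` Y n) \<and> k ` U \<subseteq> U'"
  proof
    fix U assume "U \<in> VV"
    then have U: "U \<in> components (P -` Y 0)" by (rule VC)
    have sub: "k ` U \<subseteq> P -` Y n"
    proof (rule image_subsetI)
      fix u assume "u \<in> U"
      then have "u \<in> P -` Y 0" using in_components_subset[OF U] by blast
      then show "k u \<in> P -` Y n" unfolding vimage_Y using hk by simp
    qed
    have "k ` U \<noteq> {}" using in_components_nonempty[OF U] by blast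
    then have "P -` Y n \<noteq> {}" using sub by blast
    moreover have "connected (k ` U)" using in_components_connected[OF U] by (intro connected_continuous_image ck)
    ultimately show "\<exists>U'. U' \<in> components (P -` Y n) \<and> k ` U \<subseteq> U'" using exists_component_superset[OF sub] by blast
  qed
  from bchoice[OF this] obtain \<tau> where tau: "\<forall>U\<in>VV. \<tau> U \<in> components (P -` Y n) \<and> k ` U \<subseteq> \<tau> U" by (elim exE)
  define tl where "tl = (\<lambda>U. X closure_of (P ` \<tau> U))"
  have meet: "P z \<in> tl U" if U: "U \<in> VV" "?h z \<in> closure U" for z U
  proof -
    have "k ` closure U \<subseteq> closure (\<tau> U)"
      by (rule image_closure_subset[OF ck closed_closure]) (use bspec[OF tau U(1)] closure_subset in blast)
    then have "z \<in> closure (\<tau> U)" using U(2) kh by (metis imageI subsetD)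
    then show ?thesis unfolding tl_def
      using continuous_map_image_closure_subset[OF contP, of "\<tau> U"] by auto
  qed
  define \<T> where "\<T> = tl ` VV"
  have cov: "P ` ?seg \<subseteq> \<Union>\<T>"
  proof (rule image_subsetI)
    fix z assume z: "z \<in> ?seg"
    obtain U where U: "U \<in> components (P -` Y 0)" "?h z \<in> closure U" by (rule point_in_component_closure)
    have hz: "?h z \<in> closed_segment y1 y2" using hseg z by blast
    then obtain s where s: "s \<in> S" "?h z \<in> cball s 1" using S(3) by blast
    then have "U \<in> VV" unfolding VV_def UU_def using U hz by blast
    then show "P z \<in> \<Union>\<T>" unfolding \<T>_def using meet U(2) by blast
  qed
  have TV: "\<exists>U\<in>VV. t = tl U" if "t \<in> \<T>" for t using that by (auto simp: \<T>_def)
  have connseg: "connectedin X (P ` ?seg)" by (intro connected_image_P connected_segment)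
  have conn1: "connectedin X (P ` ?seg \<union> t)" if t: "t \<in> \<T>" for t
  proof -
    obtain U where U: "U \<in> VV" "t = tl U" using TV[OF t] by blast
    have "connectedin X t" unfolding U(2) tl_def
      using bspec[OF tau U(1)] by (intro connectedin_closure_of connected_image_P) (auto dest: in_components_connected)
    moreover obtain y where y: "y \<in> closure U" "y \<in> closed_segment y1 y2" using U(1) by (auto simp: VV_def)
    have "k y \<in> ?seg" using hseg[of "k y"] y(2) hk by simp
    moreover have "P (k y) \<in> t" unfolding U(2) using meet[OF U(1), of "k y"] y(1) hk by simp
    ultimately show ?thesis by (intro connectedin_Un connseg) auto
  qed
  have c1seg: "P c1 \<in> P ` ?seg" "P (c1 + w) \<in> P ` ?seg" by auto
  then have Tne: "\<T> \<noteq> {}" using cov by auto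
  \<comment> \<open>Each tile is joined with the image of the segment, a common connected part that
    the tiles already cover.\<close>
  have "connectedin X (\<Union>((\<lambda>t. P ` ?seg \<union> t) ` \<T>))"
  proof (rule connectedin_Union)
    show "\<Inter>((\<lambda>t. P ` ?seg \<union> t) ` \<T>) \<noteq> {}" using c1seg(1) by blast
  qed (use conn1 in blast)
  moreover have "\<Union>((\<lambda>t. P ` ?seg \<union> t) ` \<T>) = \<Union>\<T>" using cov Tne by blast
  ultimately have connT: "connectedin X (\<Union>\<T>)" by simp
  show ?thesis
  proof (rule that[of \<T>])
    show "\<T> \<subseteq> tiles X f C n" unfolding tiles_eq \<T>_def tl_def using tau by blast
    show "finite \<T>" unfolding \<T>_def using finite_subset[OF VU finUU] by simp
    have "card \<T> \<le> card VV" unfolding \<T>_def using finite_subset[OF VU finUU] by (rule card_image_le)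
    also have "\<dots> \<le> card UU" by (rule card_mono[OF finUU VU])
    also have "\<dots> \<le> card S * N" by (rule cardUU)
    finally have "real (card \<T>) \<le> real (card S) * real N" by (metis of_nat_le_iff of_nat_mult)
    also have "\<dots> \<le> (dist y1 y2 + 3) * real N" using S(2) by (intro mult_right_mono) auto
    also have "dist y1 y2 = norm ((A ^^ n) w)" unfolding y2[symmetric] by (simp add: dist_norm norm_minus_commute)
    finally show "real (card \<T>) \<le> (norm ((A ^^ n) w) + 3) * real N" .
    have "P c1 \<in> \<Union>\<T>" "P (c1 + w) \<in> \<Union>\<T>" using cov c1seg by blast+
    then have "\<Union>\<T> \<inter> e \<noteq> {}" "\<Union>\<T> \<inter> e' \<noteq> {}" using e(4,5) by blast+
    then have "\<exists>e\<in>zero_edges X \<A> f C. \<exists>e'\<in>zero_edges X \<A> f C. e \<inter> e' = {} \<and> \<Union>\<T> \<inter> e \<noteq> {} \<and> \<Union>\<T> \<inter> e' \<noteq> {}"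
      using e(1,2,3) by blast
    then show "joins_opposite_sides X \<A> f C (\<Union>\<T>)"
      unfolding joins_opposite_sides_def using card_post by simp
  qed (rule connT)
qed

end

lemma min_tiles_growth:
  assumes C: "jordan_curve X C" and postC: "post X \<A> f \<subseteq> C"
  shows "(\<lambda>n. root n (real (min_tiles X \<A> f C n))) \<longlonglongrightarrow> Min (cmod ` eigenvalues A)"
proof -
  let ?F = "post X \<A> f"
  obtain a g s where a: "a \<in> ?F" and g: "pathin X g" "g ` {0..1} \<subseteq> C" and s: "s \<in> {0..1}"
    and gF: "g 0 \<in> ?F" "g s \<in> ?F" "g 1 \<in> ?F" and gne: "g 0 \<noteq> g s" "g 0 \<noteq> g 1" "g s \<noteq> g 1"
    and opp: "\<forall>x\<in>g ` {0..1}. \<exists>e\<in>zero_edges X \<A> f C. \<exists>e'\<in>zero_edges X \<A> f C. e \<inter> e' = {} \<and> a \<in> e \<and> x \<in> e'"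
    and ZE: "finite (zero_edges X \<A> f C)" "\<forall>e\<in>zero_edges X \<A> f C. closedin X e"
    using jordan_curve_corners[OF C hausX postC card_post] unfolding zero_edges_def .
  obtain l0 where l0: "l0 \<in> L" "g 0 = P ((1 / 2) *\<^sub>R l0)" using gF(1) unfolding post_eq by blast
  obtain l1 where l1: "l1 \<in> L" "g s = P ((1 / 2) *\<^sub>R l1)" using gF(2) unfolding post_eq by blast
  obtain l2 where l2: "l2 \<in> L" "g 1 = P ((1 / 2) *\<^sub>R l2)" using gF(3) unfolding post_eq by blast
  obtain R where R: "\<And>p. path p \<Longrightarrow> P ` path_image p \<inter> g ` {0..1} = {} \<Longrightarrow> dist (pathstart p) (pathfinish p) \<le> R"
    by (rule complement_of_corner_path_bounded[OF g(1) s _ l0(1) l1(1) l2(1) l0(2) l1(2) l2(2) gne]) auto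
  note ctx = C g(2) R
  obtain Ai c v where Ai: "linear Ai" "\<And>x. A (Ai x) = x" "\<And>x. Ai (A x) = x" and c: "c > 0" and v: "v \<noteq> 0"
    and lam0: "Min (cmod ` eigenvalues A) > 0" and lamin: "Min (cmod ` eigenvalues A) \<in> cmod ` eigenvalues A"
    and low: "\<And>n x. norm ((Ai ^^ n) x) \<le> c * (real n + 1) * (1 / Min (cmod ` eigenvalues A)) ^ n * norm x"
    and up: "\<And>n. norm ((A ^^ n) v) \<le> c * (real n + 1) * Min (cmod ` eigenvalues A) ^ n * norm v"
    by (rule linear_expansion[OF linA detA]) blast
  define lam where "lam = Min (cmod ` eigenvalues A)"
  have lam1: "lam > 1" using lamin expanding unfolding lam_def by auto
  \<comment> \<open>Made positive so that it may serve as a factor of a denominator.\<close>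
  define R' where "R' = max R 1"
  obtain \<delta> where delta: "\<delta> > 0" "\<And>p x. p \<in> zero_edges X \<A> f C \<times> zero_edges X \<A> f C \<Longrightarrow>
      fst p \<inter> snd p = {} \<and> fst p \<noteq> {} \<and> P x \<in> snd p \<Longrightarrow> \<delta> \<le> infdist x (P -` fst p)"
  proof (rule finite_uniform_lower_bound[of "zero_edges X \<A> f C \<times> zero_edges X \<A> f C"
        "\<lambda>p x. fst p \<inter> snd p = {} \<and> fst p \<noteq> {} \<and> P x \<in> snd p" "\<lambda>p x. infdist x (P -` fst p)"])
    show "finite (zero_edges X \<A> f C \<times> zero_edges X \<A> f C)" using ZE(1) by simp
    fix p assume p: "p \<in> zero_edges X \<A> f C \<times> zero_edges X \<A> f C"
    show "\<exists>d>0. \<forall>x. fst p \<inter> snd p = {} \<and> fst p \<noteq> {} \<and> P x \<in> snd p \<longrightarrow> d \<le> infdist x (P -` fst p)"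
    proof (cases "fst p \<inter> snd p = {} \<and> fst p \<noteq> {}")
      case True
      then show ?thesis using disjoint_closed_separated[of "fst p" "snd p"] ZE(2) p by auto
    next
      case False
      then show ?thesis by (intro exI[of _ 1]) auto
    qed
  qed blast
  have AiA: "(Ai ^^ n) ((A ^^ n) x) = x" for n x
  proof (induction n arbitrary: x)
    case (Suc n)
    have "(Ai ^^ Suc n) ((A ^^ Suc n) x) = Ai ((Ai ^^ n) ((A ^^ n) (A x)))" by (simp only: funpow.simps(2) o_apply) (simp only: funpow_swap1)
    then show ?case using Suc Ai by simp
  qed simp
  \<comment> \<open>Applying the inverse of \<open>A ^^ n\<close> to a difference of norm at most
    \<open>R'\<close> bounds the diameter of a lift at level n.\<close>
  have eps: "dist x y \<le> c * (real n + 1) * (1 / lam) ^ n * R'" if U: "U \<in> components (P -` Y C n)" "x \<in> U" "y \<in> U" for U x y n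
  proof -
    have "dist ((hmap ^^ n) x) ((hmap ^^ n) y) \<le> R'" using component_hmap_dist[OF ctx U] by (simp add: R'_def)
    then have "norm ((A ^^ n) (x - y)) \<le> R'" unfolding dist_norm affine_funpow_diff[OF linA] .
    then have "c * (real n + 1) * (1 / lam) ^ n * norm ((A ^^ n) (x - y)) \<le> c * (real n + 1) * (1 / lam) ^ n * R'"
      using c lam1 by (intro mult_left_mono) auto
    then show ?thesis using low[where n = n and x = "(A ^^ n) (x - y)"] unfolding AiA lam_def[symmetric] dist_norm by linarith
  qed
  obtain N where N: "\<forall>x. finite {U \<in> components (P -` Y C 0). closure U \<inter> cball x 1 \<noteq> {}}"
    "\<forall>x. card {U \<in> components (P -` Y C 0). closure U \<inter> cball x 1 \<noteq> {}} \<le> N"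
    by (rule finitely_many_components_near[OF ctx])
  obtain la where la: "la \<in> L" "a = P ((1 / 2) *\<^sub>R la)" using a unfolding post_eq by blast
  define c1 where "c1 = (1 / 2) *\<^sub>R la"
  \<comment> \<open>A segment longer than \<open>R\<close> cannot avoid the corner arc, so the
    segment that leaves the lift \<open>c1\<close> of \<open>a\<close> in the slow direction
    \<open>v\<close> meets the arc after a multiple \<open>w\<close> of \<open>v\<close>.\<close>
  define S where "S = (R' + 1) / norm v"
  have S: "norm (S *\<^sub>R v) > R" "S > 0" using v by (auto simp: S_def R'_def)
  have "P ` path_image (linepath c1 (c1 + S *\<^sub>R v)) \<inter> g ` {0..1} \<noteq> {}"
  proof
    assume "P ` path_image (linepath c1 (c1 + S *\<^sub>R v)) \<inter> g ` {0..1} = {}"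
    then have "dist c1 (c1 + S *\<^sub>R v) \<le> R" using R[of "linepath c1 (c1 + S *\<^sub>R v)"] by simp
    then show False using S by (simp add: dist_norm)
  qed
  then obtain z where z: "z \<in> closed_segment c1 (c1 + S *\<^sub>R v)" "P z \<in> g ` {0..1}" by auto
  obtain t where t: "0 \<le> t" "t \<le> 1" "z = (1 - t) *\<^sub>R c1 + t *\<^sub>R (c1 + S *\<^sub>R v)"
    using z(1) unfolding closed_segment_def by blast
  define w where "w = (t * S) *\<^sub>R v"
  have zw: "z = c1 + w" unfolding t(3) w_def by (simp add: algebra_simps)
  obtain e e' where e: "e \<in> zero_edges X \<A> f C" "e' \<in> zero_edges X \<A> f C" "e \<inter> e' = {}" "a \<in> e" "P z \<in> e'"
    using opp z(2) by blast
  have ac1: "P c1 \<in> e" using e(4) la(2) by (simp add: c1_def)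
  have nw: "norm ((A ^^ n) w) \<le> S * (c * (real n + 1) * lam ^ n * norm v)" for n
  proof -
    have "norm ((A ^^ n) w) = t * S * norm ((A ^^ n) v)"
      unfolding w_def linear_scale[OF funpow_linear[OF linA]] using t(1) S(2) by simp
    also have "\<dots> \<le> 1 * S * norm ((A ^^ n) v)" using t(2) S(2) by (intro mult_right_mono) auto
    also have "\<dots> \<le> S * (c * (real n + 1) * lam ^ n * norm v)"
      using up[of n] S(2) by (simp add: lam_def mult_left_mono)
    finally show ?thesis .
  qed
  let ?D = "\<lambda>n. min_tiles X \<A> f C n"
  let ?ok = "\<lambda>n k. \<exists>\<T>\<subseteq>tiles X f C n. finite \<T> \<and> card \<T> = k \<and> connectedin X (\<Union>\<T>) \<and> joins_opposite_sides X \<A> f C (\<Union>\<T>)"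
  \<comment> \<open>The chain along the segment shows that the minimum in \<open>min_tiles\<close>
    is attained, and bounds it from above.\<close>
  have Dn: "?ok n (?D n) \<and> real (?D n) \<le> (norm ((A ^^ n) w) + 3) * real N" for n
  proof -
    obtain \<T> where T: "\<T> \<subseteq> tiles X f C n" "finite \<T>" "real (card \<T>) \<le> (norm ((A ^^ n) w) + 3) * real N"
      "connectedin X (\<Union>\<T>)" "joins_opposite_sides X \<A> f C (\<Union>\<T>)"
      by (rule segment_tile_chain[OF ctx Ai spec[OF N(1)] spec[OF N(2)] e(1,2,3) ac1 e(5)[unfolded zw], of n])
    have ok: "?ok n (card \<T>)" using T by blast
    have "?ok n (?D n)" unfolding min_tiles_def by (rule LeastI[of "?ok n", OF ok])
    moreover have "?D n \<le> card \<T>" unfolding min_tiles_def by (rule Least_le[of "?ok n", OF ok])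
    ultimately show ?thesis using T(3) by (meson of_nat_mono order_trans)
  qed
  have lower: "\<delta> / (2 * c * R') * lam ^ n \<le> real (?D n) * (real n + 1)" for n
  proof -
    obtain \<T> where T: "\<T> \<subseteq> tiles X f C n" "finite \<T>" "card \<T> = ?D n"
      "connectedin X (\<Union>\<T>)" "joins_opposite_sides X \<A> f C (\<Union>\<T>)" using Dn[of n] by blast
    have "\<delta> \<le> 2 * real (card \<T>) * (c * (real n + 1) * (1 / lam) ^ n * R')"
    proof (rule tile_chain_lower_bound[OF C g(2) _ T(1,2,4,5) delta(1)])
      fix e e' x assume "e \<in> zero_edges X \<A> f C" "e' \<in> zero_edges X \<A> f C" "e \<inter> e' = {}" "e \<noteq> {}" "P x \<in> e'"
      then show "\<delta> \<le> infdist x (P -` e)" using delta(2)[of "(e, e')" x] by simp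
    qed (erule (1) R, erule (2) eps)
    then have "\<delta> \<le> (2 * c * R') * (real (?D n) * (real n + 1)) / lam ^ n"
      unfolding T(3) by (simp add: power_one_over divide_inverse mult_ac power_inverse)
    moreover have "lam ^ n > 0" using lam1 by simp
    ultimately have "\<delta> * lam ^ n \<le> (2 * c * R') * (real (?D n) * (real n + 1))" by (simp add: pos_le_divide_eq)
    moreover have "2 * c * R' > 0" using c by (simp add: R'_def)
    ultimately show ?thesis by (simp add: pos_divide_le_eq mult.commute)
  qed
  \<comment> \<open>The additive 3 is absorbed by \<open>1 \<le> (real n + 1) * lam ^ n\<close>; the
    factor \<open>real N + 1\<close> keeps the constant positive even for N = 0.\<close>
  define B where "B = (S * c * norm v + 3) * (real N + 1)"
  have upper: "real (?D n) \<le> B * (real n + 1) * lam ^ n" for n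
  proof -
    have g1: "1 \<le> (real n + 1) * lam ^ n"
      using mult_mono[of 1 "real n + 1" 1 "lam ^ n"] lam1 by (simp add: one_le_power)
    have "real (?D n) \<le> (norm ((A ^^ n) w) + 3) * real N" using Dn by blast
    also have "\<dots> \<le> (S * (c * (real n + 1) * lam ^ n * norm v) + 3 * ((real n + 1) * lam ^ n)) * (real N + 1)"
      using nw[of n] g1 order_trans[OF norm_ge_zero nw[of n]] by (intro mult_mono add_mono) (auto intro!: add_nonneg_nonneg)
    also have "\<dots> = B * (real n + 1) * lam ^ n" by (simp add: B_def algebra_simps)
    finally show ?thesis .
  qed
  have "B > 0" unfolding B_def using S(2) c v by (intro mult_pos_pos add_nonneg_pos) auto
  moreover have "\<delta> / (2 * c * R') > 0" using delta(1) c by (simp add: R'_def)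
  ultimately show ?thesis
    using root_tendsto_growth_rate[OF _ _ _ lower upper] lam1 unfolding lam_def[symmetric] by simp
qed

end

theorem corollary2p3:
  fixes X :: "'a topology" and \<A> :: "'a chart set"
    and f :: "'a \<Rightarrow> 'a" and A :: "real^2 \<Rightarrow> real^2"
  assumes "oriented_sphere X \<A>"
    and "lattes_type_map X \<A> f"
    and "has_orbifold_type X \<A> f [2, 2, 2, 2]"
    and "lattes_linear_map X \<A> f A"
  shows "combinatorial_expansion_factor X \<A> f = Min (cmod ` eigenvalues A)"
proof -
  have sphereX: "X homeomorphic_space top_of_set (sphere (0 :: real^3) 1)"
    and charts: "\<And>c. c \<in> \<A> \<Longrightarrow> is_chart X c"
    using assms(1) unfolding oriented_sphere_def oriented_atlas_def by blast+
  have hausX: "Hausdorff_space X"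
    unfolding homeomorphic_Hausdorff_space[OF sphereX] by (intro Hausdorff_space_subtopology) simp
  have "connected (sphere (0 :: real^3) 1)" by (intro connected_sphere) simp
  then have connX: "connected_space X"
    unfolding homeomorphic_connected_space[OF sphereX] by (simp add: connected_space_subtopology)
  obtain L G act \<Theta> g where L: "rank2_lattice L" and g: "torus_endomorphism_of L g A"
    and expanding: "\<forall>k\<in>eigenvalues A. cmod k > 1"
    and G: "group (G :: int monoid)" "cyclic_group G" "finite (carrier G)"
    and cover: "branched_covering_map (torus L) (torus_atlas L) X \<A> \<Theta>"
    and ind: "induced_by_rigid_action L G act \<Theta>"
    and f: "\<forall>t\<in>topspace (torus L). f (\<Theta> t) = \<Theta> (g t)"
    using assms(4) unfolding lattes_linear_map_def by (elim exE conjE)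
  obtain b where linA: "linear A" and detA: "det (matrix A) > 0"
    and b: "\<And>x. g (torus_proj L x) = torus_proj L (A x + b)"
    using g unfolding torus_endomorphism_of_def by blast
  have semiconj: "f (\<Theta> (torus_proj L x)) = \<Theta> (torus_proj L (A x + b))" for x
    using bspec[OF f, of "torus_proj L x"] by (simp add: topspace_torus b)
  interpret lp: lattes_presentation X \<A> f A L \<Theta> b
    by (rule lattes_presentation.intro) (fact charts connX hausX L linA detA expanding cover semiconj)+
  obtain x0 where x0: "\<forall>x y. lp.Pr (x0 + x) = lp.Pr (x0 + y) \<longleftrightarrow> x - y \<in> L \<or> x + y \<in> L"
    and post: "post X \<A> f = (\<lambda>l. lp.Pr (x0 + (1 / 2) *\<^sub>R l)) ` L" and card: "card (post X \<A> f) = 4"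
  proof (rule lp.pillow_structure[OF G ind assms(3)])
    fix x0
    assume "\<And>x y. lp.Pr (x0 + x) = lp.Pr (x0 + y) \<longleftrightarrow> x - y \<in> L \<or> x + y \<in> L"
      "post X \<A> f = (\<lambda>l. lp.Pr (x0 + (1 / 2) *\<^sub>R l)) ` L" "card (post X \<A> f) = 4"
    then show thesis by (intro that) blast+
  qed
  \<comment> \<open>With the base point moved to the branch point \<open>x0\<close>, the lift of
    \<open>f\<close> has the translation part \<open>A x0 + b - x0\<close>.\<close>
  define P where "P = (\<lambda>x. lp.Pr (x0 + x))"
  have P_comp: "P = lp.Pr \<circ> (+) x0" by (simp add: P_def fun_eq_iff)
  have contP: "continuous_map euclidean X P"
    unfolding P_comp by (intro continuous_map_compose[OF _ lp.continuous_Pr]) (simp add: continuous_on_add)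
  have openP: "open_map euclidean X P"
    unfolding P_comp by (intro open_map_compose[OF _ lp.open_Pr]) (simp add: open_map_def open_translation)
  have rangeP: "range P = topspace X"
    unfolding P_comp image_comp[symmetric] by (simp add: lp.range_Pr)
  have f_P: "f (P x) = P (A x + (A x0 + b - x0))" for x
    by (simp add: P_def lp.f_Pr linear_add[OF linA] algebra_simps)
  interpret pm: pillow_map X L P \<A> f A "A x0 + b - x0"
  proof (intro pillow_map.intro pillow.intro pillow_map_axioms.intro)
    show "P x = P y \<longleftrightarrow> x - y \<in> L \<or> x + y \<in> L" for x y unfolding P_def by (rule x0[rule_format])
    show "post X \<A> f = (\<lambda>l. P ((1 / 2) *\<^sub>R l)) ` L" unfolding P_def by (rule post)
  qed (fact hausX L contP openP rangeP sphereX linA detA expanding f_P card)+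
  \<comment> \<open>Some admissible curve must exist: otherwise every real number would satisfy the
    condition that defines the expansion factor.\<close>
  have "finite (post X \<A> f)" using card by (metis card.infinite zero_neq_numeral)
  moreover have "post X \<A> f \<subseteq> topspace X" unfolding post by (auto simp: lp.range_Pr[symmetric])
  ultimately obtain C where C: "jordan_curve X C" "post X \<A> f \<subseteq> C" by (rule jordan_curve_through[OF sphereX])
  show ?thesis
    unfolding combinatorial_expansion_factor_def
  proof (rule the_equality)
    show "\<forall>C. jordan_curve X C \<and> post X \<A> f \<subseteq> C \<longrightarrow>
        (\<lambda>n. root n (real (min_tiles X \<A> f C n))) \<longlonglongrightarrow> Min (cmod ` eigenvalues A)"
      using pm.min_tiles_growth by blast
    fix l assume "\<forall>C. jordan_curve X C \<and> post X \<A> f \<subseteq> C \<longrightarrow>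
        (\<lambda>n. root n (real (min_tiles X \<A> f C n))) \<longlonglongrightarrow> l"
    then show "l = Min (cmod ` eigenvalues A)" using C pm.min_tiles_growth[OF C] LIMSEQ_unique by blast
  qed
qed

end
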